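(* Let $\mathbb{K}=\mathbb{C}$ and let $H$ be the free Hopf algebra generated by the coalgebra $(\mathbb{C}^{2\times 2})^\ast$ dual to the algebra of $2\times 2$ complex matrices, with matrix coefficients $a^i_j\in H$ ($i,j\in\{0,1\}$). Let $M:=H\oplus H$ as a left $H$-module, and define $$\overline\delta:M\to M\otimes H,$$ $$\overline\delta(k^0,k^1):=\left(k^0_{(0)},0\right)\otimes k^0_{(1)}a^0_0+\left(k^1_{(0)},0\right)\otimes k^1_{(1)}a^0_1+\left(0,k^0_{(0)}\right)\otimes k^0_{(1)}a^1_0+\left(0,k^1_{(0)}\right)\otimes k^1_{(1)}a^1_1,$$ where $\Delta(h)=h_{(0)}\otimes h_{(1)}$ in sumless Sweedler notation. Then $\overline\delta$ is a right coaction of $H$ on $M$ over $\Delta$, so that it makes $M$ a left-right relative $(H,H)$-Hopf module (with $\Delta$ regarded as a right coaction of $H$ on the algebra $H$), but the corresponding left $(H\otimes H)$-module homomorphism $$\rho:(H\otimes H)_\Delta\otimes_H M\to M\otimes H,\qquad \rho(x\otimes m)=x\,\overline\delta(m)\quad (x\in H\otimes H,\ m\in M),$$ is not an isomorphism.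
   Context: Unadorned tensor products are over $\mathbb{C}$; algebras are associative and unital, modules unital, comodules coassociative and counital. The free Hopf algebra $H$ generated by a coalgebra $C$ is the Hopf algebra equipped with a coalgebra morphism $C\to H$ that is universal among coalgebra morphisms from $C$ into Hopf algebras. For $C=(\mathbb{C}^{2\times 2})^\ast$, the $a^i_j$ denote the images in $H$ of the matrix coefficients (the basis of $C$ dual to the matrix units), so that $\Delta(a^i_j)=\sum_l a^i_l\otimes a^l_j$ and $\varepsilon(a^i_j)$ is $1$ if $i=j$ and $0$ otherwise, where $\Delta$ and $\varepsilon$ are the comultiplication and counit of $H$. $(H\otimes H)_\Delta$ denotes $H\otimes H$ with the right $H$-module structure induced by the algebra homomorphism $\Delta:H\to H\otimes H$. $M\otimes H$ is a left $(H\otimes H)$-module by $(h\otimes h')(m\otimes k)=hm\otimes h'k$. A left-right relative $(A,H)$-Hopf module, for an algebra $A$ with a right algebra coaction $\delta:A\to A\otimes H$, is a left $A$-module $M$ with a right $H$-comodule structure $\overline\delta:M\to M\otimes H$ which is "over $\delta$", i.e. $\overline\delta(am)=\delta(a)\overline\delta(m)$ for all $a\in A$, $m\in M$. *)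

theory Defs
  imports "HOL-Analysis.Finite_Cartesian_Product" "HOL-Library.Numeral_Type"
    "HOL-Algebra.Module" "HOL-Algebra.Free_Abelian_Groups"
begin

section \<open>Vector spaces, algebras and modules\<close>

definition complex_ring :: "complex ring" where
  "complex_ring = \<lparr>carrier = UNIV, monoid.mult = (*), one = 1, ring.zero = 0, add = (+)\<rparr>"

text \<open>A complex vector space is a \<open>module complex_ring V\<close>. The record of a vector space also has
  fields \<open>mult\<close> and \<open>one\<close>; they are used exactly when it carries an algebra. The library locale
  \<open>algebra\<close> is restricted to commutative algebras, hence the following one.\<close>

locale complex_algebra = module complex_ring A + ring A for A (structure) +
  assumes smult_mult_left:
      "\<lbrakk>x \<in> carrier A; y \<in> carrier A\<rbrakk> \<Longrightarrow> (c \<odot> x) \<otimes> y = c \<odot> (x \<otimes> y)"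
    and smult_mult_right:
      "\<lbrakk>x \<in> carrier A; y \<in> carrier A\<rbrakk> \<Longrightarrow> x \<otimes> (c \<odot> y) = c \<odot> (x \<otimes> y)"

text \<open>Unital left modules; the library locale \<open>module\<close> has commutative coefficient rings only.\<close>

locale left_module = R?: ring R + M?: abelian_group M for R (structure) and M (structure) +
  assumes act_closed: "\<lbrakk>a \<in> carrier R; x \<in> carrier M\<rbrakk> \<Longrightarrow> a \<odot>\<^bsub>M\<^esub> x \<in> carrier M"
    and act_l_distr: "\<lbrakk>a \<in> carrier R; b \<in> carrier R; x \<in> carrier M\<rbrakk> \<Longrightarrow>
      (a \<oplus>\<^bsub>R\<^esub> b) \<odot>\<^bsub>M\<^esub> x = a \<odot>\<^bsub>M\<^esub> x \<oplus>\<^bsub>M\<^esub> b \<odot>\<^bsub>M\<^esub> x"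
    and act_r_distr: "\<lbrakk>a \<in> carrier R; x \<in> carrier M; y \<in> carrier M\<rbrakk> \<Longrightarrow>
      a \<odot>\<^bsub>M\<^esub> (x \<oplus>\<^bsub>M\<^esub> y) = a \<odot>\<^bsub>M\<^esub> x \<oplus>\<^bsub>M\<^esub> a \<odot>\<^bsub>M\<^esub> y"
    and act_assoc: "\<lbrakk>a \<in> carrier R; b \<in> carrier R; x \<in> carrier M\<rbrakk> \<Longrightarrow>
      (a \<otimes>\<^bsub>R\<^esub> b) \<odot>\<^bsub>M\<^esub> x = a \<odot>\<^bsub>M\<^esub> (b \<odot>\<^bsub>M\<^esub> x)"
    and act_one: "x \<in> carrier M \<Longrightarrow> \<one>\<^bsub>R\<^esub> \<odot>\<^bsub>M\<^esub> x = x"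

definition left_module_hom ::
  "('r, 'k) ring_scheme \<Rightarrow> ('r, 'm, 'x) module_scheme \<Rightarrow> ('r, 'n, 'y) module_scheme \<Rightarrow> ('m \<Rightarrow> 'n) set" where
  "left_module_hom R M N = {f \<in> carrier M \<rightarrow> carrier N.
     (\<forall>x\<in>carrier M. \<forall>y\<in>carrier M. f (x \<oplus>\<^bsub>M\<^esub> y) = f x \<oplus>\<^bsub>N\<^esub> f y) \<and>
     (\<forall>r\<in>carrier R. \<forall>x\<in>carrier M. f (r \<odot>\<^bsub>M\<^esub> x) = r \<odot>\<^bsub>N\<^esub> f x)}"

definition left_module_iso ::
  "('r, 'k) ring_scheme \<Rightarrow> ('r, 'm, 'x) module_scheme \<Rightarrow> ('r, 'n, 'y) module_scheme \<Rightarrow> ('m \<Rightarrow> 'n) set" where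
  "left_module_iso R M N = {f \<in> left_module_hom R M N. bij_betw f (carrier M) (carrier N)}"

abbreviation linear_maps ::
  "(complex, 'v, 'x) module_scheme \<Rightarrow> (complex, 'w, 'y) module_scheme \<Rightarrow> ('v \<Rightarrow> 'w) set" where
  "linear_maps \<equiv> left_module_hom complex_ring"

definition regular_module :: "('a, 'k) ring_scheme \<Rightarrow> ('a, 'a) module" where
  "regular_module A = \<lparr>carrier = carrier A, monoid.mult = undefined, one = undefined,
     ring.zero = \<zero>\<^bsub>A\<^esub>, add = (\<oplus>\<^bsub>A\<^esub>), smult = (\<otimes>\<^bsub>A\<^esub>)\<rparr>"

definition module_sum ::
  "('r, 'm, 'x) module_scheme \<Rightarrow> ('r, 'n, 'y) module_scheme \<Rightarrow> ('r, 'm \<times> 'n) module" where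
  "module_sum M N = \<lparr>carrier = carrier M \<times> carrier N, monoid.mult = undefined, one = undefined,
     ring.zero = (\<zero>\<^bsub>M\<^esub>, \<zero>\<^bsub>N\<^esub>),
     add = (\<lambda>(x, y) (x', y'). (x \<oplus>\<^bsub>M\<^esub> x', y \<oplus>\<^bsub>N\<^esub> y')),
     smult = (\<lambda>r (x, y). (r \<odot>\<^bsub>M\<^esub> x, r \<odot>\<^bsub>N\<^esub> y))\<rparr>"

text \<open>The complex vector space underlying a left module over a complex algebra.\<close>

definition underlying_space ::
  "(complex, 'a, 'k) module_scheme \<Rightarrow> ('a, 'm, 'x) module_scheme \<Rightarrow> (complex, 'm) module" where
  "underlying_space A M = \<lparr>carrier = carrier M, monoid.mult = undefined, one = undefined,
     ring.zero = \<zero>\<^bsub>M\<^esub>, add = (\<oplus>\<^bsub>M\<^esub>),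
     smult = (\<lambda>c x. (c \<odot>\<^bsub>A\<^esub> \<one>\<^bsub>A\<^esub>) \<odot>\<^bsub>M\<^esub> x)\<rparr>"


section \<open>Tensor products\<close>

text \<open>For a right \<open>R\<close>-module \<open>A\<close> (with right action \<open>ract\<close>) and a left \<open>R\<close>-module \<open>B\<close>, the group
  \<open>A \<otimes>\<^sub>R B\<close> is the free abelian group on \<open>carrier A \<times> carrier B\<close> modulo the usual relations.\<close>

type_synonym ('a, 'b) tensor = "('a \<times> 'b \<Rightarrow>\<^sub>0 int) set"

definition tensor_relations ::
  "('r, 'k) ring_scheme \<Rightarrow> ('a, 'x) ring_scheme \<Rightarrow> ('a \<Rightarrow> 'r \<Rightarrow> 'a) \<Rightarrow> ('r, 'b, 'y) module_scheme
     \<Rightarrow> ('a \<times> 'b \<Rightarrow>\<^sub>0 int) set" where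
  "tensor_relations R A ract B =
     {frag_of (a \<oplus>\<^bsub>A\<^esub> a', b) - frag_of (a, b) - frag_of (a', b) | a a' b.
        a \<in> carrier A \<and> a' \<in> carrier A \<and> b \<in> carrier B} \<union>
     {frag_of (a, b \<oplus>\<^bsub>B\<^esub> b') - frag_of (a, b) - frag_of (a, b') | a b b'.
        a \<in> carrier A \<and> b \<in> carrier B \<and> b' \<in> carrier B} \<union>
     {frag_of (ract a r, b) - frag_of (a, r \<odot>\<^bsub>B\<^esub> b) | a r b.
        a \<in> carrier A \<and> r \<in> carrier R \<and> b \<in> carrier B}"

definition tensor_null ::
  "('r, 'k) ring_scheme \<Rightarrow> ('a, 'x) ring_scheme \<Rightarrow> ('a \<Rightarrow> 'r \<Rightarrow> 'a) \<Rightarrow> ('r, 'b, 'y) module_scheme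
     \<Rightarrow> ('a \<times> 'b \<Rightarrow>\<^sub>0 int) set" where
  "tensor_null R A ract B =
     generate (free_Abelian_group (carrier A \<times> carrier B)) (tensor_relations R A ract B)"

definition pure_tensor_over ::
  "('r, 'k) ring_scheme \<Rightarrow> ('a, 'x) ring_scheme \<Rightarrow> ('a \<Rightarrow> 'r \<Rightarrow> 'a) \<Rightarrow> ('r, 'b, 'y) module_scheme
     \<Rightarrow> 'a \<Rightarrow> 'b \<Rightarrow> ('a, 'b) tensor" where
  "pure_tensor_over R A ract B a b =
     tensor_null R A ract B #>\<^bsub>free_Abelian_group (carrier A \<times> carrier B)\<^esub> frag_of (a, b)"

text \<open>\<open>tensor_lift G f\<close> is the homomorphism from a tensor product to the abelian group \<open>G\<close> (written
  additively) with \<open>a \<otimes> b \<mapsto> f a b\<close>. It is meaningful for balanced biadditive \<open>f\<close> only: then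
  \<open>free_lift G f\<close> is constant on each coset.\<close>

definition free_lift :: "('g, 'z) ring_scheme \<Rightarrow> ('a \<Rightarrow> 'b \<Rightarrow> 'g) \<Rightarrow> ('a \<times> 'b \<Rightarrow>\<^sub>0 int) \<Rightarrow> 'g" where
  "free_lift G f t =
     (\<Oplus>\<^bsub>G\<^esub>p\<in>Poly_Mapping.keys t. [Poly_Mapping.lookup t p] \<cdot>\<^bsub>G\<^esub> f (fst p) (snd p))"

definition tensor_lift :: "('g, 'z) ring_scheme \<Rightarrow> ('a \<Rightarrow> 'b \<Rightarrow> 'g) \<Rightarrow> ('a, 'b) tensor \<Rightarrow> 'g" where
  "tensor_lift G f X = the_elem (free_lift G f ` X)"

definition tensor_group ::
  "('r, 'k) ring_scheme \<Rightarrow> ('a, 'x) ring_scheme \<Rightarrow> ('a \<Rightarrow> 'r \<Rightarrow> 'a) \<Rightarrow> ('r, 'b, 'y) module_scheme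
     \<Rightarrow> ('a, 'b) tensor ring" where
  "tensor_group R A ract B =
     (let Q = free_Abelian_group (carrier A \<times> carrier B) Mod tensor_null R A ract B in
      \<lparr>carrier = carrier Q, monoid.mult = undefined, one = undefined,
       ring.zero = \<one>\<^bsub>Q\<^esub>, add = (\<otimes>\<^bsub>Q\<^esub>)\<rparr>)"

text \<open>If \<open>A\<close> is an \<open>(S, R)\<close>-bimodule (its left action being the \<open>smult\<close> of the record \<open>A\<close>), then
  \<open>A \<otimes>\<^sub>R B\<close> is a left \<open>S\<close>-module.\<close>

definition tensor_over ::
  "('r, 'k) ring_scheme \<Rightarrow> ('s, 'a, 'x) module_scheme \<Rightarrow> ('a \<Rightarrow> 'r \<Rightarrow> 'a) \<Rightarrow> ('r, 'b, 'y) module_scheme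
     \<Rightarrow> ('s, ('a, 'b) tensor) module" where
  "tensor_over R A ract B = (let T = tensor_group R A ract B in
     \<lparr>carrier = carrier T, monoid.mult = undefined, one = undefined, ring.zero = \<zero>\<^bsub>T\<^esub>, add = (\<oplus>\<^bsub>T\<^esub>),
      smult = (\<lambda>s. tensor_lift T (\<lambda>a b. pure_tensor_over R A ract B (s \<odot>\<^bsub>A\<^esub> a) b))\<rparr>)"

definition tensor_space ::
  "(complex, 'v, 'x) module_scheme \<Rightarrow> (complex, 'w, 'y) module_scheme
     \<Rightarrow> (complex, ('v, 'w) tensor) module" where
  "tensor_space V W = tensor_over complex_ring V (\<lambda>v c. c \<odot>\<^bsub>V\<^esub> v) W"

definition pure_tensor ::
  "(complex, 'v, 'x) module_scheme \<Rightarrow> (complex, 'w, 'y) module_scheme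
     \<Rightarrow> 'v \<Rightarrow> 'w \<Rightarrow> ('v, 'w) tensor" where
  "pure_tensor V W = pure_tensor_over complex_ring V (\<lambda>v c. c \<odot>\<^bsub>V\<^esub> v) W"

text \<open>The linear map \<open>f \<otimes> g\<close> with codomain \<open>V' \<otimes> W'\<close>.\<close>

definition tensor_map ::
  "(complex, 'v1, 'x) module_scheme \<Rightarrow> (complex, 'w1, 'y) module_scheme
     \<Rightarrow> ('v \<Rightarrow> 'v1) \<Rightarrow> ('w \<Rightarrow> 'w1) \<Rightarrow> ('v, 'w) tensor \<Rightarrow> ('v1, 'w1) tensor" where
  "tensor_map V' W' f g = tensor_lift (tensor_space V' W') (\<lambda>v w. pure_tensor V' W' (f v) (g w))"

text \<open>The isomorphism \<open>(U \<otimes> V) \<otimes> W \<rightarrow> U \<otimes> (V \<otimes> W)\<close>.\<close>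

definition tensor_assoc ::
  "(complex, 'u, 'x) module_scheme \<Rightarrow> (complex, 'v, 'y) module_scheme \<Rightarrow> (complex, 'w, 'z) module_scheme
     \<Rightarrow> (('u, 'v) tensor, 'w) tensor \<Rightarrow> ('u, ('v, 'w) tensor) tensor" where
  "tensor_assoc U V W =
     (let T = tensor_space U (tensor_space V W) in
      tensor_lift T (\<lambda>X w. tensor_lift T
        (\<lambda>u v. pure_tensor U (tensor_space V W) u (pure_tensor V W v w)) X))"

definition tensor_algebra ::
  "(complex, 'a, 'x) module_scheme \<Rightarrow> (complex, 'b, 'y) module_scheme
     \<Rightarrow> (complex, ('a, 'b) tensor) module" where
  "tensor_algebra A B = (tensor_space A B)
     \<lparr>monoid.mult := (\<lambda>X Y. tensor_lift (tensor_space A B)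
        (\<lambda>a b. tensor_lift (tensor_space A B)
          (\<lambda>a' b'. pure_tensor A B (a \<otimes>\<^bsub>A\<^esub> a') (b \<otimes>\<^bsub>B\<^esub> b')) Y) X),
      one := pure_tensor A B \<one>\<^bsub>A\<^esub> \<one>\<^bsub>B\<^esub>\<rparr>"

text \<open>For a left \<open>A\<close>-module \<open>M\<close>, the left \<open>(A \<otimes> H)\<close>-module \<open>M \<otimes> H\<close> with
  \<open>(a \<otimes> h) (m \<otimes> k) = a m \<otimes> h k\<close>.\<close>

definition tensor_left_module ::
  "(complex, 'a, 'x) module_scheme \<Rightarrow> ('a, 'm, 'y) module_scheme \<Rightarrow> (complex, 'h, 'z) module_scheme
     \<Rightarrow> (('a, 'h) tensor, ('m, 'h) tensor) module" where
  "tensor_left_module A M H = (let V = underlying_space A M; T = tensor_space V H in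
     \<lparr>carrier = carrier T, monoid.mult = undefined, one = undefined, ring.zero = \<zero>\<^bsub>T\<^esub>, add = (\<oplus>\<^bsub>T\<^esub>),
      smult = (\<lambda>X Y. tensor_lift T
        (\<lambda>a h. tensor_lift T (\<lambda>m k. pure_tensor V H (a \<odot>\<^bsub>M\<^esub> m) (h \<otimes>\<^bsub>H\<^esub> k)) Y) X)\<rparr>)"


section \<open>Coalgebras and Hopf algebras\<close>

text \<open>For a coalgebra without multiplication the fields \<open>mult\<close> and \<open>one\<close> are ignored.\<close>

record 'a coalg = "(complex, 'a) module" +
  comult :: "'a \<Rightarrow> ('a, 'a) tensor"
  counit :: "'a \<Rightarrow> complex"

locale coalgebra = module complex_ring C for C (structure) +
  assumes comult_linear: "comult C \<in> linear_maps C (tensor_space C C)"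
    and counit_linear: "counit C \<in> linear_maps C (regular_module complex_ring)"
    and coassoc: "x \<in> carrier C \<Longrightarrow>
      tensor_map C (tensor_space C C) (\<lambda>y. y) (comult C) (comult C x) =
      tensor_assoc C C C (tensor_map (tensor_space C C) C (comult C) (\<lambda>y. y) (comult C x))"
    and counit_left: "x \<in> carrier C \<Longrightarrow> tensor_lift C (\<lambda>y z. counit C y \<odot> z) (comult C x) = x"
    and counit_right: "x \<in> carrier C \<Longrightarrow> tensor_lift C (\<lambda>y z. counit C z \<odot> y) (comult C x) = x"

definition coalgebra_hom :: "('a, 'x) coalg_scheme \<Rightarrow> ('b, 'y) coalg_scheme \<Rightarrow> ('a \<Rightarrow> 'b) set" where
  "coalgebra_hom C D = {f \<in> linear_maps C D. \<forall>x\<in>carrier C.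
     comult D (f x) = tensor_map D D f f (comult C x) \<and> counit D (f x) = counit C x}"

locale bialgebra = complex_algebra H + coalgebra H for H (structure) +
  assumes comult_ring_hom: "comult H \<in> ring_hom H (tensor_algebra H H)"
    and counit_ring_hom: "counit H \<in> ring_hom H complex_ring"

definition is_antipode :: "('a, 'x) coalg_scheme \<Rightarrow> ('a \<Rightarrow> 'a) \<Rightarrow> bool" where
  "is_antipode H S \<longleftrightarrow> S \<in> linear_maps H H \<and> (\<forall>x\<in>carrier H.
     tensor_lift H (\<lambda>y z. S y \<otimes>\<^bsub>H\<^esub> z) (comult H x) = counit H x \<odot>\<^bsub>H\<^esub> \<one>\<^bsub>H\<^esub> \<and>
     tensor_lift H (\<lambda>y z. y \<otimes>\<^bsub>H\<^esub> S z) (comult H x) = counit H x \<odot>\<^bsub>H\<^esub> \<one>\<^bsub>H\<^esub>)"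

locale hopf_algebra = bialgebra H for H (structure) +
  assumes antipode: "\<exists>S. is_antipode H S"

text \<open>Bialgebra homomorphisms; between Hopf algebras they commute with the antipodes.\<close>

definition hopf_hom :: "('a, 'x) coalg_scheme \<Rightarrow> ('b, 'y) coalg_scheme \<Rightarrow> ('a \<Rightarrow> 'b) set" where
  "hopf_hom H K = coalgebra_hom H K \<inter> ring_hom H K"

text \<open>The Hopf algebras \<open>K\<close> in the universal property have their carriers in the type \<open>'h\<close> that also
  holds \<open>H\<close>; HOL cannot quantify over types within a formula. For a coalgebra \<open>C\<close> that has at most
  continuum many elements this is no restriction. A Hopf algebra is nonzero, so \<open>'h\<close>
  has at least the cardinality of the continuum; the (unrestricted) free Hopf algebra on \<open>C\<close> has
  exactly that cardinality, so it has a copy inside \<open>'h\<close>, and comparing universal properties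
  shows that \<open>H\<close> is isomorphic to it.\<close>

definition free_hopf_algebra :: "'c coalg \<Rightarrow> 'h coalg \<Rightarrow> ('c \<Rightarrow> 'h) \<Rightarrow> bool" where
  "free_hopf_algebra C H \<iota> \<longleftrightarrow>
     coalgebra C \<and> hopf_algebra H \<and> \<iota> \<in> coalgebra_hom C H \<and>
     (\<forall>(K :: 'h coalg) f. hopf_algebra K \<and> f \<in> coalgebra_hom C K \<longrightarrow>
        (\<exists>g \<in> hopf_hom H K. (\<forall>c\<in>carrier C. g (\<iota> c) = f c) \<and>
           (\<forall>g' \<in> hopf_hom H K. (\<forall>c\<in>carrier C. g' (\<iota> c) = f c) \<longrightarrow>
              (\<forall>x\<in>carrier H. g' x = g x))))"


section \<open>Comodules and relative Hopf modules\<close>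

definition right_comodule ::
  "('h, 'x) coalg_scheme \<Rightarrow> (complex, 'm, 'y) module_scheme \<Rightarrow> ('m \<Rightarrow> ('m, 'h) tensor) \<Rightarrow> bool" where
  "right_comodule H M \<delta> \<longleftrightarrow>
     module complex_ring M \<and> \<delta> \<in> linear_maps M (tensor_space M H) \<and>
     (\<forall>m\<in>carrier M.
        tensor_map M (tensor_space H H) (\<lambda>n. n) (comult H) (\<delta> m) =
        tensor_assoc M H H (tensor_map (tensor_space M H) H \<delta> (\<lambda>h. h) (\<delta> m)) \<and>
        tensor_lift M (\<lambda>n h. counit H h \<odot>\<^bsub>M\<^esub> n) (\<delta> m) = m)"

definition right_algebra_coaction ::
  "('h, 'x) coalg_scheme \<Rightarrow> (complex, 'a, 'y) module_scheme \<Rightarrow> ('a \<Rightarrow> ('a, 'h) tensor) \<Rightarrow> bool" where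
  "right_algebra_coaction H A \<delta> \<longleftrightarrow>
     complex_algebra A \<and> right_comodule H A \<delta> \<and> \<delta> \<in> ring_hom A (tensor_algebra A H)"

definition relative_hopf_module ::
  "(complex, 'a, 'x) module_scheme \<Rightarrow> ('h, 'y) coalg_scheme \<Rightarrow> ('a \<Rightarrow> ('a, 'h) tensor)
     \<Rightarrow> ('a, 'm, 'z) module_scheme \<Rightarrow> ('m \<Rightarrow> ('m, 'h) tensor) \<Rightarrow> bool" where
  "relative_hopf_module A H \<delta> M \<delta>M \<longleftrightarrow>
     hopf_algebra H \<and> right_algebra_coaction H A \<delta> \<and> left_module A M \<and>
     right_comodule H (underlying_space A M) \<delta>M \<and>
     (\<forall>a\<in>carrier A. \<forall>m\<in>carrier M. \<delta>M (a \<odot>\<^bsub>M\<^esub> m) = \<delta> a \<odot>\<^bsub>tensor_left_module A M H\<^esub> \<delta>M m)"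

text \<open>The right \<open>A\<close>-action on \<open>(A \<otimes> H)\<^sub>\<delta>\<close>, the left \<open>(A \<otimes> H)\<close>-module \<open>(A \<otimes> H)\<^sub>\<delta> \<otimes>\<^sub>A M\<close>, its
  elements \<open>x \<otimes> m\<close>, and the map \<open>x \<otimes> m \<mapsto> x \<delta>M(m)\<close> to \<open>M \<otimes> H\<close>.\<close>

definition coaction_ract ::
  "(complex, 'a, 'x) module_scheme \<Rightarrow> (complex, 'h, 'y) module_scheme \<Rightarrow> ('a \<Rightarrow> ('a, 'h) tensor)
     \<Rightarrow> ('a, 'h) tensor \<Rightarrow> 'a \<Rightarrow> ('a, 'h) tensor" where
  "coaction_ract A H \<delta> x a = x \<otimes>\<^bsub>tensor_algebra A H\<^esub> \<delta> a"

definition induced_module ::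
  "(complex, 'a, 'x) module_scheme \<Rightarrow> (complex, 'h, 'y) module_scheme \<Rightarrow> ('a \<Rightarrow> ('a, 'h) tensor)
     \<Rightarrow> ('a, 'm, 'z) module_scheme \<Rightarrow> (('a, 'h) tensor, (('a, 'h) tensor, 'm) tensor) module" where
  "induced_module A H \<delta> M =
     tensor_over A (regular_module (tensor_algebra A H)) (coaction_ract A H \<delta>) M"

definition induced_pure ::
  "(complex, 'a, 'x) module_scheme \<Rightarrow> (complex, 'h, 'y) module_scheme \<Rightarrow> ('a \<Rightarrow> ('a, 'h) tensor)
     \<Rightarrow> ('a, 'm, 'z) module_scheme \<Rightarrow> ('a, 'h) tensor \<Rightarrow> 'm \<Rightarrow> (('a, 'h) tensor, 'm) tensor" where
  "induced_pure A H \<delta> M =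
     pure_tensor_over A (regular_module (tensor_algebra A H)) (coaction_ract A H \<delta>) M"

definition induced_map ::
  "(complex, 'a, 'x) module_scheme \<Rightarrow> (complex, 'h, 'y) module_scheme \<Rightarrow> ('a, 'm, 'z) module_scheme
     \<Rightarrow> ('m \<Rightarrow> ('m, 'h) tensor) \<Rightarrow> (('a, 'h) tensor, 'm) tensor \<Rightarrow> ('m, 'h) tensor" where
  "induced_map A H M \<delta>M = tensor_lift (tensor_left_module A M H)
     (\<lambda>x m. x \<odot>\<^bsub>tensor_left_module A M H\<^esub> \<delta>M m)"


section \<open>The dual coalgebra of the algebra of two by two matrices\<close>

text \<open>The numeral type \<open>2\<close> has the elements \<open>0\<close> and \<open>1\<close>; it serves as the index set.\<close>

type_synonym matrix2 = "complex ^ 2 ^ 2"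

definition matrix_unit :: "2 \<Rightarrow> 2 \<Rightarrow> matrix2" where
  "matrix_unit i j = (\<chi> p q. if p = i \<and> q = j then 1 else 0)"

definition matrix_coeff :: "2 \<Rightarrow> 2 \<Rightarrow> matrix2 \<Rightarrow> complex" where
  "matrix_coeff i j = (\<lambda>X. X $ i $ j)"

definition matrix_dual :: "(complex, matrix2 \<Rightarrow> complex) module" where
  "matrix_dual =
     \<lparr>carrier = {f. (\<forall>X Y. f (X + Y) = f X + f Y) \<and> (\<forall>c X. f (map_matrix ((*) c) X) = c * f X)},
      monoid.mult = undefined, one = undefined,
      ring.zero = (\<lambda>X. 0), add = (\<lambda>f g X. f X + g X), smult = (\<lambda>c f X. c * f X)\<rparr>"

text \<open>Evaluation of a functional on products of matrices, \<open>f (X ** Y) = \<Sum> f\<^sub>1 X * f\<^sub>2 Y\<close>, reads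
  in terms of the basis of matrix coefficients as below, because
  \<open>(X ** Y) $ i $ j = (\<Sum>l. X $ i $ l * Y $ l $ j)\<close>.\<close>

definition matrix_comult ::
  "(matrix2 \<Rightarrow> complex) \<Rightarrow> (matrix2 \<Rightarrow> complex, matrix2 \<Rightarrow> complex) tensor" where
  "matrix_comult f = (let T = tensor_space matrix_dual matrix_dual in
     \<Oplus>\<^bsub>T\<^esub>i\<in>UNIV. \<Oplus>\<^bsub>T\<^esub>j\<in>UNIV. \<Oplus>\<^bsub>T\<^esub>l\<in>UNIV. f (matrix_unit i j) \<odot>\<^bsub>T\<^esub>
       pure_tensor matrix_dual matrix_dual (matrix_coeff i l) (matrix_coeff l j))"

definition matrix_coalgebra :: "(matrix2 \<Rightarrow> complex) coalg" where
  "matrix_coalgebra =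
     \<lparr>carrier = carrier matrix_dual, monoid.mult = undefined, one = undefined,
      ring.zero = \<zero>\<^bsub>matrix_dual\<^esub>, add = (\<oplus>\<^bsub>matrix_dual\<^esub>), smult = (\<odot>\<^bsub>matrix_dual\<^esub>),
      comult = matrix_comult, counit = (\<lambda>f. f (mat 1))\<rparr>"


section \<open>The coaction twisted by a two by two matrix\<close>

definition free_module2 :: "('h, 'x) ring_scheme \<Rightarrow> ('h, 'h \<times> 'h) module" where
  "free_module2 H = module_sum (regular_module H) (regular_module H)"

text \<open>\<open>sweedler H k e a\<close> is \<open>e k\<^sub>(\<^sub>0\<^sub>) \<otimes> k\<^sub>(\<^sub>1\<^sub>) a\<close> for a map \<open>e : H \<rightarrow> H \<oplus> H\<close>.\<close>

definition sweedler ::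
  "('h, 'x) coalg_scheme \<Rightarrow> 'h \<Rightarrow> ('h \<Rightarrow> 'h \<times> 'h) \<Rightarrow> 'h \<Rightarrow> ('h \<times> 'h, 'h) tensor" where
  "sweedler H k e a = (let V = underlying_space H (free_module2 H) in
     tensor_lift (tensor_space V H) (\<lambda>u v. pure_tensor V H (e u) (v \<otimes>\<^bsub>H\<^esub> a)) (comult H k))"

definition twisted_coaction ::
  "('h, 'x) coalg_scheme \<Rightarrow> (2 \<Rightarrow> 2 \<Rightarrow> 'h) \<Rightarrow> 'h \<times> 'h \<Rightarrow> ('h \<times> 'h, 'h) tensor" where
  "twisted_coaction H a = (\<lambda>(k0, k1).
     let T = tensor_space (underlying_space H (free_module2 H)) H in
       sweedler H k0 (\<lambda>u. (u, \<zero>\<^bsub>H\<^esub>)) (a 0 0) \<oplus>\<^bsub>T\<^esub> sweedler H k1 (\<lambda>u. (u, \<zero>\<^bsub>H\<^esub>)) (a 0 1) \<oplus>\<^bsub>T\<^esub>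
       sweedler H k0 (\<lambda>u. (\<zero>\<^bsub>H\<^esub>, u)) (a 1 0) \<oplus>\<^bsub>T\<^esub> sweedler H k1 (\<lambda>u. (\<zero>\<^bsub>H\<^esub>, u)) (a 1 1))"

end

(* The induced map is right multiplication by the transpose of the matrix 1 \<otimes> a on row vectors over
   H \<otimes> H, so it can only be surjective if that transpose has a left inverse over H. To refute this it
   suffices to have an H-module in which the transpose of a annihilates a nonzero column vector.
   By Takeuchi's construction, a matrix y\<^sub>0 over an algebra comes from a homomorphism of the
   free Hopf algebra as soon as all iterated inverse transposes y\<^sub>1, y\<^sub>2, ... of y\<^sub>0 exist. Over the Weyl
   algebra with D X - X D = 1 the matrix y\<^sub>0 = [[1, D], [X, D X]] has this property, although its
   transpose [[1, X], [D, D X]] annihilates the column with entries - X 1 and 1. *)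
theory Submission
  imports Defs
begin

section \<open>Tensor products over a ring\<close>

text \<open>The antipode inverts \<open>a\<close> but not its transpose, and the two differ only
  because entries do not commute. If the antipode S of \<open>H\<close> were bijective, the
  transpose of the matrix of all S^-1(a i j) would invert the transpose of \<open>a\<close>. So the
  theorem needs a Hopf algebra whose antipode is not bijective. In Takeuchi's relations this shows
  as one-sidedness: the sequence y_0, y_1, ... need not extend to an index -1, and y_0 has an
  invertible transpose exactly if it does.

  The matrix over the Weyl algebra comes from Schur complements of its entry 1. For y_0 the
  complement is D X - X D = 1, for the transpose it is D X - D X = 0. The counit removes the first
  tensor factor, which is why a vector annihilated over \<open>H\<close> suffices for a statement
  about H \<otimes> H.

  The universal property of \<open>H\<close> speaks only of Hopf algebras with elements in the type
  \<open>'h\<close>. Takeuchi's algebra is therefore built inside \<open>'h\<close>, by coding terms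
  as elements of \<open>'h\<close>, and a homomorphism from \<open>H\<close> into it carries the
  representation back to \<open>H\<close>.\<close>

definition balanced ::
  "('r, 'k) ring_scheme \<Rightarrow> ('a, 'x) ring_scheme \<Rightarrow> ('a \<Rightarrow> 'r \<Rightarrow> 'a) \<Rightarrow> ('r, 'b, 'y) module_scheme
     \<Rightarrow> ('g, 'z) ring_scheme \<Rightarrow> ('a \<Rightarrow> 'b \<Rightarrow> 'g) \<Rightarrow> bool" where
  "balanced R A ract B G f \<longleftrightarrow>
     (\<forall>a\<in>carrier A. \<forall>b\<in>carrier B. f a b \<in> carrier G) \<and>
     (\<forall>a\<in>carrier A. \<forall>a'\<in>carrier A. \<forall>b\<in>carrier B. f (a \<oplus>\<^bsub>A\<^esub> a') b = f a b \<oplus>\<^bsub>G\<^esub> f a' b) \<and>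
     (\<forall>a\<in>carrier A. \<forall>b\<in>carrier B. \<forall>b'\<in>carrier B. f a (b \<oplus>\<^bsub>B\<^esub> b') = f a b \<oplus>\<^bsub>G\<^esub> f a b') \<and>
     (\<forall>a\<in>carrier A. \<forall>r\<in>carrier R. \<forall>b\<in>carrier B. f (ract a r) b = f a (r \<odot>\<^bsub>B\<^esub> b))"

section \<open>Homomorphisms out of a free abelian group\<close>

lemma (in abelian_group) add_minus_minus:
  assumes "x \<in> carrier G" "y \<in> carrier G"
  shows "(x \<oplus> y) \<ominus> x \<ominus> y = \<zero>"
proof -
  have "(x \<oplus> y) \<ominus> x = \<ominus> x \<oplus> (x \<oplus> y)"
    using assms by (simp add: a_minus_def a_comm)
  then show ?thesis using assms by (simp add: r_neg1) (simp add: a_minus_def r_neg)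
qed

text \<open>The support of a sum may be smaller than the union of the supports. Summing over a
  common superset, where zero coefficients contribute zero, makes lifts of different elements
  comparable term by term.\<close>

lemma free_lift_superset:
  assumes "abelian_group G" "finite S" "Poly_Mapping.keys t \<subseteq> S"
    and f: "\<And>p. p \<in> S \<Longrightarrow> f (fst p) (snd p) \<in> carrier G"
  shows "free_lift G f t =
    (\<Oplus>\<^bsub>G\<^esub>p\<in>S. [Poly_Mapping.lookup t p] \<cdot>\<^bsub>G\<^esub> f (fst p) (snd p))"
proof -
  interpret G: abelian_group G by fact
  have "[(0 :: int)] \<cdot>\<^bsub>G\<^esub> x = \<zero>\<^bsub>G\<^esub>" for x
    by (simp add: add_pow_def)
  then show ?thesis
    unfolding free_lift_def
    by (intro G.add.finprod_mono_neutral_cong_left)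
      (use assms in \<open>auto simp: in_keys_iff intro!: G.add.int_pow_closed\<close>)
qed

lemma free_lift_closed:
  assumes "abelian_group G"
    and "\<And>p. p \<in> Poly_Mapping.keys t \<Longrightarrow> f (fst p) (snd p) \<in> carrier G"
  shows "free_lift G f t \<in> carrier G"
proof -
  interpret G: abelian_group G by fact
  show ?thesis
    unfolding free_lift_def by (rule G.finsum_closed) (use assms in auto)
qed

lemma free_lift_add:
  assumes "abelian_group G"
    and f: "\<And>p. p \<in> Poly_Mapping.keys s \<union> Poly_Mapping.keys t \<Longrightarrow> f (fst p) (snd p) \<in> carrier G"
  shows "free_lift G f (s + t) = free_lift G f s \<oplus>\<^bsub>G\<^esub> free_lift G f t"
proof -
  interpret G: abelian_group G by fact
  let ?S = "Poly_Mapping.keys s \<union> Poly_Mapping.keys t"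
  have *: "free_lift G f u =
    (\<Oplus>\<^bsub>G\<^esub>p\<in>?S. [Poly_Mapping.lookup u p] \<cdot>\<^bsub>G\<^esub> f (fst p) (snd p))"
    if "Poly_Mapping.keys u \<subseteq> ?S" for u
    by (rule free_lift_superset) (use assms that in auto)
  have "free_lift G f (s + t) =
    (\<Oplus>\<^bsub>G\<^esub>p\<in>?S. [Poly_Mapping.lookup s p] \<cdot>\<^bsub>G\<^esub> f (fst p) (snd p)
        \<oplus>\<^bsub>G\<^esub> [Poly_Mapping.lookup t p] \<cdot>\<^bsub>G\<^esub> f (fst p) (snd p))"
    by (subst *[OF Poly_Mapping.keys_add], rule G.finsum_cong)
      (use f in \<open>auto simp: lookup_add G.add.int_pow_mult simp_implies_def\<close>)
  also have "\<dots> = free_lift G f s \<oplus>\<^bsub>G\<^esub> free_lift G f t"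
    using f by (subst G.finsum_addf) (auto simp: *)
  finally show ?thesis .
qed

lemma free_lift_zero: "abelian_group G \<Longrightarrow> free_lift G f 0 = \<zero>\<^bsub>G\<^esub>"
  by (simp add: free_lift_def abelian_group_def abelian_monoid.finsum_empty)

lemma free_lift_of:
  assumes "abelian_group G" "f a b \<in> carrier G"
  shows "free_lift G f (frag_of (a, b)) = f a b"
proof -
  interpret G: abelian_group G by fact
  show ?thesis
    using assms(2) by (simp add: free_lift_def lookup_frag_of)
qed

lemma free_lift_uminus:
  assumes "abelian_group G"
    and f: "\<And>p. p \<in> Poly_Mapping.keys t \<Longrightarrow> f (fst p) (snd p) \<in> carrier G"
  shows "free_lift G f (- t) = \<ominus>\<^bsub>G\<^esub> free_lift G f t"
proof -
  interpret G: abelian_group G by fact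
  have "free_lift G f (- t) \<oplus>\<^bsub>G\<^esub> free_lift G f t = free_lift G f (- t + t)"
    by (rule free_lift_add[symmetric]) (use assms in auto)
  then have "free_lift G f (- t) \<oplus>\<^bsub>G\<^esub> free_lift G f t = \<zero>\<^bsub>G\<^esub>"
    by (simp add: free_lift_zero[OF assms(1)])
  moreover have "free_lift G f (- t) \<in> carrier G" "free_lift G f t \<in> carrier G"
    by (rule free_lift_closed; use assms in auto)+
  ultimately show ?thesis by (metis G.minus_equality)
qed

lemma free_lift_diff:
  assumes "abelian_group G"
    and f: "\<And>p. p \<in> Poly_Mapping.keys s \<union> Poly_Mapping.keys t \<Longrightarrow> f (fst p) (snd p) \<in> carrier G"
  shows "free_lift G f (s - t) = free_lift G f s \<ominus>\<^bsub>G\<^esub> free_lift G f t"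
  using free_lift_add[OF assms(1), of s "- t" f] free_lift_uminus[OF assms(1), of t f] f
  by (simp add: a_minus_def)

text \<open>One setting for both kinds of tensor product in the theorem: the one over the complex
  numbers, with \<open>c \<odot> v\<close> as right action, and the one over \<open>H\<close>, with
  right multiplication by values of \<Delta> on H \<otimes> H.\<close>

locale tensor_factors =
  fixes R :: "('r, 'k) ring_scheme" and A :: "('a, 'x) ring_scheme" and ract :: "'a \<Rightarrow> 'r \<Rightarrow> 'a"
    and B :: "('r, 'b, 'y) module_scheme"
  assumes A: "abelian_group A" and B: "abelian_group B"
    and ract_closed: "\<lbrakk>a \<in> carrier A; r \<in> carrier R\<rbrakk> \<Longrightarrow> ract a r \<in> carrier A"
    and smult_closed: "\<lbrakk>r \<in> carrier R; b \<in> carrier B\<rbrakk> \<Longrightarrow> r \<odot>\<^bsub>B\<^esub> b \<in> carrier B"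
begin

abbreviation "F \<equiv> free_Abelian_group (carrier A \<times> carrier B)"
abbreviation "N \<equiv> tensor_null R A ract B"
abbreviation "T \<equiv> tensor_group R A ract B"
abbreviation "pure \<equiv> pure_tensor_over R A ract B"

interpretation A: abelian_group A by (fact A)
interpretation B: abelian_group B by (fact B)
interpretation F: comm_group F by (rule abelian_free_Abelian_group)

section \<open>The quotient of the free abelian group and its universal property\<close>

lemma relations_closed: "tensor_relations R A ract B \<subseteq> carrier F"
  unfolding tensor_relations_def
  by (auto simp: ract_closed smult_closed subset_iff dest!: subsetD[OF keys_diff])

lemma null_subgroup: "subgroup N F"
  unfolding tensor_null_def by (rule F.generate_is_subgroup[OF relations_closed])

interpretation N: normal N F
  by (rule F.subgroup_imp_normal[OF null_subgroup])

text \<open>Each clause of \<open>balanced\<close> kills one of the three kinds of relations, and a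
  homomorphism that vanishes on generators vanishes on the subgroup they generate.\<close>

lemma free_lift_null:
  assumes G: "abelian_group G" and f: "balanced R A ract B G f" and t: "t \<in> N"
  shows "free_lift G f t = \<zero>\<^bsub>G\<^esub>"
proof -
  interpret G: abelian_group G by (fact G)
  have cl: "f (fst p) (snd p) \<in> carrier G"
    if "p \<in> Poly_Mapping.keys u" "Poly_Mapping.keys u \<subseteq> carrier A \<times> carrier B" for u p
    using that f by (auto simp: balanced_def)
  have rel: "free_lift G f u = \<zero>\<^bsub>G\<^esub>" if u: "u \<in> tensor_relations R A ract B" for u
  proof -
    have diff: "free_lift G f (s - s') = free_lift G f s \<ominus>\<^bsub>G\<^esub> free_lift G f s'"
      if "s \<in> carrier F" "s' \<in> carrier F" for s s'
      by (rule free_lift_diff[OF G]) (use that cl in auto)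
    have of: "free_lift G f (frag_of (a, b)) = f a b" "f a b \<in> carrier G"
      if "a \<in> carrier A" "b \<in> carrier B" for a b
      using that f free_lift_of[OF G, of f a b] by (auto simp: balanced_def)
    have *: "frag_of p - frag_of q \<in> carrier F"
      if "p \<in> carrier A \<times> carrier B" "q \<in> carrier A \<times> carrier B" for p q
      using that by (auto dest!: subsetD[OF keys_diff])
    from u show ?thesis
      unfolding tensor_relations_def
    proof (elim UnE CollectE exE conjE)
      fix a a' b
      assume eq: "u = frag_of (a \<oplus>\<^bsub>A\<^esub> a', b) - frag_of (a, b) - frag_of (a', b)"
        and m: "a \<in> carrier A" "a' \<in> carrier A" "b \<in> carrier B"
      have "f (a \<oplus>\<^bsub>A\<^esub> a') b = f a b \<oplus>\<^bsub>G\<^esub> f a' b"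
        using f m by (auto simp: balanced_def)
      then show ?thesis
        using m of[of a b] of[of a' b] of[of "a \<oplus>\<^bsub>A\<^esub> a'" b]
        by (simp add: eq diff * of G.add_minus_minus del: carrier_free_Abelian_group_iff)
    next
      fix a b b'
      assume eq: "u = frag_of (a, b \<oplus>\<^bsub>B\<^esub> b') - frag_of (a, b) - frag_of (a, b')"
        and m: "a \<in> carrier A" "b \<in> carrier B" "b' \<in> carrier B"
      have "f a (b \<oplus>\<^bsub>B\<^esub> b') = f a b \<oplus>\<^bsub>G\<^esub> f a b'"
        using f m by (auto simp: balanced_def)
      then show ?thesis
        using m of[of a b] of[of a b'] of[of a "b \<oplus>\<^bsub>B\<^esub> b'"]
        by (simp add: eq diff * of G.add_minus_minus del: carrier_free_Abelian_group_iff)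
    next
      fix a r b
      assume eq: "u = frag_of (ract a r, b) - frag_of (a, r \<odot>\<^bsub>B\<^esub> b)"
        and m: "a \<in> carrier A" "r \<in> carrier R" "b \<in> carrier B"
      have "f (ract a r) b = f a (r \<odot>\<^bsub>B\<^esub> b)"
        using f m by (auto simp: balanced_def)
      then show ?thesis
        using m of[of "ract a r" b] of[of a "r \<odot>\<^bsub>B\<^esub> b"]
        by (simp add: eq diff of ract_closed smult_closed a_minus_def G.r_neg)
    qed
  qed
  have "t \<in> generate F (tensor_relations R A ract B)"
    using t by (simp add: tensor_null_def)
  then show ?thesis
  proof (induction rule: generate.induct)
    case one
    then show ?case by (simp add: free_lift_zero[OF G])
  next
    case (incl h)
    then show ?case by (rule rel)
  next
    case (inv h)
    then have h: "h \<in> carrier F" using relations_closed by blast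
    then have "free_lift G f (- h) = \<ominus>\<^bsub>G\<^esub> free_lift G f h"
      by (intro free_lift_uminus[OF G]) (use cl in auto)
    then show ?case using rel[OF inv] h by simp
  next
    case (eng h1 h2)
    then have "h1 \<in> carrier F" "h2 \<in> carrier F"
      using F.generate_in_carrier[OF relations_closed] by blast+
    then have "free_lift G f (h1 + h2) = free_lift G f h1 \<oplus>\<^bsub>G\<^esub> free_lift G f h2"
      by (intro free_lift_add[OF G]) (use cl in auto)
    then show ?case using eng by simp
  qed
qed

text \<open>\<open>tensor_lift\<close> takes the only element of the image of a coset. This is
  meaningful because the lift vanishes on \<open>N\<close>, so that it is constant on every
  coset.\<close>

lemma lift_coset:
  assumes G: "abelian_group G" and f: "balanced R A ract B G f" and t: "t \<in> carrier F"
  shows "tensor_lift G f (N #>\<^bsub>F\<^esub> t) = free_lift G f t"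
proof -
  interpret G: abelian_group G by (fact G)
  have cl: "f (fst p) (snd p) \<in> carrier G"
    if "p \<in> Poly_Mapping.keys u" "Poly_Mapping.keys u \<subseteq> carrier A \<times> carrier B" for u p
    using that f by (auto simp: balanced_def)
  have "free_lift G f (n + t) = free_lift G f t" if n: "n \<in> N" for n
  proof -
    have nF: "n \<in> carrier F" using N.subset n by blast
    then have "free_lift G f (n + t) = free_lift G f n \<oplus>\<^bsub>G\<^esub> free_lift G f t"
      by (intro free_lift_add[OF G]) (use cl t in auto)
    moreover have "free_lift G f t \<in> carrier G"
      by (intro free_lift_closed[OF G]) (use cl t in auto)
    ultimately show ?thesis by (simp add: free_lift_null[OF G f n])
  qed
  then have "free_lift G f ` (N #>\<^bsub>F\<^esub> t) = {free_lift G f t}"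
    using N.one_closed unfolding r_coset_def by (auto simp: image_UN)
  then show ?thesis by (simp add: tensor_lift_def)
qed

lemma carrier_T: "carrier T = (\<lambda>t. N #>\<^bsub>F\<^esub> t) ` carrier F"
  by (simp add: tensor_group_def carrier_FactGroup)

lemma add_T: "\<lbrakk>s \<in> carrier F; t \<in> carrier F\<rbrakk> \<Longrightarrow> (N #>\<^bsub>F\<^esub> s) \<oplus>\<^bsub>T\<^esub> (N #>\<^bsub>F\<^esub> t) = N #>\<^bsub>F\<^esub> (s + t)"
  using N.rcos_sum[of s t] by (simp add: tensor_group_def)

lemma abelian_group_T: "abelian_group T"
proof -
  have "comm_group (F Mod N)" by (rule F.abelian_FactGroup[OF null_subgroup])
  moreover have "add_monoid T = F Mod N"
    by (simp add: tensor_group_def)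
  ultimately show ?thesis
    by (intro abelian_group.intro abelian_monoid.intro abelian_group_axioms.intro)
      (simp_all add: comm_group.axioms)
qed

interpretation T: abelian_group T by (rule abelian_group_T)

lemma pure_closed: "\<lbrakk>a \<in> carrier A; b \<in> carrier B\<rbrakk> \<Longrightarrow> pure a b \<in> carrier T"
  by (simp add: carrier_T pure_tensor_over_def)

lemma coset_eqI: "\<lbrakk>s \<in> carrier F; t \<in> carrier F; s - t \<in> N\<rbrakk> \<Longrightarrow> N #>\<^bsub>F\<^esub> s = N #>\<^bsub>F\<^esub> t"
proof -
  assume s: "s \<in> carrier F" and t: "t \<in> carrier F" and st: "s - t \<in> N"
  have "s \<in> N #>\<^bsub>F\<^esub> t"
    using st unfolding r_coset_def by (auto intro!: bexI[of _ "s - t"])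
  then show ?thesis
    using F.repr_independence[OF _ t null_subgroup] by simp
qed

lemma relation_null: "u \<in> tensor_relations R A ract B \<Longrightarrow> u \<in> N"
  unfolding tensor_null_def by (rule generate.incl)

lemma pure_add_left:
  assumes "a \<in> carrier A" "a' \<in> carrier A" "b \<in> carrier B"
  shows "pure (a \<oplus>\<^bsub>A\<^esub> a') b = pure a b \<oplus>\<^bsub>T\<^esub> pure a' b"
proof -
  have "frag_of (a \<oplus>\<^bsub>A\<^esub> a', b) - (frag_of (a, b) + frag_of (a', b)) \<in> N"
    by (rule relation_null) (use assms in \<open>auto simp: tensor_relations_def algebra_simps\<close>)
  then have "N #>\<^bsub>F\<^esub> frag_of (a \<oplus>\<^bsub>A\<^esub> a', b) = N #>\<^bsub>F\<^esub> (frag_of (a, b) + frag_of (a', b))"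
    by (intro coset_eqI) (use assms in \<open>auto dest!: subsetD[OF Poly_Mapping.keys_add]\<close>)
  then show ?thesis using assms by (simp add: pure_tensor_over_def add_T)
qed

lemma pure_add_right:
  assumes "a \<in> carrier A" "b \<in> carrier B" "b' \<in> carrier B"
  shows "pure a (b \<oplus>\<^bsub>B\<^esub> b') = pure a b \<oplus>\<^bsub>T\<^esub> pure a b'"
proof -
  have "frag_of (a, b \<oplus>\<^bsub>B\<^esub> b') - (frag_of (a, b) + frag_of (a, b')) \<in> N"
    by (rule relation_null) (use assms in \<open>auto simp: tensor_relations_def algebra_simps\<close>)
  then have "N #>\<^bsub>F\<^esub> frag_of (a, b \<oplus>\<^bsub>B\<^esub> b') = N #>\<^bsub>F\<^esub> (frag_of (a, b) + frag_of (a, b'))"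
    by (intro coset_eqI) (use assms in \<open>auto dest!: subsetD[OF Poly_Mapping.keys_add]\<close>)
  then show ?thesis using assms by (simp add: pure_tensor_over_def add_T)
qed

lemma pure_balanced:
  assumes "a \<in> carrier A" "r \<in> carrier R" "b \<in> carrier B"
  shows "pure (ract a r) b = pure a (r \<odot>\<^bsub>B\<^esub> b)"
proof -
  have "frag_of (ract a r, b) - frag_of (a, r \<odot>\<^bsub>B\<^esub> b) \<in> N"
    by (rule relation_null) (use assms in \<open>auto simp: tensor_relations_def\<close>)
  then show ?thesis
    unfolding pure_tensor_over_def
    by (intro coset_eqI) (use assms in \<open>auto simp: ract_closed smult_closed\<close>)
qed

lemma lift_pure:
  assumes "abelian_group G" "balanced R A ract B G f" "a \<in> carrier A" "b \<in> carrier B"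
  shows "tensor_lift G f (pure a b) = f a b"
  using assms by (simp add: pure_tensor_over_def lift_coset free_lift_of balanced_def)

lemma lift_closed:
  assumes G: "abelian_group G" and f: "balanced R A ract B G f" and X: "X \<in> carrier T"
  shows "tensor_lift G f X \<in> carrier G"
proof -
  obtain t where t: "t \<in> carrier F" "X = N #>\<^bsub>F\<^esub> t"
    using X by (auto simp: carrier_T)
  have "free_lift G f t \<in> carrier G"
    by (rule free_lift_closed[OF G]) (use t f in \<open>auto simp: balanced_def\<close>)
  then show ?thesis by (simp add: t(2) lift_coset[OF G f t(1)])
qed

lemma lift_add:
  assumes G: "abelian_group G" and f: "balanced R A ract B G f"
    and X: "X \<in> carrier T" and Y: "Y \<in> carrier T"
  shows "tensor_lift G f (X \<oplus>\<^bsub>T\<^esub> Y) = tensor_lift G f X \<oplus>\<^bsub>G\<^esub> tensor_lift G f Y"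
proof -
  obtain s t where st: "s \<in> carrier F" "X = N #>\<^bsub>F\<^esub> s" "t \<in> carrier F" "Y = N #>\<^bsub>F\<^esub> t"
    using X Y by (auto simp: carrier_T)
  have cl: "f (fst p) (snd p) \<in> carrier G"
    if "p \<in> Poly_Mapping.keys u" "Poly_Mapping.keys u \<subseteq> carrier A \<times> carrier B" for u p
    using that f by (auto simp: balanced_def)
  have "s + t \<in> carrier F" using F.m_closed[of s t] st by simp
  moreover have "free_lift G f (s + t) = free_lift G f s \<oplus>\<^bsub>G\<^esub> free_lift G f t"
    by (rule free_lift_add[OF G]) (use st cl in auto)
  ultimately show ?thesis by (simp add: st add_T lift_coset[OF G f] del: carrier_free_Abelian_group_iff)
qed

lemma pure_minus_left:
  assumes "a \<in> carrier A" "b \<in> carrier B"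
  shows "pure (\<ominus>\<^bsub>A\<^esub> a) b = \<ominus>\<^bsub>T\<^esub> pure a b"
proof -
  have "pure (\<zero>\<^bsub>A\<^esub> \<oplus>\<^bsub>A\<^esub> \<zero>\<^bsub>A\<^esub>) b = pure \<zero>\<^bsub>A\<^esub> b \<oplus>\<^bsub>T\<^esub> pure \<zero>\<^bsub>A\<^esub> b"
    using assms by (intro pure_add_left) auto
  then have "pure \<zero>\<^bsub>A\<^esub> b = \<zero>\<^bsub>T\<^esub>"
    using T.add.r_cancel_one'[of "pure \<zero>\<^bsub>A\<^esub> b" "pure \<zero>\<^bsub>A\<^esub> b"] pure_closed assms by simp
  then have "pure (\<ominus>\<^bsub>A\<^esub> a) b \<oplus>\<^bsub>T\<^esub> pure a b = \<zero>\<^bsub>T\<^esub>"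
    using assms pure_add_left[of "\<ominus>\<^bsub>A\<^esub> a" a b] by (simp add: A.l_neg)
  then show ?thesis using pure_closed assms T.minus_equality by simp
qed

text \<open>Every element is a sum of pure tensors, without subtraction: zero and the negative of a
  pure tensor are pure themselves, so neither needs a case of its own.\<close>

lemma tensor_group_induct [consumes 1, case_names pure add]:
  assumes X: "X \<in> carrier T"
    and pure: "\<And>a b. \<lbrakk>a \<in> carrier A; b \<in> carrier B\<rbrakk> \<Longrightarrow> P (pure a b)"
    and add: "\<And>X Y. \<lbrakk>X \<in> carrier T; Y \<in> carrier T; P X; P Y\<rbrakk> \<Longrightarrow> P (X \<oplus>\<^bsub>T\<^esub> Y)"
  shows "P X"
proof -
  have minus: "N #>\<^bsub>F\<^esub> (- t) = \<ominus>\<^bsub>T\<^esub> (N #>\<^bsub>F\<^esub> t)" if "t \<in> carrier F" for t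
  proof -
    have "(N #>\<^bsub>F\<^esub> (- t)) \<oplus>\<^bsub>T\<^esub> (N #>\<^bsub>F\<^esub> t) = N #>\<^bsub>F\<^esub> 0"
      using that by (subst add_T) auto
    also have "\<dots> = \<zero>\<^bsub>T\<^esub>"
      using F.coset_mult_one[OF N.subset] by (simp add: tensor_group_def)
    finally show ?thesis
      using that by (intro T.minus_equality[symmetric]) (auto simp: carrier_T)
  qed
  have zero: "N #>\<^bsub>F\<^esub> 0 = pure \<zero>\<^bsub>A\<^esub> \<zero>\<^bsub>B\<^esub>"
  proof -
    have "pure \<zero>\<^bsub>A\<^esub> \<zero>\<^bsub>B\<^esub> = \<zero>\<^bsub>T\<^esub>"
      using pure_add_left[of "\<zero>\<^bsub>A\<^esub>" "\<zero>\<^bsub>A\<^esub>" "\<zero>\<^bsub>B\<^esub>"]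
        T.add.r_cancel_one'[of "pure \<zero>\<^bsub>A\<^esub> \<zero>\<^bsub>B\<^esub>" "pure \<zero>\<^bsub>A\<^esub> \<zero>\<^bsub>B\<^esub>"] pure_closed by simp
    moreover have "N #>\<^bsub>F\<^esub> 0 = \<zero>\<^bsub>T\<^esub>"
      using F.coset_mult_one[OF N.subset] by (simp add: tensor_group_def)
    ultimately show ?thesis by simp
  qed
  obtain t where t: "Poly_Mapping.keys t \<subseteq> carrier A \<times> carrier B" and Xt: "X = N #>\<^bsub>F\<^esub> t"
    using X by (auto simp: carrier_T)
  \<comment> \<open>The free group is generated under differences, so negatives must be carried along.\<close>
  have "P (N #>\<^bsub>F\<^esub> t) \<and> P (N #>\<^bsub>F\<^esub> (- t))"
  proof (rule free_Abelian_group_induct[OF t, where P = "\<lambda>t. P (N #>\<^bsub>F\<^esub> t) \<and> P (N #>\<^bsub>F\<^esub> (- t))"])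
    show "P (N #>\<^bsub>F\<^esub> 0) \<and> P (N #>\<^bsub>F\<^esub> (- 0))"
      unfolding minus_zero zero by (auto intro!: pure)
  next
    fix x y
    assume xy: "Poly_Mapping.keys x \<subseteq> carrier A \<times> carrier B" "Poly_Mapping.keys y \<subseteq> carrier A \<times> carrier B"
      "P (N #>\<^bsub>F\<^esub> x) \<and> P (N #>\<^bsub>F\<^esub> (- x))" "P (N #>\<^bsub>F\<^esub> y) \<and> P (N #>\<^bsub>F\<^esub> (- y))"
    have eq: "N #>\<^bsub>F\<^esub> (x - y) = (N #>\<^bsub>F\<^esub> x) \<oplus>\<^bsub>T\<^esub> (N #>\<^bsub>F\<^esub> (- y))"
      "N #>\<^bsub>F\<^esub> (- (x - y)) = (N #>\<^bsub>F\<^esub> y) \<oplus>\<^bsub>T\<^esub> (N #>\<^bsub>F\<^esub> (- x))"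
      using xy(1,2) by (subst add_T; simp)+
    have "N #>\<^bsub>F\<^esub> s \<in> carrier T" if "Poly_Mapping.keys s \<subseteq> carrier A \<times> carrier B" for s
      using that by (auto simp: carrier_T)
    then show "P (N #>\<^bsub>F\<^esub> (x - y)) \<and> P (N #>\<^bsub>F\<^esub> (- (x - y)))"
      using xy unfolding eq by (simp add: add)
  next
    fix p
    assume "p \<in> carrier A \<times> carrier B"
    then obtain a b where ab: "p = (a, b)" "a \<in> carrier A" "b \<in> carrier B" by auto
    have "N #>\<^bsub>F\<^esub> (- frag_of p) = pure (\<ominus>\<^bsub>A\<^esub> a) b"
      using minus[of "frag_of p"] ab by (simp add: pure_minus_left) (simp add: pure_tensor_over_def)
    moreover have "N #>\<^bsub>F\<^esub> frag_of p = pure a b"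
      by (simp add: pure_tensor_over_def ab)
    ultimately show "P (N #>\<^bsub>F\<^esub> frag_of p) \<and> P (N #>\<^bsub>F\<^esub> (- frag_of p))"
      using pure ab by simp
  qed
  then show ?thesis by (simp add: Xt)
qed

end

section \<open>Complex vector spaces and their tensor products\<close>

lemma complex_ring_simps [simp]:
  "carrier complex_ring = UNIV" "x \<otimes>\<^bsub>complex_ring\<^esub> y = x * y" "\<one>\<^bsub>complex_ring\<^esub> = 1"
  "\<zero>\<^bsub>complex_ring\<^esub> = 0" "x \<oplus>\<^bsub>complex_ring\<^esub> y = x + y"
  by (simp_all add: complex_ring_def)

lemma cring_complex_ring: "cring complex_ring"
proof (intro cringI abelian_groupI comm_monoidI)
  fix x :: complex
  show "\<exists>y\<in>carrier complex_ring. y \<oplus>\<^bsub>complex_ring\<^esub> x = \<zero>\<^bsub>complex_ring\<^esub>"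
    by (auto intro!: exI[of _ "- x"])
qed (simp_all add: algebra_simps)

abbreviation cspace :: "(complex, 'v, 'x) module_scheme \<Rightarrow> bool" where
  "cspace \<equiv> module complex_ring"

lemma abelian_group_cong:
  assumes "abelian_group G" "carrier G' = carrier G" "add G' = add G" "ring.zero G' = ring.zero G"
  shows "abelian_group G'"
proof -
  interpret abelian_group G by fact
  show ?thesis
    by (rule abelian_groupI) (auto simp: assms(2-) a_ac intro: l_neg a_inv_closed)
qed

lemma cspaceI:
  assumes "abelian_group V"
    "\<And>c x. x \<in> carrier V \<Longrightarrow> c \<odot>\<^bsub>V\<^esub> x \<in> carrier V"
    "\<And>c d x. x \<in> carrier V \<Longrightarrow> (c + d) \<odot>\<^bsub>V\<^esub> x = c \<odot>\<^bsub>V\<^esub> x \<oplus>\<^bsub>V\<^esub> d \<odot>\<^bsub>V\<^esub> x"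
    "\<And>c x y. \<lbrakk>x \<in> carrier V; y \<in> carrier V\<rbrakk> \<Longrightarrow> c \<odot>\<^bsub>V\<^esub> (x \<oplus>\<^bsub>V\<^esub> y) = c \<odot>\<^bsub>V\<^esub> x \<oplus>\<^bsub>V\<^esub> c \<odot>\<^bsub>V\<^esub> y"
    "\<And>c d x. x \<in> carrier V \<Longrightarrow> (c * d) \<odot>\<^bsub>V\<^esub> x = c \<odot>\<^bsub>V\<^esub> (d \<odot>\<^bsub>V\<^esub> x)"
    "\<And>x. x \<in> carrier V \<Longrightarrow> 1 \<odot>\<^bsub>V\<^esub> x = x"
  shows "cspace V"
  by (rule moduleI[OF cring_complex_ring]) (use assms in auto)

lemma cspaceD:
  assumes "cspace V"
  shows "abelian_group V"
    "x \<in> carrier V \<Longrightarrow> c \<odot>\<^bsub>V\<^esub> x \<in> carrier V"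
    "x \<in> carrier V \<Longrightarrow> (c + d) \<odot>\<^bsub>V\<^esub> x = c \<odot>\<^bsub>V\<^esub> x \<oplus>\<^bsub>V\<^esub> d \<odot>\<^bsub>V\<^esub> x"
    "\<lbrakk>x \<in> carrier V; y \<in> carrier V\<rbrakk> \<Longrightarrow> c \<odot>\<^bsub>V\<^esub> (x \<oplus>\<^bsub>V\<^esub> y) = c \<odot>\<^bsub>V\<^esub> x \<oplus>\<^bsub>V\<^esub> c \<odot>\<^bsub>V\<^esub> y"
    "x \<in> carrier V \<Longrightarrow> (c * d) \<odot>\<^bsub>V\<^esub> x = c \<odot>\<^bsub>V\<^esub> (d \<odot>\<^bsub>V\<^esub> x)"
    "x \<in> carrier V \<Longrightarrow> 1 \<odot>\<^bsub>V\<^esub> x = x"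
proof -
  interpret module complex_ring V by fact
  show "abelian_group V" by (rule abelian_group_axioms)
  show "x \<in> carrier V \<Longrightarrow> c \<odot>\<^bsub>V\<^esub> x \<in> carrier V"
    "x \<in> carrier V \<Longrightarrow> (c + d) \<odot>\<^bsub>V\<^esub> x = c \<odot>\<^bsub>V\<^esub> x \<oplus>\<^bsub>V\<^esub> d \<odot>\<^bsub>V\<^esub> x"
    "\<lbrakk>x \<in> carrier V; y \<in> carrier V\<rbrakk> \<Longrightarrow> c \<odot>\<^bsub>V\<^esub> (x \<oplus>\<^bsub>V\<^esub> y) = c \<odot>\<^bsub>V\<^esub> x \<oplus>\<^bsub>V\<^esub> c \<odot>\<^bsub>V\<^esub> y"
    "x \<in> carrier V \<Longrightarrow> (c * d) \<odot>\<^bsub>V\<^esub> x = c \<odot>\<^bsub>V\<^esub> (d \<odot>\<^bsub>V\<^esub> x)"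
    "x \<in> carrier V \<Longrightarrow> 1 \<odot>\<^bsub>V\<^esub> x = x"
    using smult_l_distr[of c d x] smult_r_distr[of c x y] smult_assoc1[of c d x] smult_one[of x]
    by simp_all
qed

lemma abelian_groupD:
  assumes "abelian_group V"
  shows "\<lbrakk>x \<in> carrier V; y \<in> carrier V\<rbrakk> \<Longrightarrow> x \<oplus>\<^bsub>V\<^esub> y \<in> carrier V"
    "\<zero>\<^bsub>V\<^esub> \<in> carrier V"
    "x \<in> carrier V \<Longrightarrow> \<zero>\<^bsub>V\<^esub> \<oplus>\<^bsub>V\<^esub> x = x"
    "x \<in> carrier V \<Longrightarrow> x \<oplus>\<^bsub>V\<^esub> \<zero>\<^bsub>V\<^esub> = x"
  using assms
  by (simp_all add: abelian_group_def abelian_monoid.a_closed abelian_monoid.zero_closed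
    abelian_monoid.l_zero abelian_monoid.r_zero)

lemma abelian_group_interchange:
  assumes "abelian_group V" "x \<in> carrier V" "y \<in> carrier V" "x' \<in> carrier V" "y' \<in> carrier V"
  shows "(x \<oplus>\<^bsub>V\<^esub> y) \<oplus>\<^bsub>V\<^esub> (x' \<oplus>\<^bsub>V\<^esub> y') = (x \<oplus>\<^bsub>V\<^esub> x') \<oplus>\<^bsub>V\<^esub> (y \<oplus>\<^bsub>V\<^esub> y')"
proof -
  interpret abelian_group V by fact
  show ?thesis using assms(2-) by (simp add: a_ac)
qed

lemma smult_zero:
  assumes "cspace V" "x \<in> carrier V"
  shows "0 \<odot>\<^bsub>V\<^esub> x = \<zero>\<^bsub>V\<^esub>" "c \<odot>\<^bsub>V\<^esub> \<zero>\<^bsub>V\<^esub> = \<zero>\<^bsub>V\<^esub>"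
proof -
  interpret module complex_ring V by fact
  have "0 \<odot>\<^bsub>V\<^esub> x = 0 \<odot>\<^bsub>V\<^esub> x \<oplus>\<^bsub>V\<^esub> 0 \<odot>\<^bsub>V\<^esub> x"
    using cspaceD(3)[OF assms, of 0 0] by simp
  then show "0 \<odot>\<^bsub>V\<^esub> x = \<zero>\<^bsub>V\<^esub>"
    using add.r_cancel_one'[of "0 \<odot>\<^bsub>V\<^esub> x" "0 \<odot>\<^bsub>V\<^esub> x"] assms by simp
  have "c \<odot>\<^bsub>V\<^esub> \<zero>\<^bsub>V\<^esub> = c \<odot>\<^bsub>V\<^esub> \<zero>\<^bsub>V\<^esub> \<oplus>\<^bsub>V\<^esub> c \<odot>\<^bsub>V\<^esub> \<zero>\<^bsub>V\<^esub>"
    using cspaceD(4)[OF assms(1), of "\<zero>\<^bsub>V\<^esub>" "\<zero>\<^bsub>V\<^esub>" c] by simp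
  then show "c \<odot>\<^bsub>V\<^esub> \<zero>\<^bsub>V\<^esub> = \<zero>\<^bsub>V\<^esub>"
    using add.r_cancel_one'[of "c \<odot>\<^bsub>V\<^esub> \<zero>\<^bsub>V\<^esub>" "c \<odot>\<^bsub>V\<^esub> \<zero>\<^bsub>V\<^esub>"] by simp
qed

lemma left_module_homI:
  assumes "\<And>x. x \<in> carrier M \<Longrightarrow> f x \<in> carrier N"
    "\<And>x y. \<lbrakk>x \<in> carrier M; y \<in> carrier M\<rbrakk> \<Longrightarrow> f (x \<oplus>\<^bsub>M\<^esub> y) = f x \<oplus>\<^bsub>N\<^esub> f y"
    "\<And>r x. \<lbrakk>r \<in> carrier R; x \<in> carrier M\<rbrakk> \<Longrightarrow> f (r \<odot>\<^bsub>M\<^esub> x) = r \<odot>\<^bsub>N\<^esub> f x"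
  shows "f \<in> left_module_hom R M N"
  using assms by (auto simp: left_module_hom_def)

lemma linearD:
  assumes "f \<in> linear_maps V W"
  shows "x \<in> carrier V \<Longrightarrow> f x \<in> carrier W"
    "\<lbrakk>x \<in> carrier V; y \<in> carrier V\<rbrakk> \<Longrightarrow> f (x \<oplus>\<^bsub>V\<^esub> y) = f x \<oplus>\<^bsub>W\<^esub> f y"
    "x \<in> carrier V \<Longrightarrow> f (c \<odot>\<^bsub>V\<^esub> x) = c \<odot>\<^bsub>W\<^esub> f x"
  using assms by (auto simp: left_module_hom_def)

lemma linear_zero:
  assumes "f \<in> linear_maps V W" "cspace V" "cspace W"
  shows "f \<zero>\<^bsub>V\<^esub> = \<zero>\<^bsub>W\<^esub>"
proof -
  have z: "\<zero>\<^bsub>V\<^esub> \<in> carrier V" using abelian_groupD(2) cspaceD(1) assms(2) by blast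
  have "f (0 \<odot>\<^bsub>V\<^esub> \<zero>\<^bsub>V\<^esub>) = 0 \<odot>\<^bsub>W\<^esub> f \<zero>\<^bsub>V\<^esub>"
    using z linearD(3)[OF assms(1)] by blast
  then show ?thesis
    using z smult_zero[OF assms(2)] smult_zero[OF assms(3)] linearD(1)[OF assms(1)] by auto
qed

lemma linear_id: "(\<lambda>x. x) \<in> linear_maps V V"
  by (rule left_module_homI) auto

lemma linear_comp:
  assumes "f \<in> linear_maps U V" "g \<in> linear_maps V W"
  shows "(\<lambda>x. g (f x)) \<in> linear_maps U W"
  using assms by (auto simp: left_module_hom_def Pi_iff)

lemma linear_add:
  assumes "cspace W" "f \<in> linear_maps U W" "g \<in> linear_maps U W"
  shows "(\<lambda>x. f x \<oplus>\<^bsub>W\<^esub> g x) \<in> linear_maps U W"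
  by (rule left_module_homI)
    (simp_all add: linearD[OF assms(2)] linearD[OF assms(3)] cspaceD[OF assms(1)]
      abelian_groupD[OF cspaceD(1)[OF assms(1)]] abelian_group_interchange[OF cspaceD(1)[OF assms(1)]])

section \<open>Bilinear maps and the tensor product over the complex numbers\<close>

definition bilinear ::
  "(complex, 'v, 'x) module_scheme \<Rightarrow> (complex, 'w, 'y) module_scheme \<Rightarrow> (complex, 'u, 'z) module_scheme
     \<Rightarrow> ('v \<Rightarrow> 'w \<Rightarrow> 'u) \<Rightarrow> bool" where
  "bilinear V W U f \<longleftrightarrow> (\<forall>w\<in>carrier W. (\<lambda>v. f v w) \<in> linear_maps V U) \<and>
     (\<forall>v\<in>carrier V. f v \<in> linear_maps W U)"

lemma bilinearI:
  assumes "\<And>w. w \<in> carrier W \<Longrightarrow> (\<lambda>v. f v w) \<in> linear_maps V U"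
    "\<And>v. v \<in> carrier V \<Longrightarrow> f v \<in> linear_maps W U"
  shows "bilinear V W U f"
  using assms by (simp add: bilinear_def)

lemma bilinearD:
  assumes "bilinear V W U f"
  shows "w \<in> carrier W \<Longrightarrow> (\<lambda>v. f v w) \<in> linear_maps V U"
    "v \<in> carrier V \<Longrightarrow> f v \<in> linear_maps W U"
    "\<lbrakk>v \<in> carrier V; w \<in> carrier W\<rbrakk> \<Longrightarrow> f v w \<in> carrier U"
    "\<lbrakk>v \<in> carrier V; v' \<in> carrier V; w \<in> carrier W\<rbrakk> \<Longrightarrow> f (v \<oplus>\<^bsub>V\<^esub> v') w = f v w \<oplus>\<^bsub>U\<^esub> f v' w"
    "\<lbrakk>v \<in> carrier V; w \<in> carrier W; w' \<in> carrier W\<rbrakk> \<Longrightarrow> f v (w \<oplus>\<^bsub>W\<^esub> w') = f v w \<oplus>\<^bsub>U\<^esub> f v w'"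
    "\<lbrakk>v \<in> carrier V; w \<in> carrier W\<rbrakk> \<Longrightarrow> f (c \<odot>\<^bsub>V\<^esub> v) w = c \<odot>\<^bsub>U\<^esub> f v w"
    "\<lbrakk>v \<in> carrier V; w \<in> carrier W\<rbrakk> \<Longrightarrow> f v (c \<odot>\<^bsub>W\<^esub> w) = c \<odot>\<^bsub>U\<^esub> f v w"
  using assms by (simp_all add: bilinear_def left_module_hom_def Pi_iff)

lemma bilinear_balanced:
  "bilinear V W U f \<Longrightarrow> balanced complex_ring V (\<lambda>v c. c \<odot>\<^bsub>V\<^esub> v) W U f"
  by (simp add: balanced_def bilinearD)

lemma bilinear_comp:
  assumes "bilinear V W U f" "g \<in> linear_maps V' V" "h \<in> linear_maps W' W" "k \<in> linear_maps U U'"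
  shows "bilinear V' W' U' (\<lambda>v w. k (f (g v) (h w)))"
proof (rule bilinearI)
  fix w assume "w \<in> carrier W'"
  then have "(\<lambda>v. f v (h w)) \<in> linear_maps V U" by (simp add: bilinearD(1)[OF assms(1)] linearD(1)[OF assms(3)])
  then show "(\<lambda>v. k (f (g v) (h w))) \<in> linear_maps V' U'"
    by (intro linear_comp[OF _ assms(4)] linear_comp[OF assms(2)])
next
  fix v assume "v \<in> carrier V'"
  then have "f (g v) \<in> linear_maps W U" by (simp add: bilinearD(2)[OF assms(1)] linearD(1)[OF assms(2)])
  then show "(\<lambda>w. k (f (g v) (h w))) \<in> linear_maps W' U'"
    by (intro linear_comp[OF _ assms(4)] linear_comp[OF assms(3)])
qed

lemma tensor_over_simps:
  "carrier (tensor_over R A ract B) = carrier (tensor_group R A ract B)"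
  "x \<oplus>\<^bsub>tensor_over R A ract B\<^esub> y = x \<oplus>\<^bsub>tensor_group R A ract B\<^esub> y"
  "\<zero>\<^bsub>tensor_over R A ract B\<^esub> = \<zero>\<^bsub>tensor_group R A ract B\<^esub>"
  "add (tensor_over R A ract B) = add (tensor_group R A ract B)"
  by (simp_all add: tensor_over_def Let_def)

context tensor_factors
begin

lemma smult_tensor_over:
  "s \<odot>\<^bsub>tensor_over R A' ract B\<^esub> X = tensor_lift (tensor_group R A' ract B)
     (\<lambda>a b. pure_tensor_over R A' ract B (s \<odot>\<^bsub>A'\<^esub> a) b) X"
  by (simp add: tensor_over_def Let_def)

text \<open>An additive endomorphism of the left factor that commutes with the right action acts on
  the tensor product. Every left action on a \<open>tensor_over\<close> arises in this way, whether
  by scalars or by elements of H \<otimes> H.\<close>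

lemma smult_balanced:
  assumes "\<And>a. a \<in> carrier A \<Longrightarrow> f a \<in> carrier A"
    "\<And>a a'. \<lbrakk>a \<in> carrier A; a' \<in> carrier A\<rbrakk> \<Longrightarrow> f (a \<oplus>\<^bsub>A\<^esub> a') = f a \<oplus>\<^bsub>A\<^esub> f a'"
    "\<And>a r. \<lbrakk>a \<in> carrier A; r \<in> carrier R\<rbrakk> \<Longrightarrow> f (ract a r) = ract (f a) r"
  shows "balanced R A ract B T (\<lambda>a b. pure (f a) b)"
  using assms abelian_groupD[OF A] abelian_groupD[OF B]
  by (simp add: balanced_def pure_closed pure_add_left pure_add_right pure_balanced)

end

lemma tensor_factors_cspace:
  assumes "cspace V" "cspace W"
  shows "tensor_factors complex_ring V (\<lambda>v c. c \<odot>\<^bsub>V\<^esub> v) W"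
  using assms by (intro tensor_factors.intro) (auto simp: cspaceD)

context
  fixes V :: "(complex, 'v, 'x) module_scheme" and W :: "(complex, 'w, 'y) module_scheme"
  assumes V: "cspace V" and W: "cspace W"
begin

interpretation tensor_factors complex_ring V "\<lambda>v c. c \<odot>\<^bsub>V\<^esub> v" W
  by (rule tensor_factors_cspace[OF V W])

lemma pure_tensor_closed:
  "\<lbrakk>v \<in> carrier V; w \<in> carrier W\<rbrakk> \<Longrightarrow> pure_tensor V W v w \<in> carrier (tensor_space V W)"
  by (simp add: pure_tensor_def tensor_space_def tensor_over_simps pure_closed)

lemma tensor_induct [consumes 1, case_names pure add]:
  assumes "X \<in> carrier (tensor_space V W)"
    and "\<And>v w. \<lbrakk>v \<in> carrier V; w \<in> carrier W\<rbrakk> \<Longrightarrow> P (pure_tensor V W v w)"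
    and "\<And>X Y. \<lbrakk>X \<in> carrier (tensor_space V W); Y \<in> carrier (tensor_space V W); P X; P Y\<rbrakk>
      \<Longrightarrow> P (X \<oplus>\<^bsub>tensor_space V W\<^esub> Y)"
  shows "P X"
  using assms unfolding pure_tensor_def tensor_space_def tensor_over_simps
  by (rule tensor_group_induct)

lemma smult_pure_tensor_left:
  assumes "v \<in> carrier V" "w \<in> carrier W"
  shows "c \<odot>\<^bsub>tensor_space V W\<^esub> pure_tensor V W v w = pure_tensor V W (c \<odot>\<^bsub>V\<^esub> v) w"
  unfolding tensor_space_def pure_tensor_def smult_tensor_over
  by (rule lift_pure[OF abelian_group_T smult_balanced])
    (use assms V in \<open>auto simp: cspaceD(1-4) mult.commute simp flip: cspaceD(5)[OF V]\<close>)

lemma smult_pure_tensor_right: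
  assumes "v \<in> carrier V" "w \<in> carrier W"
  shows "c \<odot>\<^bsub>tensor_space V W\<^esub> pure_tensor V W v w = pure_tensor V W v (c \<odot>\<^bsub>W\<^esub> w)"
  using assms by (simp add: smult_pure_tensor_left) (simp add: pure_tensor_def pure_balanced)

lemma smult_tensor_closed:
  "X \<in> carrier (tensor_space V W) \<Longrightarrow> c \<odot>\<^bsub>tensor_space V W\<^esub> X \<in> carrier (tensor_space V W)"
  unfolding tensor_space_def tensor_over_simps smult_tensor_over
  by (rule lift_closed[OF abelian_group_T smult_balanced])
    (use V in \<open>auto simp: cspaceD(1-4) mult.commute simp flip: cspaceD(5)[OF V]\<close>)

lemma smult_tensor_add:
  "\<lbrakk>X \<in> carrier (tensor_space V W); Y \<in> carrier (tensor_space V W)\<rbrakk> \<Longrightarrow>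
   c \<odot>\<^bsub>tensor_space V W\<^esub> (X \<oplus>\<^bsub>tensor_space V W\<^esub> Y) =
   c \<odot>\<^bsub>tensor_space V W\<^esub> X \<oplus>\<^bsub>tensor_space V W\<^esub> c \<odot>\<^bsub>tensor_space V W\<^esub> Y"
  unfolding tensor_space_def tensor_over_simps smult_tensor_over
  by (rule lift_add[OF abelian_group_T smult_balanced])
    (use V in \<open>auto simp: cspaceD(1-4) mult.commute simp flip: cspaceD(5)[OF V]\<close>)

lemma pure_tensor_add_left:
  "\<lbrakk>v \<in> carrier V; v' \<in> carrier V; w \<in> carrier W\<rbrakk> \<Longrightarrow> pure_tensor V W (v \<oplus>\<^bsub>V\<^esub> v') w =
     pure_tensor V W v w \<oplus>\<^bsub>tensor_space V W\<^esub> pure_tensor V W v' w"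
  by (simp add: pure_tensor_def tensor_space_def tensor_over_simps pure_add_left)

lemma pure_tensor_add_right:
  "\<lbrakk>v \<in> carrier V; w \<in> carrier W; w' \<in> carrier W\<rbrakk> \<Longrightarrow> pure_tensor V W v (w \<oplus>\<^bsub>W\<^esub> w') =
     pure_tensor V W v w \<oplus>\<^bsub>tensor_space V W\<^esub> pure_tensor V W v w'"
  by (simp add: pure_tensor_def tensor_space_def tensor_over_simps pure_add_right)

lemma abelian_group_tensor_space: "abelian_group (tensor_space V W)"
  by (rule abelian_group_cong[OF abelian_group_T])
    (auto simp: tensor_space_def tensor_over_simps)

lemma cspace_tensor: "cspace (tensor_space V W)"
proof (rule cspaceI[OF abelian_group_tensor_space smult_tensor_closed])
  show "c \<odot>\<^bsub>tensor_space V W\<^esub> (X \<oplus>\<^bsub>tensor_space V W\<^esub> Y) =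
      c \<odot>\<^bsub>tensor_space V W\<^esub> X \<oplus>\<^bsub>tensor_space V W\<^esub> c \<odot>\<^bsub>tensor_space V W\<^esub> Y"
    if "X \<in> carrier (tensor_space V W)" "Y \<in> carrier (tensor_space V W)" for c X Y
    using that by (rule smult_tensor_add)
  fix X c d
  assume X: "X \<in> carrier (tensor_space V W)"
  show "(c + d) \<odot>\<^bsub>tensor_space V W\<^esub> X =
      c \<odot>\<^bsub>tensor_space V W\<^esub> X \<oplus>\<^bsub>tensor_space V W\<^esub> d \<odot>\<^bsub>tensor_space V W\<^esub> X"
    using X
    by (induction rule: tensor_induct)
      (simp_all add: smult_pure_tensor_left cspaceD[OF V] pure_tensor_add_left smult_tensor_add
        smult_tensor_closed abelian_group_interchange[OF abelian_group_tensor_space])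
  show "(c * d) \<odot>\<^bsub>tensor_space V W\<^esub> X = c \<odot>\<^bsub>tensor_space V W\<^esub> (d \<odot>\<^bsub>tensor_space V W\<^esub> X)"
    using X
    by (induction rule: tensor_induct)
      (simp_all add: smult_pure_tensor_left cspaceD[OF V] smult_tensor_add smult_tensor_closed)
  show "1 \<odot>\<^bsub>tensor_space V W\<^esub> X = X"
    using X
    by (induction rule: tensor_induct)
      (simp_all add: smult_pure_tensor_left cspaceD[OF V] smult_tensor_add)
qed

lemma bilinear_pure_tensor: "bilinear V W (tensor_space V W) (pure_tensor V W)"
  by (intro bilinearI left_module_homI)
    (simp_all add: pure_tensor_closed pure_tensor_add_left pure_tensor_add_right
      smult_pure_tensor_left flip: smult_pure_tensor_right)

lemma tensor_lift_pure:
  assumes "cspace U" "bilinear V W U f" "v \<in> carrier V" "w \<in> carrier W"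
  shows "tensor_lift U f (pure_tensor V W v w) = f v w"
  unfolding pure_tensor_def
  using assms by (intro lift_pure) (auto simp: cspaceD bilinear_balanced)

lemma tensor_lift_linear:
  assumes U: "cspace U" and f: "bilinear V W U f"
  shows "tensor_lift U f \<in> linear_maps (tensor_space V W) U"
proof (rule left_module_homI)
  note U' = cspaceD(1)[OF U]
  note f' = bilinear_balanced[OF f]
  show cl: "tensor_lift U f X \<in> carrier U" if "X \<in> carrier (tensor_space V W)" for X
    using that lift_closed[OF U' f'] by (simp add: tensor_space_def tensor_over_simps)
  show add: "tensor_lift U f (X \<oplus>\<^bsub>tensor_space V W\<^esub> Y) = tensor_lift U f X \<oplus>\<^bsub>U\<^esub> tensor_lift U f Y"
    if "X \<in> carrier (tensor_space V W)" "Y \<in> carrier (tensor_space V W)" for X Y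
    using that lift_add[OF U' f'] by (simp add: tensor_space_def tensor_over_simps)
  show "tensor_lift U f (c \<odot>\<^bsub>tensor_space V W\<^esub> X) = c \<odot>\<^bsub>U\<^esub> tensor_lift U f X"
    if "X \<in> carrier (tensor_space V W)" for c X
    using that
    by (induction rule: tensor_induct)
      (simp_all add: smult_pure_tensor_left cspaceD[OF V] tensor_lift_pure[OF U f] bilinearD[OF f]
        smult_tensor_add smult_tensor_closed add cspaceD[OF U] cl)
qed

lemma linear_tensor_eqI:
  assumes "f \<in> linear_maps (tensor_space V W) U" "g \<in> linear_maps (tensor_space V W) U"
    and "\<And>v w. \<lbrakk>v \<in> carrier V; w \<in> carrier W\<rbrakk> \<Longrightarrow> f (pure_tensor V W v w) = g (pure_tensor V W v w)"
    and "X \<in> carrier (tensor_space V W)"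
  shows "f X = g X"
  using assms(4)
  by (induction rule: tensor_induct) (simp_all add: assms(3) linearD(2)[OF assms(1)] linearD(2)[OF assms(2)])

text \<open>Serves nested lifts, where the map to be lifted depends linearly on an outer variable
  and the result must again be linear in that variable.\<close>

lemma tensor_lift_linear_param:
  assumes Z: "cspace Z" and U: "cspace U" and f: "\<And>z. z \<in> carrier Z \<Longrightarrow> bilinear V W U (f z)"
    and lin: "\<And>v w. \<lbrakk>v \<in> carrier V; w \<in> carrier W\<rbrakk> \<Longrightarrow> (\<lambda>z. f z v w) \<in> linear_maps Z U"
    and X: "X \<in> carrier (tensor_space V W)"
  shows "(\<lambda>z. tensor_lift U (f z) X) \<in> linear_maps Z U"
proof (rule left_module_homI)
  note lift = linearD[OF tensor_lift_linear[OF U f]]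
  show "tensor_lift U (f z) X \<in> carrier U" if "z \<in> carrier Z" for z
    using that X by (rule lift(1))
  show "tensor_lift U (f (z \<oplus>\<^bsub>Z\<^esub> z')) X = tensor_lift U (f z) X \<oplus>\<^bsub>U\<^esub> tensor_lift U (f z') X"
    if "z \<in> carrier Z" "z' \<in> carrier Z" for z z'
    using X
  proof (induction rule: tensor_induct)
    case (pure v w)
    then show ?case
      using that linearD(2)[OF lin, of v w z z'] abelian_groupD(1)[OF cspaceD(1)[OF Z]]
      by (simp add: tensor_lift_pure[OF U f])
  next
    case (add X Y)
    then show ?case
      using that abelian_groupD(1)[OF cspaceD(1)[OF Z]]
      by (simp add: lift abelian_group_interchange[OF cspaceD(1)[OF U]])
  qed
  show "tensor_lift U (f (c \<odot>\<^bsub>Z\<^esub> z)) X = c \<odot>\<^bsub>U\<^esub> tensor_lift U (f z) X" if "z \<in> carrier Z" for c z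
    using X
  proof (induction rule: tensor_induct)
    case (pure v w)
    then show ?case
      using that linearD(3)[OF lin, of v w z c] cspaceD(2)[OF Z]
      by (simp add: tensor_lift_pure[OF U f])
  next
    case (add X Y)
    then show ?case
      using that cspaceD(2)[OF Z] by (simp add: lift cspaceD[OF U])
  qed
qed

lemma bilinear_lift_left:
  assumes "cspace Z" "cspace U" "\<And>z. z \<in> carrier Z \<Longrightarrow> bilinear V W U (f z)"
    "\<And>v w. \<lbrakk>v \<in> carrier V; w \<in> carrier W\<rbrakk> \<Longrightarrow> (\<lambda>z. f z v w) \<in> linear_maps Z U"
  shows "bilinear (tensor_space V W) Z U (\<lambda>X z. tensor_lift U (f z) X)"
    "bilinear Z (tensor_space V W) U (\<lambda>z. tensor_lift U (f z))"
  by (intro bilinearI tensor_lift_linear tensor_lift_linear_param assms; assumption)+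

end

text \<open>Multiplication in a tensor algebra and its action on M \<otimes> H are both twofold
  lifts of a map in four variables. The inner lift consumes one pair of variables and the outer lift
  the other, so bilinearity is required in either pair while the other pair is fixed.\<close>

lemma bilinear_lift_lift:
  assumes V: "cspace V" and W: "cspace W" and V': "cspace V'" and W': "cspace W'" and U: "cspace U"
    and f: "\<And>v w. \<lbrakk>v \<in> carrier V; w \<in> carrier W\<rbrakk> \<Longrightarrow> bilinear V' W' U (f v w)"
    and f': "\<And>v w. \<lbrakk>v \<in> carrier V'; w \<in> carrier W'\<rbrakk> \<Longrightarrow> bilinear V W U (\<lambda>v' w'. f v' w' v w)"
  shows "bilinear (tensor_space V W) (tensor_space V' W') U
      (\<lambda>X Y. tensor_lift U (\<lambda>v w. tensor_lift U (f v w) Y) X)"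
    "\<lbrakk>v \<in> carrier V; w \<in> carrier W; v' \<in> carrier V'; w' \<in> carrier W'\<rbrakk> \<Longrightarrow>
       tensor_lift U (\<lambda>v w. tensor_lift U (f v w) (pure_tensor V' W' v' w')) (pure_tensor V W v w) =
       f v w v' w'"
proof -
  have inner: "bilinear V W U (\<lambda>v w. tensor_lift U (f v w) Y)"
    if "Y \<in> carrier (tensor_space V' W')" for Y
  proof (rule bilinearI)
    fix w assume "w \<in> carrier W"
    then show "(\<lambda>v. tensor_lift U (f v w) Y) \<in> linear_maps V U"
      using that bilinearD(1)[OF f'] f by (intro tensor_lift_linear_param[OF V' W' V U]) auto
  next
    fix v assume "v \<in> carrier V"
    then show "(\<lambda>w. tensor_lift U (f v w) Y) \<in> linear_maps W U"
      using that bilinearD(2)[OF f'] f by (intro tensor_lift_linear_param[OF V' W' W U]) auto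
  qed
  show "bilinear (tensor_space V W) (tensor_space V' W') U
      (\<lambda>X Y. tensor_lift U (\<lambda>v w. tensor_lift U (f v w) Y) X)"
    using inner f tensor_lift_linear[OF V' W' U]
    by (intro bilinear_lift_left(1)[OF V W cspace_tensor[OF V' W'] U]) auto
  show "tensor_lift U (\<lambda>v w. tensor_lift U (f v w) (pure_tensor V' W' v' w')) (pure_tensor V W v w) =
       f v w v' w'"
    if "v \<in> carrier V" "w \<in> carrier W" "v' \<in> carrier V'" "w' \<in> carrier W'"
    using that inner[OF pure_tensor_closed[OF V' W']]
    by (simp add: tensor_lift_pure[OF V W U] tensor_lift_pure[OF V' W' U f])
qed

lemma bilinear_pure_map:
  assumes "cspace V'" "cspace W'" "f \<in> linear_maps V V'" "g \<in> linear_maps W W'"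
  shows "bilinear V W (tensor_space V' W') (\<lambda>v w. pure_tensor V' W' (f v) (g w))"
  using bilinear_comp[OF bilinear_pure_tensor[OF assms(1,2)] assms(3,4) linear_id] .

lemma tensor_map_linear:
  assumes "cspace V" "cspace W" "cspace V'" "cspace W'" "f \<in> linear_maps V V'" "g \<in> linear_maps W W'"
  shows "tensor_map V' W' f g \<in> linear_maps (tensor_space V W) (tensor_space V' W')"
  unfolding tensor_map_def using assms
  by (intro tensor_lift_linear bilinear_pure_map cspace_tensor)

lemma tensor_map_pure:
  assumes "cspace V" "cspace W" "cspace V'" "cspace W'" "f \<in> linear_maps V V'" "g \<in> linear_maps W W'"
    "v \<in> carrier V" "w \<in> carrier W"
  shows "tensor_map V' W' f g (pure_tensor V W v w) = pure_tensor V' W' (f v) (g w)"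
  unfolding tensor_map_def using assms
  by (intro tensor_lift_pure bilinear_pure_map cspace_tensor)

section \<open>The associativity isomorphism\<close>

context
  fixes U :: "(complex, 'u, 'x) module_scheme" and V :: "(complex, 'v, 'y) module_scheme"
    and W :: "(complex, 'w, 'z) module_scheme"
  assumes U: "cspace U" and V: "cspace V" and W: "cspace W"
begin

private lemma VW: "cspace (tensor_space V W)" using V W by (rule cspace_tensor)

private lemma assoc_bilinear:
  "w \<in> carrier W \<Longrightarrow>
   bilinear U V (tensor_space U (tensor_space V W)) (\<lambda>u v. pure_tensor U (tensor_space V W) u (pure_tensor V W v w))"
  by (rule bilinear_comp[OF bilinear_pure_tensor[OF U VW] linear_id _ linear_id])
    (rule bilinearD(1)[OF bilinear_pure_tensor[OF V W]])

private lemma assoc_linear: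
  "\<lbrakk>u \<in> carrier U; v \<in> carrier V\<rbrakk> \<Longrightarrow>
   (\<lambda>w. pure_tensor U (tensor_space V W) u (pure_tensor V W v w)) \<in> linear_maps W (tensor_space U (tensor_space V W))"
  by (rule linear_comp[OF bilinearD(2)[OF bilinear_pure_tensor[OF V W]] bilinearD(2)[OF bilinear_pure_tensor[OF U VW]]])

lemma tensor_assoc_linear:
  "tensor_assoc U V W \<in>
     linear_maps (tensor_space (tensor_space U V) W) (tensor_space U (tensor_space V W))"
  unfolding tensor_assoc_def Let_def
  by (intro tensor_lift_linear bilinear_lift_left U V W cspace_tensor assoc_bilinear assoc_linear)

lemma tensor_assoc_pure:
  assumes "u \<in> carrier U" "v \<in> carrier V" "w \<in> carrier W"
  shows "tensor_assoc U V W (pure_tensor (tensor_space U V) W (pure_tensor U V u v) w) =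
    pure_tensor U (tensor_space V W) u (pure_tensor V W v w)"
proof -
  let ?T = "tensor_space U (tensor_space V W)"
  have "tensor_assoc U V W (pure_tensor (tensor_space U V) W (pure_tensor U V u v) w) =
    tensor_lift ?T (\<lambda>u v. pure_tensor U (tensor_space V W) u (pure_tensor V W v w)) (pure_tensor U V u v)"
    unfolding tensor_assoc_def Let_def
    by (rule tensor_lift_pure) (use assms in \<open>auto intro!: bilinear_lift_left U V W cspace_tensor
      assoc_bilinear assoc_linear pure_tensor_closed\<close>)
  also have "\<dots> = pure_tensor U (tensor_space V W) u (pure_tensor V W v w)"
    by (rule tensor_lift_pure) (use assms in \<open>auto intro!: U V W cspace_tensor assoc_bilinear\<close>)
  finally show ?thesis .
qed

end

section \<open>Tensor products of algebras and modules\<close>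

lemma complex_algebraD:
  assumes "complex_algebra A"
  shows "cspace A" "ring A" "monoid A"
    "\<lbrakk>x \<in> carrier A; y \<in> carrier A\<rbrakk> \<Longrightarrow> x \<otimes>\<^bsub>A\<^esub> y \<in> carrier A" "\<one>\<^bsub>A\<^esub> \<in> carrier A"
    "x \<in> carrier A \<Longrightarrow> \<one>\<^bsub>A\<^esub> \<otimes>\<^bsub>A\<^esub> x = x" "x \<in> carrier A \<Longrightarrow> x \<otimes>\<^bsub>A\<^esub> \<one>\<^bsub>A\<^esub> = x"
    "\<lbrakk>x \<in> carrier A; y \<in> carrier A; z \<in> carrier A\<rbrakk> \<Longrightarrow> (x \<otimes>\<^bsub>A\<^esub> y) \<otimes>\<^bsub>A\<^esub> z = x \<otimes>\<^bsub>A\<^esub> (y \<otimes>\<^bsub>A\<^esub> z)"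
    "\<lbrakk>x \<in> carrier A; y \<in> carrier A\<rbrakk> \<Longrightarrow> (c \<odot>\<^bsub>A\<^esub> x) \<otimes>\<^bsub>A\<^esub> y = c \<odot>\<^bsub>A\<^esub> (x \<otimes>\<^bsub>A\<^esub> y)"
    "\<lbrakk>x \<in> carrier A; y \<in> carrier A\<rbrakk> \<Longrightarrow> x \<otimes>\<^bsub>A\<^esub> (c \<odot>\<^bsub>A\<^esub> y) = c \<odot>\<^bsub>A\<^esub> (x \<otimes>\<^bsub>A\<^esub> y)"
proof -
  interpret complex_algebra A by fact
  show "cspace A" "ring A" "monoid A" by unfold_locales
  show "\<lbrakk>x \<in> carrier A; y \<in> carrier A\<rbrakk> \<Longrightarrow> x \<otimes>\<^bsub>A\<^esub> y \<in> carrier A" "\<one>\<^bsub>A\<^esub> \<in> carrier A"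
    "x \<in> carrier A \<Longrightarrow> \<one>\<^bsub>A\<^esub> \<otimes>\<^bsub>A\<^esub> x = x" "x \<in> carrier A \<Longrightarrow> x \<otimes>\<^bsub>A\<^esub> \<one>\<^bsub>A\<^esub> = x"
    "\<lbrakk>x \<in> carrier A; y \<in> carrier A; z \<in> carrier A\<rbrakk> \<Longrightarrow> (x \<otimes>\<^bsub>A\<^esub> y) \<otimes>\<^bsub>A\<^esub> z = x \<otimes>\<^bsub>A\<^esub> (y \<otimes>\<^bsub>A\<^esub> z)"
    "\<lbrakk>x \<in> carrier A; y \<in> carrier A\<rbrakk> \<Longrightarrow> (c \<odot>\<^bsub>A\<^esub> x) \<otimes>\<^bsub>A\<^esub> y = c \<odot>\<^bsub>A\<^esub> (x \<otimes>\<^bsub>A\<^esub> y)"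
    "\<lbrakk>x \<in> carrier A; y \<in> carrier A\<rbrakk> \<Longrightarrow> x \<otimes>\<^bsub>A\<^esub> (c \<odot>\<^bsub>A\<^esub> y) = c \<odot>\<^bsub>A\<^esub> (x \<otimes>\<^bsub>A\<^esub> y)"
    using smult_mult_left[of x y c] smult_mult_right[of x y c]
    by (simp_all add: m_assoc)
qed

lemma complex_algebraI:
  assumes A: "cspace A" and m: "bilinear A A A (\<otimes>\<^bsub>A\<^esub>)" and one: "\<one>\<^bsub>A\<^esub> \<in> carrier A"
    "\<And>x. x \<in> carrier A \<Longrightarrow> \<one>\<^bsub>A\<^esub> \<otimes>\<^bsub>A\<^esub> x = x" "\<And>x. x \<in> carrier A \<Longrightarrow> x \<otimes>\<^bsub>A\<^esub> \<one>\<^bsub>A\<^esub> = x"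
    and assoc: "\<And>x y z. \<lbrakk>x \<in> carrier A; y \<in> carrier A; z \<in> carrier A\<rbrakk> \<Longrightarrow>
      (x \<otimes>\<^bsub>A\<^esub> y) \<otimes>\<^bsub>A\<^esub> z = x \<otimes>\<^bsub>A\<^esub> (y \<otimes>\<^bsub>A\<^esub> z)"
  shows "complex_algebra A"
proof -
  have "ring A"
    by (intro ringI monoidI cspaceD(1)[OF A]) (use assms in \<open>auto simp: bilinearD[OF m]\<close>)
  then show ?thesis
    by (intro complex_algebra.intro complex_algebra_axioms.intro A) (auto simp: bilinearD[OF m])
qed

lemma bilinear_mult:
  assumes "complex_algebra A"
  shows "bilinear A A A (\<otimes>\<^bsub>A\<^esub>)"
proof -
  interpret complex_algebra A by fact
  show ?thesis
    by (intro bilinearI left_module_homI)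
      (auto simp: complex_algebraD[OF assms] l_distr r_distr)
qed

section \<open>Modules over a complex algebra as complex vector spaces\<close>

context
  fixes A :: "(complex, 'a, 'x) module_scheme" and M :: "('a, 'm, 'y) module_scheme"
  assumes A: "complex_algebra A" and M: "left_module A M"
begin

interpretation A: complex_algebra A by (fact A)
interpretation M: left_module A M by (fact M)

lemma underlying_space_simps:
  "carrier (underlying_space A M) = carrier M"
  "x \<oplus>\<^bsub>underlying_space A M\<^esub> y = x \<oplus>\<^bsub>M\<^esub> y"
  "\<zero>\<^bsub>underlying_space A M\<^esub> = \<zero>\<^bsub>M\<^esub>"
  "c \<odot>\<^bsub>underlying_space A M\<^esub> x = (c \<odot>\<^bsub>A\<^esub> \<one>\<^bsub>A\<^esub>) \<odot>\<^bsub>M\<^esub> x"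
  by (simp_all add: underlying_space_def)

private lemma scalar_mult:
  "a \<in> carrier A \<Longrightarrow> (c \<odot>\<^bsub>A\<^esub> \<one>\<^bsub>A\<^esub>) \<otimes>\<^bsub>A\<^esub> a = c \<odot>\<^bsub>A\<^esub> a"
  "a \<in> carrier A \<Longrightarrow> a \<otimes>\<^bsub>A\<^esub> (c \<odot>\<^bsub>A\<^esub> \<one>\<^bsub>A\<^esub>) = c \<odot>\<^bsub>A\<^esub> a"
  by (simp_all add: complex_algebraD[OF A])

private lemma scalar_scalar:
  "(c * d) \<odot>\<^bsub>A\<^esub> \<one>\<^bsub>A\<^esub> = (c \<odot>\<^bsub>A\<^esub> \<one>\<^bsub>A\<^esub>) \<otimes>\<^bsub>A\<^esub> (d \<odot>\<^bsub>A\<^esub> \<one>\<^bsub>A\<^esub>)"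
  by (subst scalar_mult(1)) (simp_all add: cspaceD[OF complex_algebraD(1)[OF A]])

lemma cspace_underlying: "cspace (underlying_space A M)"
proof (rule cspaceI)
  show "abelian_group (underlying_space A M)"
    by (rule abelian_group_cong[OF M.M.abelian_group_axioms]) (simp_all add: underlying_space_def)
qed (simp_all add: underlying_space_simps M.act_closed M.act_r_distr M.act_one M.act_l_distr M.act_assoc
    scalar_scalar cspaceD(2-4,6)[OF complex_algebraD(1)[OF A]])

text \<open>Linearity in the module argument holds because scalars act through the elements
  \<open>c \<odot> \<one>\<close>, which are central in \<open>A\<close>.\<close>

lemma bilinear_act: "bilinear A (underlying_space A M) (underlying_space A M) (\<odot>\<^bsub>M\<^esub>)"
  by (intro bilinearI left_module_homI)
    (simp_all add: underlying_space_simps M.act_closed M.act_r_distr M.act_l_distr scalar_mult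
      flip: M.act_assoc)

end

context
  fixes A :: "(complex, 'a, 'x) module_scheme" and M :: "('a, 'm, 'y) module_scheme"
    and H :: "(complex, 'h, 'z) module_scheme"
  assumes A: "complex_algebra A" and M: "left_module A M" and H: "complex_algebra H"
begin

private abbreviation "V \<equiv> underlying_space A M"
private abbreviation "N \<equiv> tensor_left_module A M H"

private lemmas V = cspace_underlying[OF A M]
private lemmas A' = complex_algebraD(1)[OF A]
private lemmas H' = complex_algebraD(1)[OF H]
private lemmas VH = cspace_tensor[OF V H']

lemma tensor_left_module_simps:
  "carrier N = carrier (tensor_space V H)" "x \<oplus>\<^bsub>N\<^esub> y = x \<oplus>\<^bsub>tensor_space V H\<^esub> y"
  "\<zero>\<^bsub>N\<^esub> = \<zero>\<^bsub>tensor_space V H\<^esub>" "add N = add (tensor_space V H)"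
  by (simp_all add: tensor_left_module_def Let_def)

private lemma action_bilinear:
  assumes "a \<in> carrier A" "h \<in> carrier H"
  shows "bilinear V H (tensor_space V H) (\<lambda>m k. pure_tensor V H (a \<odot>\<^bsub>M\<^esub> m) (h \<otimes>\<^bsub>H\<^esub> k))"
  using assms bilinearD(2)[OF bilinear_act[OF A M]] bilinearD(2)[OF bilinear_mult[OF H]]
  by (intro bilinear_pure_map V H')

private lemma action_bilinear':
  assumes "m \<in> carrier V" "k \<in> carrier H"
  shows "bilinear A H (tensor_space V H) (\<lambda>a h. pure_tensor V H (a \<odot>\<^bsub>M\<^esub> m) (h \<otimes>\<^bsub>H\<^esub> k))"
  using assms bilinearD(1)[OF bilinear_act[OF A M]] bilinearD(1)[OF bilinear_mult[OF H]]
  by (intro bilinear_pure_map V H')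

lemma bilinear_tensor_act:
  "bilinear (tensor_space A H) (tensor_space V H) (tensor_space V H) (\<odot>\<^bsub>N\<^esub>)"
  using bilinear_lift_lift(1)[OF A' H' V H' VH action_bilinear action_bilinear']
  by (simp add: tensor_left_module_def Let_def)

lemma tensor_act_pure:
  "\<lbrakk>a \<in> carrier A; h \<in> carrier H; m \<in> carrier M; k \<in> carrier H\<rbrakk> \<Longrightarrow>
     pure_tensor A H a h \<odot>\<^bsub>N\<^esub> pure_tensor V H m k = pure_tensor V H (a \<odot>\<^bsub>M\<^esub> m) (h \<otimes>\<^bsub>H\<^esub> k)"
  using bilinear_lift_lift(2)[OF A' H' V H' VH action_bilinear action_bilinear']
  by (simp add: tensor_left_module_def Let_def underlying_space_simps[OF A M])

end

section \<open>The algebra structure on a tensor product\<close>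

context
  fixes A :: "(complex, 'a, 'x) module_scheme" and B :: "(complex, 'b, 'y) module_scheme"
  assumes A: "complex_algebra A" and B: "complex_algebra B"
begin

private abbreviation "T \<equiv> tensor_space A B"
private abbreviation "AB \<equiv> tensor_algebra A B"

lemma tensor_algebra_simps:
  "carrier AB = carrier T" "x \<oplus>\<^bsub>AB\<^esub> y = x \<oplus>\<^bsub>T\<^esub> y" "\<zero>\<^bsub>AB\<^esub> = \<zero>\<^bsub>T\<^esub>" "c \<odot>\<^bsub>AB\<^esub> x = c \<odot>\<^bsub>T\<^esub> x"
  "\<one>\<^bsub>AB\<^esub> = pure_tensor A B \<one>\<^bsub>A\<^esub> \<one>\<^bsub>B\<^esub>" "add AB = add T" "smult AB = smult T"
  by (simp_all add: tensor_algebra_def)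

private lemmas cA = complex_algebraD(1)[OF A]
private lemmas cB = complex_algebraD(1)[OF B]
private lemmas cT = cspace_tensor[OF cA cB]

private lemma mult_bilinear:
  assumes "a \<in> carrier A" "b \<in> carrier B"
  shows "bilinear A B T (\<lambda>a' b'. pure_tensor A B (a \<otimes>\<^bsub>A\<^esub> a') (b \<otimes>\<^bsub>B\<^esub> b'))"
    "bilinear A B T (\<lambda>a' b'. pure_tensor A B (a' \<otimes>\<^bsub>A\<^esub> a) (b' \<otimes>\<^bsub>B\<^esub> b))"
  using assms bilinearD(2)[OF bilinear_mult[OF A]] bilinearD(2)[OF bilinear_mult[OF B]]
    bilinearD(1)[OF bilinear_mult[OF A]] bilinearD(1)[OF bilinear_mult[OF B]]
  by (auto intro!: bilinear_pure_map cA cB)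

lemma bilinear_tensor_mult: "bilinear T T T (\<otimes>\<^bsub>AB\<^esub>)"
  using bilinear_lift_lift(1)[OF cA cB cA cB cT mult_bilinear]
  by (simp add: tensor_algebra_def)

lemma tensor_mult_pure:
  "\<lbrakk>a \<in> carrier A; b \<in> carrier B; a' \<in> carrier A; b' \<in> carrier B\<rbrakk> \<Longrightarrow>
     pure_tensor A B a b \<otimes>\<^bsub>AB\<^esub> pure_tensor A B a' b' = pure_tensor A B (a \<otimes>\<^bsub>A\<^esub> a') (b \<otimes>\<^bsub>B\<^esub> b')"
  using bilinear_lift_lift(2)[OF cA cB cA cB cT mult_bilinear]
  by (simp add: tensor_algebra_def)

lemma complex_algebra_tensor: "complex_algebra AB"
proof (rule complex_algebraI)
  note T_add = abelian_groupD(1)[OF cspaceD(1)[OF cT]]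
  note m = bilinearD[OF bilinear_tensor_mult]
  show "cspace AB"
    by (rule cspaceI, rule abelian_group_cong[OF cspaceD(1)[OF cT]])
      (simp_all add: tensor_algebra_simps cspaceD[OF cT])
  show "bilinear AB AB AB (\<otimes>\<^bsub>AB\<^esub>)"
    using bilinear_tensor_mult
    by (simp add: bilinear_def left_module_hom_def tensor_algebra_simps)
  show "\<one>\<^bsub>AB\<^esub> \<in> carrier AB"
    by (simp add: tensor_algebra_simps pure_tensor_closed cA cB complex_algebraD[OF A] complex_algebraD[OF B])
  show "\<one>\<^bsub>AB\<^esub> \<otimes>\<^bsub>AB\<^esub> X = X" if "X \<in> carrier AB" for X
    using that unfolding tensor_algebra_simps(1)
    by (induction rule: tensor_induct[OF cA cB, consumes 1, case_names pure add])
      (simp_all add: tensor_algebra_simps tensor_mult_pure m pure_tensor_closed cA cB complex_algebraD[OF A] complex_algebraD[OF B])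
  show "X \<otimes>\<^bsub>AB\<^esub> \<one>\<^bsub>AB\<^esub> = X" if "X \<in> carrier AB" for X
    using that unfolding tensor_algebra_simps(1)
    by (induction rule: tensor_induct[OF cA cB, consumes 1, case_names pure add])
      (simp_all add: tensor_algebra_simps tensor_mult_pure m pure_tensor_closed cA cB complex_algebraD[OF A] complex_algebraD[OF B])
  show "X \<otimes>\<^bsub>AB\<^esub> Y \<otimes>\<^bsub>AB\<^esub> Z = X \<otimes>\<^bsub>AB\<^esub> (Y \<otimes>\<^bsub>AB\<^esub> Z)"
    if "X \<in> carrier AB" "Y \<in> carrier AB" "Z \<in> carrier AB" for X Y Z
    using that unfolding tensor_algebra_simps
  proof (induction X rule: tensor_induct[OF cA cB, consumes 1, case_names pure add])
    case (pure a b)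
    note ab = this
    show ?case
      using \<open>Y \<in> carrier T\<close>
    proof (induction Y rule: tensor_induct[OF cA cB, consumes 1, case_names pure add])
      case (pure a' b')
      show ?case
        using \<open>Z \<in> carrier T\<close>
        by (induction Z rule: tensor_induct[OF cA cB, consumes 1, case_names pure add])
          (use ab pure in \<open>simp_all add: tensor_mult_pure m pure_tensor_closed cA cB
            complex_algebraD[OF A] complex_algebraD[OF B]\<close>)
    qed (use ab in \<open>simp_all add: m pure_tensor_closed cA cB\<close>)
  qed (simp_all add: m)
qed

end

text \<open>With X \<Delta>(h) in place of a product and a value of the coaction for
  \<open>Z\<close>, this is what makes the induced map both balanced over \<open>H\<close> and
  linear over H \<otimes> H.\<close>

lemma tensor_act_assoc:
  assumes A: "complex_algebra A" and M: "left_module A M" and H: "complex_algebra H"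
    and "X \<in> carrier (tensor_space A H)" "Y \<in> carrier (tensor_space A H)"
      "Z \<in> carrier (tensor_space (underlying_space A M) H)"
  shows "(X \<otimes>\<^bsub>tensor_algebra A H\<^esub> Y) \<odot>\<^bsub>tensor_left_module A M H\<^esub> Z =
    X \<odot>\<^bsub>tensor_left_module A M H\<^esub> (Y \<odot>\<^bsub>tensor_left_module A M H\<^esub> Z)"
proof -
  interpret M: left_module A M by (fact M)
  note A' = complex_algebraD(1)[OF A] and H' = complex_algebraD(1)[OF H]
    and V' = cspace_underlying[OF A M]
  note m = bilinearD[OF bilinear_tensor_mult[OF A H]]
    and n = bilinearD[OF bilinear_tensor_act[OF A M H]]
  note simps = tensor_mult_pure[OF A H] tensor_act_pure[OF A M H] m n complex_algebraD[OF A]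
    complex_algebraD[OF H] pure_tensor_closed A' H' V' underlying_space_simps[OF A M] M.act_closed
    M.act_assoc
  show ?thesis
    using assms(4-)
  proof (induction X rule: tensor_induct[OF A' H', consumes 1, case_names pure add])
    case (pure a h)
    note ah = this
    show ?case
      using \<open>Y \<in> carrier (tensor_space A H)\<close>
    proof (induction Y rule: tensor_induct[OF A' H', consumes 1, case_names pure add])
      case (pure a' h')
      show ?case
        using \<open>Z \<in> _\<close>
        by (induction Z rule: tensor_induct[OF V' H', consumes 1, case_names pure add]) (use ah pure in \<open>simp_all add: simps\<close>)
    qed (use ah \<open>Z \<in> _\<close> in \<open>simp_all add: simps\<close>)
  qed (simp_all add: simps)
qed

lemma tensor_map_mult:
  assumes A: "complex_algebra A" and B: "complex_algebra B" and A1: "complex_algebra A1" and B1: "complex_algebra B1"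
    and f: "f \<in> linear_maps A A1" "\<And>x y. \<lbrakk>x \<in> carrier A; y \<in> carrier A\<rbrakk> \<Longrightarrow> f (x \<otimes>\<^bsub>A\<^esub> y) = f x \<otimes>\<^bsub>A1\<^esub> f y"
    and g: "g \<in> linear_maps B B1" "\<And>x y. \<lbrakk>x \<in> carrier B; y \<in> carrier B\<rbrakk> \<Longrightarrow> g (x \<otimes>\<^bsub>B\<^esub> y) = g x \<otimes>\<^bsub>B1\<^esub> g y"
    and X: "X \<in> carrier (tensor_space A B)" and Y: "Y \<in> carrier (tensor_space A B)"
  shows "tensor_map A1 B1 f g (X \<otimes>\<^bsub>tensor_algebra A B\<^esub> Y) =
    tensor_map A1 B1 f g X \<otimes>\<^bsub>tensor_algebra A1 B1\<^esub> tensor_map A1 B1 f g Y"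
proof -
  note A' = complex_algebraD(1)[OF A] and B' = complex_algebraD(1)[OF B]
    and A1' = complex_algebraD(1)[OF A1] and B1' = complex_algebraD(1)[OF B1]
  note m = bilinearD[OF bilinear_tensor_mult[OF A B]]
    and n = bilinearD[OF bilinear_tensor_mult[OF A1 B1]]
    and l = linearD[OF tensor_map_linear[OF A' B' A1' B1' f(1) g(1)]]
  note simps = tensor_mult_pure[OF A B] tensor_mult_pure[OF A1 B1] m n l f(2) g(2)
    linearD[OF f(1)] linearD[OF g(1)] tensor_map_pure[OF A' B' A1' B1' f(1) g(1)]
    pure_tensor_closed A' B' A1' B1' complex_algebraD[OF A] complex_algebraD[OF B]
  show ?thesis
    using X Y
  proof (induction X rule: tensor_induct[OF A' B', consumes 1, case_names pure add])
    case (pure a b)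
    note ab = this
    show ?case
      using \<open>Y \<in> _\<close>
      by (induction Y rule: tensor_induct[OF A' B', consumes 1, case_names pure add]) (use ab in \<open>simp_all add: simps\<close>)
  qed (simp_all add: simps)
qed

text \<open>The construction reads only the carrier, addition and scalar multiplication of its
  factors. Hence records that differ in other fields have literally equal tensor products, and no
  isomorphism has to be carried along.\<close>

lemma tensor_space_cong:
  assumes "carrier V' = carrier V" "add V' = add V" "smult V' = smult V"
    "carrier W' = carrier W" "add W' = add W" "smult W' = smult W"
  shows "tensor_space V' W' = tensor_space V W" "pure_tensor V' W' = pure_tensor V W"
proof -
  have 1: "tensor_null complex_ring V' (\<lambda>v c. c \<odot>\<^bsub>V'\<^esub> v) W' = tensor_null complex_ring V (\<lambda>v c. c \<odot>\<^bsub>V\<^esub> v) W"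
    by (simp add: tensor_null_def tensor_relations_def assms)
  then have 2: "pure_tensor_over complex_ring V' (\<lambda>v c. c \<odot>\<^bsub>V'\<^esub> v) W' = pure_tensor_over complex_ring V (\<lambda>v c. c \<odot>\<^bsub>V\<^esub> v) W"
    by (simp add: pure_tensor_over_def fun_eq_iff assms)
  show "tensor_space V' W' = tensor_space V W"
    using 1 2 by (simp add: tensor_space_def tensor_over_def tensor_group_def assms)
  show "pure_tensor V' W' = pure_tensor V W"
    using 2 by (simp add: pure_tensor_def)
qed

lemma tensor_space_tensor_algebra:
  "tensor_space (tensor_algebra A B) W = tensor_space (tensor_space A B) W"
  "tensor_space W (tensor_algebra A B) = tensor_space W (tensor_space A B)"
  "pure_tensor (tensor_algebra A B) W = pure_tensor (tensor_space A B) W"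
  "pure_tensor W (tensor_algebra A B) = pure_tensor W (tensor_space A B)"
  by (rule tensor_space_cong; simp add: tensor_algebra_def)+

lemma tensor_map_tensor_algebra:
  "tensor_map (tensor_algebra A B) W = tensor_map (tensor_space A B) W"
  "tensor_map W (tensor_algebra A B) = tensor_map W (tensor_space A B)"
  by (simp_all add: tensor_map_def tensor_space_tensor_algebra fun_eq_iff)

lemma tensor_induct3 [consumes 4, case_names pure add]:
  assumes U: "cspace U" and V: "cspace V" and W: "cspace W"
    and X: "X \<in> carrier (tensor_space (tensor_space U V) W)"
    and pure: "\<And>u v w. \<lbrakk>u \<in> carrier U; v \<in> carrier V; w \<in> carrier W\<rbrakk> \<Longrightarrow>
      P (pure_tensor (tensor_space U V) W (pure_tensor U V u v) w)"
    and add: "\<And>X Y. \<lbrakk>X \<in> carrier (tensor_space (tensor_space U V) W);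
      Y \<in> carrier (tensor_space (tensor_space U V) W); P X; P Y\<rbrakk>
      \<Longrightarrow> P (X \<oplus>\<^bsub>tensor_space (tensor_space U V) W\<^esub> Y)"
  shows "P X"
  using X
proof (induction X rule: tensor_induct[OF cspace_tensor[OF U V] W, consumes 1, case_names pure add])
  case (pure Z w)
  from pure(1) show ?case
    by (induction Z rule: tensor_induct[OF U V, consumes 1, case_names pure add])
      (auto simp: assms(5) pure pure_tensor_add_left[OF cspace_tensor[OF U V] W]
        intro!: add pure_tensor_closed[OF cspace_tensor[OF U V] W])
qed (rule add)

text \<open>Makes both sides of coassociativity in Takeuchi's algebra algebra homomorphisms, so that
  it is enough to compare them on generators.\<close>

lemma tensor_assoc_mult:
  assumes A: "complex_algebra A" and B: "complex_algebra B" and C: "complex_algebra C"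
    and X: "X \<in> carrier (tensor_space (tensor_space A B) C)" and Y: "Y \<in> carrier (tensor_space (tensor_space A B) C)"
  shows "tensor_assoc A B C (X \<otimes>\<^bsub>tensor_algebra (tensor_algebra A B) C\<^esub> Y) =
    tensor_assoc A B C X \<otimes>\<^bsub>tensor_algebra A (tensor_algebra B C)\<^esub> tensor_assoc A B C Y"
proof -
  note A' = complex_algebraD(1)[OF A] and B' = complex_algebraD(1)[OF B] and C' = complex_algebraD(1)[OF C]
    and AB = complex_algebra_tensor[OF A B] and BC = complex_algebra_tensor[OF B C]
    and AB' = cspace_tensor[OF complex_algebraD(1)[OF A] complex_algebraD(1)[OF B]]
    and BC' = cspace_tensor[OF complex_algebraD(1)[OF B] complex_algebraD(1)[OF C]]
  note m = bilinearD[OF bilinear_tensor_mult[OF AB C], unfolded tensor_space_tensor_algebra]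
    and n = bilinearD[OF bilinear_tensor_mult[OF A BC], unfolded tensor_space_tensor_algebra]
    and l = linearD[OF tensor_assoc_linear[OF A' B' C']]
    and p = tensor_mult_pure[OF AB C, unfolded tensor_space_tensor_algebra tensor_algebra_simps[OF A B]]
      tensor_mult_pure[OF A BC, unfolded tensor_space_tensor_algebra tensor_algebra_simps[OF B C]]
  note simps = m n l p tensor_assoc_pure[OF A' B' C'] tensor_mult_pure[OF A B] tensor_mult_pure[OF B C]
    pure_tensor_closed A' B' C' AB' BC' complex_algebraD(4)
    complex_algebraD(4)[OF A] complex_algebraD(4)[OF B] complex_algebraD(4)[OF C]
  show ?thesis
    using X Y
  proof (induction X rule: tensor_induct3[OF A' B' C', consumes 1, case_names pure add])
    case (pure a b c)
    note abc = this
    show ?case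
      using \<open>Y \<in> _\<close>
      by (induction Y rule: tensor_induct3[OF A' B' C', consumes 1, case_names pure add]) (use abc in \<open>simp_all add: simps\<close>)
  qed (simp_all add: simps)
qed

section \<open>The twisted coaction of a Hopf algebra with a multiplicative matrix\<close>

lemma regular_module_simps [simp]:
  "carrier (regular_module A) = carrier A" "x \<oplus>\<^bsub>regular_module A\<^esub> y = x \<oplus>\<^bsub>A\<^esub> y"
  "\<zero>\<^bsub>regular_module A\<^esub> = \<zero>\<^bsub>A\<^esub>" "x \<odot>\<^bsub>regular_module A\<^esub> y = x \<otimes>\<^bsub>A\<^esub> y"
  "add (regular_module A) = add A"
  by (simp_all add: regular_module_def)

lemma free_module2_simps:
  "carrier (free_module2 A) = carrier A \<times> carrier A"
  "(x, y) \<oplus>\<^bsub>free_module2 A\<^esub> (x', y') = (x \<oplus>\<^bsub>A\<^esub> x', y \<oplus>\<^bsub>A\<^esub> y')"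
  "\<zero>\<^bsub>free_module2 A\<^esub> = (\<zero>\<^bsub>A\<^esub>, \<zero>\<^bsub>A\<^esub>)" "a \<odot>\<^bsub>free_module2 A\<^esub> (x, y) = (a \<otimes>\<^bsub>A\<^esub> x, a \<otimes>\<^bsub>A\<^esub> y)"
  by (simp_all add: free_module2_def module_sum_def)

lemma (in ring) left_module_free_module2: "left_module R (free_module2 R)"
proof -
  have "abelian_group (free_module2 R)"
  proof (rule abelian_groupI)
    fix x assume "x \<in> carrier (free_module2 R)"
    then show "\<exists>y\<in>carrier (free_module2 R). y \<oplus>\<^bsub>free_module2 R\<^esub> x = \<zero>\<^bsub>free_module2 R\<^esub>"
      by (intro bexI[of _ "(\<ominus> fst x, \<ominus> snd x)"]) (auto simp: free_module2_simps l_neg)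
  qed (auto simp: free_module2_simps a_ac)
  then show ?thesis
    by (intro left_module.intro left_module_axioms.intro ring_axioms)
      (auto simp: free_module2_simps l_distr r_distr m_assoc)
qed

lemma UNIV_two: "(UNIV :: 2 set) = {0, 1}"
  by (rule card_subset_eq[symmetric]) auto

lemma two_cases: "(q :: 2) = 0 \<or> q = 1"
  using UNIV_two by auto

text \<open>The coaction and its induced map are studied over any Hopf algebra with a multiplicative
  matrix. Freeness enters only afterwards, through the representation that supplies an annihilated
  vector.\<close>

locale matrix_hopf_algebra = hopf_algebra H for H :: "('h, 'x) coalg_scheme" (structure) +
  fixes a :: "2 \<Rightarrow> 2 \<Rightarrow> 'h"
  assumes a_closed: "a i j \<in> carrier H"
    and comult_a: "comult H (a i j) =
      pure_tensor H H (a i 0) (a 0 j) \<oplus>\<^bsub>tensor_space H H\<^esub> pure_tensor H H (a i 1) (a 1 j)"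
    and counit_a: "counit H (a i j) = (if i = j then 1 else 0)"
begin

abbreviation "M \<equiv> free_module2 H"
abbreviation "V \<equiv> underlying_space H M"
abbreviation "HH \<equiv> tensor_space H H"
abbreviation "MH \<equiv> tensor_space V H"
abbreviation "N \<equiv> tensor_left_module H M H"
abbreviation "\<Delta> \<equiv> comult H"
abbreviation "\<epsilon> \<equiv> counit H"

abbreviation fst_emb :: "'h \<Rightarrow> 'h \<times> 'h" where "fst_emb u \<equiv> (u, \<zero>)"
abbreviation snd_emb :: "'h \<Rightarrow> 'h \<times> 'h" where "snd_emb u \<equiv> (\<zero>, u)"
abbreviation "twist e b \<equiv> tensor_map V H e (\<lambda>v. v \<otimes> b)"

text \<open>\<open>column q (\<Delta> k)\<close> is the value of the coaction at \<open>k\<close> in the \<open>q\<close>-th summand of \<open>M\<close>.\<close>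

definition column :: "2 \<Rightarrow> ('h, 'h) tensor \<Rightarrow> ('h \<times> 'h, 'h) tensor" where
  "column q Z = twist fst_emb (a 0 q) Z \<oplus>\<^bsub>MH\<^esub> twist snd_emb (a 1 q) Z"

lemma H: "complex_algebra H" by (rule complex_algebra_axioms)
lemma H': "cspace H" by (rule module_axioms)
lemma M: "left_module H M" by (rule left_module_free_module2)
lemma V: "cspace V" by (rule cspace_underlying[OF H M])
lemma HH: "cspace HH" by (rule cspace_tensor[OF H' H'])
lemma MH: "cspace MH" by (rule cspace_tensor[OF V H'])
lemma MHH: "cspace (tensor_space V HH)" by (rule cspace_tensor[OF V HH])

lemma V_simps:
  "carrier V = carrier H \<times> carrier H" "(x, y) \<oplus>\<^bsub>V\<^esub> (x', y') = (x \<oplus> x', y \<oplus> y')"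
  "\<zero>\<^bsub>V\<^esub> = (\<zero>, \<zero>)"
  "\<lbrakk>x \<in> carrier H; y \<in> carrier H\<rbrakk> \<Longrightarrow> c \<odot>\<^bsub>V\<^esub> (x, y) = (c \<odot> x, c \<odot> y)"
  by (simp_all add: underlying_space_simps[OF H M] free_module2_simps complex_algebraD[OF H])

lemma \<Delta>_closed: "x \<in> carrier H \<Longrightarrow> \<Delta> x \<in> carrier HH"
  by (rule linearD(1)[OF comult_linear])

lemma \<Delta>_mult: "\<lbrakk>x \<in> carrier H; y \<in> carrier H\<rbrakk> \<Longrightarrow> \<Delta> (x \<otimes> y) = \<Delta> x \<otimes>\<^bsub>tensor_algebra H H\<^esub> \<Delta> y"
  by (rule ring_hom_mult[OF comult_ring_hom])

lemma \<epsilon>_mult: "\<lbrakk>x \<in> carrier H; y \<in> carrier H\<rbrakk> \<Longrightarrow> \<epsilon> (x \<otimes> y) = \<epsilon> x * \<epsilon> y"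
  using ring_hom_mult[OF counit_ring_hom, of x y] by simp

lemma \<epsilon>_one: "\<epsilon> \<one> = 1"
  using ring_hom_one[OF counit_ring_hom] by simp

lemma \<epsilon>_linear:
  "\<lbrakk>x \<in> carrier H; y \<in> carrier H\<rbrakk> \<Longrightarrow> \<epsilon> (x \<oplus> y) = \<epsilon> x + \<epsilon> y"
  "x \<in> carrier H \<Longrightarrow> \<epsilon> (c \<odot> x) = c * \<epsilon> x"
  using linearD(2,3)[OF counit_linear] by simp_all

lemma \<epsilon>_zero: "\<epsilon> \<zero> = 0"
  using \<epsilon>_linear(2)[of \<zero> 0] smult_zero[OF H', of \<zero>] by simp

lemma emb_linear: "fst_emb \<in> linear_maps H V" "snd_emb \<in> linear_maps H V"
  by (rule left_module_homI; simp add: V_simps smult_zero[OF H'] del: One_nat_def)+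

lemma mult_right_linear: "b \<in> carrier H \<Longrightarrow> (\<lambda>v. v \<otimes> b) \<in> linear_maps H H"
  by (rule bilinearD(1)[OF bilinear_mult[OF H]])

lemma twist_linear:
  "\<lbrakk>e \<in> linear_maps H V; b \<in> carrier H\<rbrakk> \<Longrightarrow> twist e b \<in> linear_maps HH MH"
  by (intro tensor_map_linear H' V mult_right_linear)

lemma twist_pure:
  "\<lbrakk>e \<in> linear_maps H V; b \<in> carrier H; u \<in> carrier H; v \<in> carrier H\<rbrakk> \<Longrightarrow>
    twist e b (pure_tensor H H u v) = pure_tensor V H (e u) (v \<otimes> b)"
  by (intro tensor_map_pure H' V mult_right_linear)

lemma column_linear: "column q \<in> linear_maps HH MH"
  unfolding column_def by (intro linear_add MH twist_linear emb_linear a_closed)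

lemma column_comult_linear: "(\<lambda>k. column q (\<Delta> k)) \<in> linear_maps H MH"
  by (rule linear_comp[OF comult_linear column_linear])

text \<open>The four terms are collected by the coordinate they come from, not by the coordinate
  they land in. Each axiom of the coaction then reduces to a statement about a single
  column.\<close>

lemma coaction_column:
  assumes "k0 \<in> carrier H" "k1 \<in> carrier H"
  shows "twisted_coaction H a (k0, k1) = column 0 (\<Delta> k0) \<oplus>\<^bsub>MH\<^esub> column 1 (\<Delta> k1)"
proof -
  interpret MH: abelian_group MH by (rule cspaceD(1)[OF MH])
  have "twist e (a i j) (\<Delta> k) \<in> carrier MH" if "k \<in> carrier H" "e \<in> linear_maps H V" for e i j k
    using that by (intro linearD(1)[OF twist_linear] a_closed \<Delta>_closed)
  then show ?thesis
    using assms emb_linear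
    by (simp add: twisted_coaction_def sweedler_def tensor_map_def[symmetric] Let_def column_def MH.a_ac)
qed

lemma coaction_linear: "twisted_coaction H a \<in> linear_maps V MH"
proof -
  have "fst \<in> linear_maps V H" "snd \<in> linear_maps V H"
    by (rule left_module_homI; force simp: V_simps)+
  then have "(\<lambda>m. column 0 (\<Delta> (fst m)) \<oplus>\<^bsub>MH\<^esub> column 1 (\<Delta> (snd m))) \<in> linear_maps V MH" (is "?f \<in> _")
    by (intro linear_add MH linear_comp[OF _ column_comult_linear])
  moreover have "?f m = twisted_coaction H a m" if "m \<in> carrier V" for m
    using that by (cases m) (simp add: coaction_column V_simps)
  moreover have "x \<oplus>\<^bsub>V\<^esub> y \<in> carrier V" "c \<odot>\<^bsub>V\<^esub> x \<in> carrier V"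
    if "x \<in> carrier V" "y \<in> carrier V" for x y c
    using that by (simp_all add: cspaceD[OF V] abelian_groupD[OF cspaceD(1)[OF V]])
  ultimately show ?thesis
    by (simp add: left_module_hom_def Pi_iff)
qed

lemma coaction_emb:
  assumes "k \<in> carrier H"
  shows "twisted_coaction H a (fst_emb k) = column 0 (\<Delta> k)"
    "twisted_coaction H a (snd_emb k) = column 1 (\<Delta> k)"
proof -
  have "column q (\<Delta> \<zero>) = \<zero>\<^bsub>MH\<^esub>" for q
    using linear_zero[OF column_comult_linear H' MH] .
  moreover have "column q (\<Delta> k) \<in> carrier MH" for q
    using assms by (rule linearD(1)[OF column_comult_linear])
  ultimately show "twisted_coaction H a (fst_emb k) = column 0 (\<Delta> k)"
    "twisted_coaction H a (snd_emb k) = column 1 (\<Delta> k)"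
    using assms by (simp_all add: coaction_column abelian_groupD[OF cspaceD(1)[OF MH]])
qed

subsection \<open>Compatibility with the module structure\<close>

text \<open>A twist multiplies the second factor from the right, so it commutes with the action of H
  \<otimes> H from the left. Together with multiplicativity of \<Delta> this is the reason that the
  coaction is over \<Delta>.\<close>

lemma twist_mult:
  assumes e: "e \<in> linear_maps H V" "\<And>h u. \<lbrakk>h \<in> carrier H; u \<in> carrier H\<rbrakk> \<Longrightarrow> e (h \<otimes> u) = h \<odot>\<^bsub>M\<^esub> e u"
    and b: "b \<in> carrier H" and X: "X \<in> carrier HH" and Y: "Y \<in> carrier HH"
  shows "twist e b (X \<otimes>\<^bsub>tensor_algebra H H\<^esub> Y) = X \<odot>\<^bsub>N\<^esub> twist e b Y"
proof -
  have eM: "e u \<in> carrier M" if "u \<in> carrier H" for u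
    using linearD(1)[OF e(1) that] by (simp add: underlying_space_simps[OF H M])
  note simps = tensor_mult_pure[OF H H] tensor_act_pure[OF H M H] bilinearD[OF bilinear_tensor_mult[OF H H]]
    bilinearD[OF bilinear_tensor_act[OF H M H]] twist_pure[OF e(1) b] linearD[OF twist_linear[OF e(1) b]]
    pure_tensor_closed[OF H' H'] e(2) eM m_assoc b
  show ?thesis
    using X Y
  proof (induction X rule: tensor_induct[OF H' H', consumes 1, case_names pure add])
    case (pure h h')
    note hh = this
    show ?case
      using \<open>Y \<in> _\<close>
      by (induction Y rule: tensor_induct[OF H' H', consumes 1, case_names pure add])
        (use hh in \<open>simp_all add: simps\<close>)
  qed (simp_all add: simps)
qed

lemma column_mult:
  assumes "X \<in> carrier HH" "Y \<in> carrier HH"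
  shows "column q (X \<otimes>\<^bsub>tensor_algebra H H\<^esub> Y) = X \<odot>\<^bsub>N\<^esub> column q Y"
proof -
  have "twist e b Y \<in> carrier MH" if "e \<in> linear_maps H V" "b \<in> carrier H" for e b
    using that assms by (intro linearD(1)[OF twist_linear])
  then show ?thesis
    unfolding column_def
    using assms emb_linear
    by (subst (1 2) twist_mult)
      (simp_all add: a_closed free_module2_simps bilinearD(5)[OF bilinear_tensor_act[OF H M H]])
qed

lemma coaction_closed: "m \<in> carrier M \<Longrightarrow> twisted_coaction H a m \<in> carrier MH"
  using linearD(1)[OF coaction_linear] by (simp add: underlying_space_simps[OF H M])

lemma act_coaction:
  assumes "X \<in> carrier HH" "k0 \<in> carrier H" "k1 \<in> carrier H"
  shows "X \<odot>\<^bsub>N\<^esub> twisted_coaction H a (k0, k1) =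
    column 0 (X \<otimes>\<^bsub>tensor_algebra H H\<^esub> \<Delta> k0) \<oplus>\<^bsub>MH\<^esub> column 1 (X \<otimes>\<^bsub>tensor_algebra H H\<^esub> \<Delta> k1)"
  using assms linearD(1)[OF column_comult_linear]
  by (simp add: coaction_column column_mult \<Delta>_closed bilinearD[OF bilinear_tensor_act[OF H M H]])

lemma coaction_act:
  assumes "h \<in> carrier H" "m \<in> carrier M"
  shows "twisted_coaction H a (h \<odot>\<^bsub>M\<^esub> m) = \<Delta> h \<odot>\<^bsub>N\<^esub> twisted_coaction H a m"
proof (cases m)
  case (Pair k0 k1)
  then show ?thesis
    using assms coaction_column[of "h \<otimes> k0" "h \<otimes> k1"] act_coaction[of "\<Delta> h" k0 k1]
    by (simp add: free_module2_simps \<Delta>_closed \<Delta>_mult)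
qed

subsection \<open>The comodule axioms\<close>

text \<open>The map u \<otimes> (v \<otimes> w) to e u \<otimes> (v b \<otimes> w c). Both sides of
  coassociativity are sums of such maps applied to the twofold comultiplication.\<close>

definition twist2 :: "('h \<Rightarrow> 'h \<times> 'h) \<Rightarrow> 'h \<Rightarrow> 'h \<Rightarrow> ('h, ('h, 'h) tensor) tensor \<Rightarrow> ('h \<times> 'h, ('h, 'h) tensor) tensor" where
  "twist2 e b c = tensor_map V HH e (tensor_map H H (\<lambda>v. v \<otimes> b) (\<lambda>w. w \<otimes> c))"

lemma mult_map_linear:
  "\<lbrakk>b \<in> carrier H; c \<in> carrier H\<rbrakk> \<Longrightarrow> tensor_map H H (\<lambda>v. v \<otimes> b) (\<lambda>w. w \<otimes> c) \<in> linear_maps HH HH"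
  by (intro tensor_map_linear H' mult_right_linear)

lemma twist2_linear:
  "\<lbrakk>e \<in> linear_maps H V; b \<in> carrier H; c \<in> carrier H\<rbrakk> \<Longrightarrow>
    twist2 e b c \<in> linear_maps (tensor_space H HH) (tensor_space V HH)"
  unfolding twist2_def by (intro tensor_map_linear H' V HH mult_map_linear)

lemma twist2_pure:
  "\<lbrakk>e \<in> linear_maps H V; b \<in> carrier H; c \<in> carrier H; u \<in> carrier H; X \<in> carrier HH\<rbrakk> \<Longrightarrow>
    twist2 e b c (pure_tensor H HH u X) =
    pure_tensor V HH (e u) (tensor_map H H (\<lambda>v. v \<otimes> b) (\<lambda>w. w \<otimes> c) X)"
  unfolding twist2_def by (intro tensor_map_pure H' V HH mult_map_linear)

lemma mult_pure_right:
  assumes "X \<in> carrier HH" "b \<in> carrier H" "c \<in> carrier H"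
  shows "X \<otimes>\<^bsub>tensor_algebra H H\<^esub> pure_tensor H H b c = tensor_map H H (\<lambda>v. v \<otimes> b) (\<lambda>w. w \<otimes> c) X"
  using assms(1)
  by (induction X rule: tensor_induct[OF H' H', consumes 1, case_names pure add])
    (simp_all add: tensor_mult_pure[OF H H] tensor_map_pure[OF H' H' H' H'] mult_right_linear assms
      bilinearD[OF bilinear_tensor_mult[OF H H]] pure_tensor_closed[OF H' H'] linearD[OF mult_map_linear])

lemma id_comult_linear: "tensor_map W HH (\<lambda>n. n) \<Delta> \<in> linear_maps (tensor_space W H) (tensor_space W HH)"
  if "cspace W" for W
  by (rule tensor_map_linear[OF that H' that HH linear_id comult_linear])

lemma id_comult_pure:
  "\<lbrakk>cspace W; w \<in> carrier W; h \<in> carrier H\<rbrakk> \<Longrightarrow>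
    tensor_map W HH (\<lambda>n. n) \<Delta> (pure_tensor W H w h) = pure_tensor W HH w (\<Delta> h)" for W
  by (rule tensor_map_pure[OF _ H' _ HH linear_id comult_linear])

lemma comult_id_linear: "tensor_map HH H \<Delta> (\<lambda>y. y) \<in> linear_maps HH (tensor_space HH H)"
  by (rule tensor_map_linear[OF H' H' HH H' comult_linear linear_id])

lemma comult_id_pure:
  "\<lbrakk>u \<in> carrier H; h \<in> carrier H\<rbrakk> \<Longrightarrow>
    tensor_map HH H \<Delta> (\<lambda>n. n) (pure_tensor H H u h) = pure_tensor HH H (\<Delta> u) h"
  by (rule tensor_map_pure[OF H' H' HH H' comult_linear linear_id])

lemma coaction_id_linear:
  "tensor_map MH H (twisted_coaction H a) (\<lambda>y. y) \<in> linear_maps MH (tensor_space MH H)"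
  by (rule tensor_map_linear[OF V H' MH H' coaction_linear linear_id])

lemma coaction_id_pure:
  "\<lbrakk>m \<in> carrier V; h \<in> carrier H\<rbrakk> \<Longrightarrow>
    tensor_map MH H (twisted_coaction H a) (\<lambda>n. n) (pure_tensor V H m h) =
    pure_tensor MH H (twisted_coaction H a m) h"
  by (rule tensor_map_pure[OF V H' MH H' coaction_linear linear_id])

text \<open>\<Delta>(v a_pq) = \<Delta>(v) \<Delta>(a_pq), and \<Delta>(a_pq) is the sum over l of
  a_pl \<otimes> a_lq. So one twist splits into two twofold twists, one for each intermediate index
  l.\<close>

lemma id_comult_twist:
  assumes e: "e \<in> linear_maps H V" and Z: "Z \<in> carrier HH"
  shows "tensor_map V HH (\<lambda>n. n) \<Delta> (twist e (a p q) Z) =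
    twist2 e (a p 0) (a 0 q) (tensor_map H HH (\<lambda>n. n) \<Delta> Z) \<oplus>\<^bsub>tensor_space V HH\<^esub>
    twist2 e (a p 1) (a 1 q) (tensor_map H HH (\<lambda>n. n) \<Delta> Z)"
proof (rule linear_tensor_eqI[OF H' H' _ _ _ Z])
  show "(\<lambda>Z. tensor_map V HH (\<lambda>n. n) \<Delta> (twist e (a p q) Z)) \<in> linear_maps HH (tensor_space V HH)"
    by (rule linear_comp[OF twist_linear[OF e a_closed] id_comult_linear[OF V]])
  show "(\<lambda>Z. twist2 e (a p 0) (a 0 q) (tensor_map H HH (\<lambda>n. n) \<Delta> Z) \<oplus>\<^bsub>tensor_space V HH\<^esub>
    twist2 e (a p 1) (a 1 q) (tensor_map H HH (\<lambda>n. n) \<Delta> Z)) \<in> linear_maps HH (tensor_space V HH)"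
    by (intro linear_add MHH linear_comp[OF id_comult_linear[OF H'] twist2_linear] e a_closed)
  fix u v assume uv: "u \<in> carrier H" "v \<in> carrier H"
  have "\<Delta> (v \<otimes> a p q) = tensor_map H H (\<lambda>v. v \<otimes> a p 0) (\<lambda>w. w \<otimes> a 0 q) (\<Delta> v) \<oplus>\<^bsub>HH\<^esub>
      tensor_map H H (\<lambda>v. v \<otimes> a p 1) (\<lambda>w. w \<otimes> a 1 q) (\<Delta> v)"
    using uv by (simp add: \<Delta>_mult a_closed comult_a bilinearD[OF bilinear_tensor_mult[OF H H]]
      pure_tensor_closed[OF H' H'] \<Delta>_closed mult_pure_right)
  then show "tensor_map V HH (\<lambda>n. n) \<Delta> (twist e (a p q) (pure_tensor H H u v)) =
    twist2 e (a p 0) (a 0 q) (tensor_map H HH (\<lambda>n. n) \<Delta> (pure_tensor H H u v)) \<oplus>\<^bsub>tensor_space V HH\<^esub>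
    twist2 e (a p 1) (a 1 q) (tensor_map H HH (\<lambda>n. n) \<Delta> (pure_tensor H H u v))"
    using uv
    by (simp add: twist_pure e a_closed id_comult_pure V H' linearD[OF e] twist2_pure \<Delta>_closed
      pure_tensor_add_right[OF V HH] linearD[OF mult_map_linear])
qed

lemma assoc_twist:
  assumes e: "e \<in> linear_maps H V" and bc: "b \<in> carrier H" "c \<in> carrier H" and w: "w \<in> carrier H"
    and X: "X \<in> carrier HH"
  shows "tensor_assoc V H H (pure_tensor MH H (twist e b X) (w \<otimes> c)) =
    twist2 e b c (tensor_assoc H H H (pure_tensor HH H X w))"
proof (rule linear_tensor_eqI[OF H' H' _ _ _ X])
  show "(\<lambda>X. tensor_assoc V H H (pure_tensor MH H (twist e b X) (w \<otimes> c))) \<in> linear_maps HH (tensor_space V HH)"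
    using bc w
    by (intro linear_comp[OF _ tensor_assoc_linear[OF V H' H']]
        linear_comp[OF twist_linear bilinearD(1)[OF bilinear_pure_tensor[OF MH H']]] e) auto
  show "(\<lambda>X. twist2 e b c (tensor_assoc H H H (pure_tensor HH H X w))) \<in> linear_maps HH (tensor_space V HH)"
    using bc w
    by (intro linear_comp[OF _ twist2_linear] linear_comp[OF _ tensor_assoc_linear[OF H' H' H']]
        bilinearD(1)[OF bilinear_pure_tensor[OF HH H']] e) auto
  fix u v assume "u \<in> carrier H" "v \<in> carrier H"
  then show "tensor_assoc V H H (pure_tensor MH H (twist e b (pure_tensor H H u v)) (w \<otimes> c)) =
    twist2 e b c (tensor_assoc H H H (pure_tensor HH H (pure_tensor H H u v) w))"
    using bc w
    by (simp add: twist_pure e tensor_assoc_pure[OF V H' H'] tensor_assoc_pure[OF H' H' H'] linearD[OF e]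
      twist2_pure pure_tensor_closed[OF H' H'] tensor_map_pure[OF H' H' H' H'] mult_right_linear)
qed

lemma assoc_column:
  assumes c: "c \<in> carrier H" and w: "w \<in> carrier H" and X: "X \<in> carrier HH"
  shows "tensor_assoc V H H (pure_tensor MH H (column l X) (w \<otimes> c)) =
    twist2 fst_emb (a 0 l) c (tensor_assoc H H H (pure_tensor HH H X w)) \<oplus>\<^bsub>tensor_space V HH\<^esub>
    twist2 snd_emb (a 1 l) c (tensor_assoc H H H (pure_tensor HH H X w))"
proof -
  have "twist e (a i j) X \<in> carrier MH" if "e \<in> linear_maps H V" for e i j
    using that X by (intro linearD(1)[OF twist_linear] a_closed)
  then show ?thesis
    using assms emb_linear
    by (simp add: column_def pure_tensor_add_left[OF MH H'] pure_tensor_closed[OF MH H']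
      linearD(2)[OF tensor_assoc_linear[OF V H' H']] assoc_twist a_closed)
qed

text \<open>The embedding \<open>e\<close> carries the intermediate index \<open>l\<close>: coacting
  on an element of the \<open>l\<close>-th summand of \<open>M\<close> yields column
  \<open>l\<close>, whose matrix entries are a_0l and a_1l.\<close>

lemma coaction_id_twist:
  assumes e: "e = fst_emb \<and> l = 0 \<or> e = snd_emb \<and> l = 1" and c: "c \<in> carrier H" and Z: "Z \<in> carrier HH"
  shows "tensor_assoc V H H (tensor_map MH H (twisted_coaction H a) (\<lambda>h. h) (twist e c Z)) =
    twist2 fst_emb (a 0 l) c (tensor_assoc H H H (tensor_map HH H \<Delta> (\<lambda>y. y) Z)) \<oplus>\<^bsub>tensor_space V HH\<^esub>
    twist2 snd_emb (a 1 l) c (tensor_assoc H H H (tensor_map HH H \<Delta> (\<lambda>y. y) Z))"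
proof (rule linear_tensor_eqI[OF H' H' _ _ _ Z])
  have e': "e \<in> linear_maps H V" using e emb_linear by auto
  show "(\<lambda>Z. tensor_assoc V H H (tensor_map MH H (twisted_coaction H a) (\<lambda>h. h) (twist e c Z)))
    \<in> linear_maps HH (tensor_space V HH)"
    by (intro linear_comp[OF _ tensor_assoc_linear[OF V H' H']] linear_comp[OF twist_linear[OF e' c] coaction_id_linear])
  show "(\<lambda>Z. twist2 fst_emb (a 0 l) c (tensor_assoc H H H (tensor_map HH H \<Delta> (\<lambda>y. y) Z)) \<oplus>\<^bsub>tensor_space V HH\<^esub>
    twist2 snd_emb (a 1 l) c (tensor_assoc H H H (tensor_map HH H \<Delta> (\<lambda>y. y) Z))) \<in> linear_maps HH (tensor_space V HH)"
    by (intro linear_add MHH linear_comp[OF _ twist2_linear] linear_comp[OF comult_id_linear tensor_assoc_linear[OF H' H' H']]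
      emb_linear a_closed c)
  fix u v assume uv: "u \<in> carrier H" "v \<in> carrier H"
  have "twisted_coaction H a (e u) = column l (\<Delta> u)"
    using e coaction_emb[OF uv(1)] by auto
  then show "tensor_assoc V H H (tensor_map MH H (twisted_coaction H a) (\<lambda>h. h) (twist e c (pure_tensor H H u v))) =
    twist2 fst_emb (a 0 l) c (tensor_assoc H H H (tensor_map HH H \<Delta> (\<lambda>y. y) (pure_tensor H H u v))) \<oplus>\<^bsub>tensor_space V HH\<^esub>
    twist2 snd_emb (a 1 l) c (tensor_assoc H H H (tensor_map HH H \<Delta> (\<lambda>y. y) (pure_tensor H H u v)))"
    using uv c linearD(1)[OF e' uv(1)]
    by (simp add: twist_pure e' coaction_id_pure assoc_column \<Delta>_closed comult_id_pure)
qed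

text \<open>On column q both sides are the double sum, over the row p and the intermediate index l,
  of twists by a_pl and a_lq. One side sums over l first and the other over p first.\<close>

lemma coaction_coassoc:
  assumes m: "m \<in> carrier V"
  shows "tensor_map V HH (\<lambda>n. n) \<Delta> (twisted_coaction H a m) =
    tensor_assoc V H H (tensor_map MH H (twisted_coaction H a) (\<lambda>h. h) (twisted_coaction H a m))"
proof -
  let ?L = "tensor_map V HH (\<lambda>n. n) \<Delta>"
  let ?R = "\<lambda>X. tensor_assoc V H H (tensor_map MH H (twisted_coaction H a) (\<lambda>h. h) X)"
  have R: "?R \<in> linear_maps MH (tensor_space V HH)"
    by (rule linear_comp[OF coaction_id_linear tensor_assoc_linear[OF V H' H']])
  have L: "?L \<in> linear_maps MH (tensor_space V HH)"
    by (rule id_comult_linear[OF V])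
  have "?L (column q (\<Delta> k)) = ?R (column q (\<Delta> k))" if k: "k \<in> carrier H" for q k
  proof -
    \<comment> \<open>Coassociativity of \<open>H\<close> gives two expressions for the twofold
      comultiplication \<open>K\<close> of \<open>k\<close>, one for each side of the claim.\<close>
    define K where "K = tensor_map H HH (\<lambda>n. n) \<Delta> (\<Delta> k)"
    have K': "K = tensor_assoc H H H (tensor_map HH H \<Delta> (\<lambda>y. y) (\<Delta> k))"
      using coassoc[OF k] by (simp add: K_def)
    have K: "K \<in> carrier (tensor_space H HH)"
      unfolding K_def by (intro linearD(1)[OF id_comult_linear[OF H']] \<Delta>_closed k)
    have tw: "twist e (a i j) (\<Delta> k) \<in> carrier MH" if "e \<in> linear_maps H V" for e i j
      using that by (intro linearD(1)[OF twist_linear] a_closed \<Delta>_closed k)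
    have cl: "twist2 e (a p l) (a l q) K \<in> carrier (tensor_space V HH)" if "e \<in> linear_maps H V" for e p l
      using that by (intro linearD(1)[OF twist2_linear] a_closed K)
    have "?L (column q (\<Delta> k)) =
      (twist2 fst_emb (a 0 0) (a 0 q) K \<oplus>\<^bsub>tensor_space V HH\<^esub> twist2 fst_emb (a 0 1) (a 1 q) K) \<oplus>\<^bsub>tensor_space V HH\<^esub>
      (twist2 snd_emb (a 1 0) (a 0 q) K \<oplus>\<^bsub>tensor_space V HH\<^esub> twist2 snd_emb (a 1 1) (a 1 q) K)"
      by (simp only: column_def linearD(2)[OF L] tw emb_linear id_comult_twist \<Delta>_closed[OF k] K_def)
    moreover have "?R (column q (\<Delta> k)) =
      (twist2 fst_emb (a 0 0) (a 0 q) K \<oplus>\<^bsub>tensor_space V HH\<^esub> twist2 snd_emb (a 1 0) (a 0 q) K) \<oplus>\<^bsub>tensor_space V HH\<^esub>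
      (twist2 fst_emb (a 0 1) (a 1 q) K \<oplus>\<^bsub>tensor_space V HH\<^esub> twist2 snd_emb (a 1 1) (a 1 q) K)"
      using coaction_id_twist[of fst_emb 0 "a 0 q" "\<Delta> k"] coaction_id_twist[of snd_emb 1 "a 1 q" "\<Delta> k"]
      by (simp add: column_def linearD(2)[OF R] tw emb_linear a_closed \<Delta>_closed k flip: K')
    ultimately show ?thesis
      by (simp add: abelian_group_interchange[OF cspaceD(1)[OF MHH]] cl emb_linear)
  qed
  then show ?thesis
    using m linearD(1)[OF column_comult_linear]
    by (cases m) (simp add: V_simps coaction_column linearD(2)[OF L] linearD(2)[OF R])
qed

lemma counit_act_bilinear: "bilinear V H V (\<lambda>n h. \<epsilon> h \<odot>\<^bsub>V\<^esub> n)"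
  by (intro bilinearI left_module_homI)
    (simp_all add: cspaceD[OF V] \<epsilon>_linear mult.commute[of "\<epsilon> _"] flip: cspaceD(5)[OF V])

lemma counit_twist:
  assumes e: "e \<in> linear_maps H V" and b: "b \<in> carrier H" and Z: "Z \<in> carrier HH"
  shows "tensor_lift V (\<lambda>n h. \<epsilon> h \<odot>\<^bsub>V\<^esub> n) (twist e b Z) =
    \<epsilon> b \<odot>\<^bsub>V\<^esub> e (tensor_lift H (\<lambda>y z. \<epsilon> z \<odot> y) Z)"
proof (rule linear_tensor_eqI[OF H' H' _ _ _ Z])
  note l = tensor_lift_linear[OF V H' V counit_act_bilinear]
  have bi: "bilinear H H H (\<lambda>y z. \<epsilon> z \<odot> y)"
    by (intro bilinearI left_module_homI)
      (simp_all add: cspaceD[OF H'] \<epsilon>_linear mult.commute[of "\<epsilon> _"] flip: cspaceD(5)[OF H'])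
  show "(\<lambda>Z. tensor_lift V (\<lambda>n h. \<epsilon> h \<odot>\<^bsub>V\<^esub> n) (twist e b Z)) \<in> linear_maps HH V"
    by (rule linear_comp[OF twist_linear[OF e b] l])
  have "(\<lambda>x. \<epsilon> b \<odot>\<^bsub>V\<^esub> x) \<in> linear_maps V V"
    by (rule left_module_homI) (simp_all add: cspaceD[OF V] mult.commute[of "\<epsilon> _"] flip: cspaceD(5)[OF V])
  then show "(\<lambda>Z. \<epsilon> b \<odot>\<^bsub>V\<^esub> e (tensor_lift H (\<lambda>y z. \<epsilon> z \<odot> y) Z)) \<in> linear_maps HH V"
    by (rule linear_comp[OF linear_comp[OF tensor_lift_linear[OF H' H' H' bi] e]])
  fix u v assume "u \<in> carrier H" "v \<in> carrier H"
  then show "tensor_lift V (\<lambda>n h. \<epsilon> h \<odot>\<^bsub>V\<^esub> n) (twist e b (pure_tensor H H u v)) =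
    \<epsilon> b \<odot>\<^bsub>V\<^esub> e (tensor_lift H (\<lambda>y z. \<epsilon> z \<odot> y) (pure_tensor H H u v))"
    using b by (simp add: twist_pure e tensor_lift_pure[OF V H' V counit_act_bilinear] linearD[OF e]
      tensor_lift_pure[OF H' H' H' bi] \<epsilon>_mult mult.commute flip: cspaceD(5)[OF V])
qed

text \<open>The counit is multiplicative and turns the matrix \<open>a\<close> into the identity
  matrix. Of column q only the q-th entry survives, and there the counit axiom of \<open>H\<close>
  gives back \<open>k\<close>.\<close>

lemma coaction_counit:
  assumes m: "m \<in> carrier V"
  shows "tensor_lift V (\<lambda>n h. \<epsilon> h \<odot>\<^bsub>V\<^esub> n) (twisted_coaction H a m) = m"
proof -
  note l = tensor_lift_linear[OF V H' V counit_act_bilinear]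
  have "tensor_lift V (\<lambda>n h. \<epsilon> h \<odot>\<^bsub>V\<^esub> n) (column q (\<Delta> k)) = (if q = 0 then fst_emb k else snd_emb k)"
    if k: "k \<in> carrier H" for q k
  proof -
    have "twist e (a i j) (\<Delta> k) \<in> carrier MH" if "e \<in> linear_maps H V" for e i j
      using that by (intro linearD(1)[OF twist_linear] a_closed \<Delta>_closed k)
    then show ?thesis
      using k emb_linear two_cases[of q]
      by (auto simp add: column_def linearD(2)[OF l] counit_twist a_closed \<Delta>_closed counit_right
        counit_a V_simps smult_zero[OF H'] cspaceD(6)[OF H'])
  qed
  then show ?thesis
    using m linearD(1)[OF column_comult_linear] abelian_groupD(3,4)[OF cspaceD(1)[OF H']]
    by (cases m) (simp add: V_simps(1,2) coaction_column linearD(2)[OF l])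
qed

lemma right_comodule_twisted: "right_comodule H V (twisted_coaction H a)"
  unfolding right_comodule_def
  using V coaction_linear coaction_coassoc coaction_counit by blast

lemma right_algebra_coaction_comult: "right_algebra_coaction H H \<Delta>"
  unfolding right_algebra_coaction_def right_comodule_def
  using H H' comult_linear coassoc counit_right comult_ring_hom by blast

lemma relative_hopf_module_twisted: "relative_hopf_module H H \<Delta> M (twisted_coaction H a)"
  unfolding relative_hopf_module_def
  using hopf_algebra_axioms right_algebra_coaction_comult M right_comodule_twisted coaction_act by blast

subsection \<open>The induced map\<close>

abbreviation "RHH \<equiv> regular_module (tensor_algebra H H)"
abbreviation "ract \<equiv> coaction_ract H H \<Delta>"

lemma HH_algebra: "complex_algebra (tensor_algebra H H)"
  by (rule complex_algebra_tensor[OF H H])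

lemma N_abelian: "abelian_group N"
  by (rule abelian_group_cong[OF cspaceD(1)[OF MH]]) (simp_all add: tensor_left_module_simps[OF H M H])

lemma M_abelian: "abelian_group M"
  using M by (simp add: left_module_def)

lemma RHH_abelian: "abelian_group RHH"
  by (rule abelian_group_cong[OF cspaceD(1)[OF complex_algebraD(1)[OF HH_algebra]]])
    (simp_all add: regular_module_def)

lemma source_factors: "tensor_factors H RHH ract M"
proof (rule tensor_factors.intro[OF RHH_abelian M_abelian])
  interpret M: left_module H M by (rule M)
  show "ract X h \<in> carrier RHH" if "X \<in> carrier RHH" "h \<in> carrier H" for X h
    using that \<Delta>_closed complex_algebraD(4)[OF HH_algebra]
    by (simp add: coaction_ract_def tensor_algebra_simps[OF H H])
  show "h \<odot>\<^bsub>M\<^esub> m \<in> carrier M" if "h \<in> carrier H" "m \<in> carrier M" for h m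
    using that by (rule M.act_closed)
qed

interpretation S: tensor_factors H RHH ract M
  by (rule source_factors)

abbreviation "source \<equiv> induced_module H H \<Delta> M"
abbreviation "\<rho> \<equiv> induced_map H H M (twisted_coaction H a)"

lemma source_simps:
  "carrier source = carrier (tensor_group H RHH ract M)"
  "x \<oplus>\<^bsub>source\<^esub> y = x \<oplus>\<^bsub>tensor_group H RHH ract M\<^esub> y"
  by (simp_all add: induced_module_def tensor_over_simps)

lemma coaction_add:
  "\<lbrakk>m \<in> carrier M; m' \<in> carrier M\<rbrakk> \<Longrightarrow> twisted_coaction H a (m \<oplus>\<^bsub>M\<^esub> m') =
     twisted_coaction H a m \<oplus>\<^bsub>MH\<^esub> twisted_coaction H a m'"
  using linearD(2)[OF coaction_linear] by (simp add: underlying_space_simps[OF H M])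

text \<open>(x \<Delta>(h)) \<delta>(m) = x (\<Delta>(h) \<delta>(m)) = x \<delta>(h m), where the
  last equality says that the coaction is over \<Delta>.\<close>

lemma induced_balanced:
  "balanced H RHH ract M N (\<lambda>x m. x \<odot>\<^bsub>N\<^esub> twisted_coaction H a m)"
  unfolding balanced_def
  using coaction_closed bilinearD[OF bilinear_tensor_act[OF H M H]] tensor_act_assoc[OF H M H]
  by (simp add: tensor_algebra_simps[OF H H] tensor_left_module_simps[OF H M H] coaction_add
    coaction_ract_def coaction_act \<Delta>_closed)

lemma induced_map_pure:
  "\<lbrakk>x \<in> carrier HH; m \<in> carrier M\<rbrakk> \<Longrightarrow>
    \<rho> (induced_pure H H \<Delta> M x m) = x \<odot>\<^bsub>N\<^esub> twisted_coaction H a m"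
  unfolding induced_map_def induced_pure_def
  by (rule S.lift_pure[OF N_abelian induced_balanced]) (simp_all add: tensor_algebra_simps[OF H H])

lemma induced_map_closed: "X \<in> carrier source \<Longrightarrow> \<rho> X \<in> carrier N"
  unfolding induced_map_def source_simps by (rule S.lift_closed[OF N_abelian induced_balanced])

lemma induced_map_add:
  "\<lbrakk>X \<in> carrier source; Y \<in> carrier source\<rbrakk> \<Longrightarrow> \<rho> (X \<oplus>\<^bsub>source\<^esub> Y) = \<rho> X \<oplus>\<^bsub>N\<^esub> \<rho> Y"
  unfolding induced_map_def source_simps by (rule S.lift_add[OF N_abelian induced_balanced])

lemma source_induct [consumes 1, case_names pure add]:
  assumes "X \<in> carrier source"
    and "\<And>x m. \<lbrakk>x \<in> carrier HH; m \<in> carrier M\<rbrakk> \<Longrightarrow> P (induced_pure H H \<Delta> M x m)"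
    and "\<And>X Y. \<lbrakk>X \<in> carrier source; Y \<in> carrier source; P X; P Y\<rbrakk> \<Longrightarrow> P (X \<oplus>\<^bsub>source\<^esub> Y)"
  shows "P X"
  using assms(1) unfolding source_simps
  by (rule S.tensor_group_induct)
    (use assms(2,3) in \<open>auto simp: source_simps induced_pure_def tensor_algebra_simps[OF H H]\<close>)

text \<open>Left multiplication by \<open>s\<close> commutes with right multiplication by values of
  \<Delta>, so H \<otimes> H with these two actions is a bimodule.\<close>

lemma source_act_balanced:
  assumes s: "s \<in> carrier HH"
  shows "balanced H RHH ract M (tensor_group H RHH ract M)
    (\<lambda>x m. pure_tensor_over H RHH ract M (s \<odot>\<^bsub>RHH\<^esub> x) m)"
proof (rule S.smult_balanced)
  note m = bilinearD[OF bilinear_mult[OF HH_algebra]]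
  show "s \<odot>\<^bsub>RHH\<^esub> x \<in> carrier RHH" if "x \<in> carrier RHH" for x
    using m(3) s that by (simp add: tensor_algebra_simps[OF H H])
  show "s \<odot>\<^bsub>RHH\<^esub> (x \<oplus>\<^bsub>RHH\<^esub> x') = s \<odot>\<^bsub>RHH\<^esub> x \<oplus>\<^bsub>RHH\<^esub> s \<odot>\<^bsub>RHH\<^esub> x'"
    if "x \<in> carrier RHH" "x' \<in> carrier RHH" for x x'
    using m(5) s that by (simp add: tensor_algebra_simps[OF H H])
  show "s \<odot>\<^bsub>RHH\<^esub> ract x h = ract (s \<odot>\<^bsub>RHH\<^esub> x) h" if "x \<in> carrier RHH" "h \<in> carrier H" for x h
    using complex_algebraD(8)[OF HH_algebra] s that \<Delta>_closed
    by (simp add: coaction_ract_def tensor_algebra_simps[OF H H])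
qed

lemma source_act_pure:
  assumes "s \<in> carrier HH" "x \<in> carrier HH" "m \<in> carrier M"
  shows "s \<odot>\<^bsub>source\<^esub> induced_pure H H \<Delta> M x m = induced_pure H H \<Delta> M (s \<otimes>\<^bsub>tensor_algebra H H\<^esub> x) m"
  unfolding induced_module_def induced_pure_def S.smult_tensor_over
  using S.lift_pure[OF S.abelian_group_T source_act_balanced[OF assms(1)], of x m] assms
  by (simp add: tensor_algebra_simps[OF H H])

lemma source_act_closed:
  assumes "s \<in> carrier HH" "X \<in> carrier source"
  shows "s \<odot>\<^bsub>source\<^esub> X \<in> carrier source"
  using S.lift_closed[OF S.abelian_group_T source_act_balanced[OF assms(1)]] assms(2)
  unfolding source_simps by (simp add: induced_module_def S.smult_tensor_over)

lemma source_act_add: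
  assumes "s \<in> carrier HH" "X \<in> carrier source" "Y \<in> carrier source"
  shows "s \<odot>\<^bsub>source\<^esub> (X \<oplus>\<^bsub>source\<^esub> Y) = s \<odot>\<^bsub>source\<^esub> X \<oplus>\<^bsub>source\<^esub> s \<odot>\<^bsub>source\<^esub> Y"
  using S.lift_add[OF S.abelian_group_T source_act_balanced[OF assms(1)]] assms(2,3)
  unfolding source_simps by (simp add: induced_module_def S.smult_tensor_over)

lemma induced_map_hom: "\<rho> \<in> left_module_hom (tensor_algebra H H) source N"
proof (rule left_module_homI)
  note m = bilinearD[OF bilinear_tensor_mult[OF H H]]
    and n = bilinearD[OF bilinear_tensor_act[OF H M H]]
  show "\<rho> (s \<odot>\<^bsub>source\<^esub> X) = s \<odot>\<^bsub>N\<^esub> \<rho> X" if s: "s \<in> carrier (tensor_algebra H H)" and X: "X \<in> carrier source" for s X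
    using X
  proof (induction X rule: source_induct)
    case (pure x m)
    then show ?case
      using s by (simp add: tensor_algebra_simps[OF H H] source_act_pure induced_map_pure m coaction_closed
        tensor_act_assoc[OF H M H])
  next
    case (add X Y)
    then show ?case
      using s induced_map_closed
      by (simp add: tensor_algebra_simps[OF H H] source_act_add source_act_closed induced_map_add n
        tensor_left_module_simps[OF H M H])
  qed
qed (rule induced_map_closed induced_map_add; assumption)+

text \<open>In matrix terms the induced map multiplies rows over \<open>H \<otimes> H\<close> by the transpose of \<open>1 \<otimes> a\<close>.
  A vector annihilated by the transpose of \<open>a\<close> in some representation gives a nonzero map that
  vanishes on its image.\<close>

lemma induced_map_not_surj:
  assumes W: "left_module H W" and w: "w0 \<in> carrier W" "w1 \<in> carrier W" "w1 \<noteq> \<zero>\<^bsub>W\<^esub>"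
    and ann: "\<And>q. a 0 q \<odot>\<^bsub>W\<^esub> w0 \<oplus>\<^bsub>W\<^esub> a 1 q \<odot>\<^bsub>W\<^esub> w1 = \<zero>\<^bsub>W\<^esub>"
  shows "\<rho> ` carrier source \<noteq> carrier N"
proof
  assume surj: "\<rho> ` carrier source = carrier N"
  interpret W: left_module H W by (rule W)
  define U where "U = underlying_space H W"
  have U: "cspace U" unfolding U_def by (rule cspace_underlying[OF H W])
  have U_simps: "carrier U = carrier W" "x \<oplus>\<^bsub>U\<^esub> y = x \<oplus>\<^bsub>W\<^esub> y" "\<zero>\<^bsub>U\<^esub> = \<zero>\<^bsub>W\<^esub>" for x y
    unfolding U_def by (simp_all add: underlying_space_simps[OF H W])
  note U_closed = cspaceD(2)[OF U, unfolded U_simps(1)] abelian_groupD(1)[OF cspaceD(1)[OF U], unfolded U_simps(1)]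
  have act: "bilinear H U U (\<odot>\<^bsub>W\<^esub>)" unfolding U_def by (rule bilinear_act[OF H W])
  \<comment> \<open>Applying the counit to the coordinates of \<open>M\<close> discards the first
    tensor factor. On column q of u \<otimes> v the map \<theta> below then yields \<epsilon>(u) v
    applied to the combination a_0q w0 + a_1q w1, which is zero.\<close>
  define \<beta> where "\<beta> m = \<epsilon> (fst m) \<odot>\<^bsub>U\<^esub> w0 \<oplus>\<^bsub>U\<^esub> \<epsilon> (snd m) \<odot>\<^bsub>U\<^esub> w1" for m
  have lin: "(\<lambda>h. \<epsilon> h \<odot>\<^bsub>U\<^esub> u) \<in> linear_maps H U" if "u \<in> carrier W" for u
    by (rule left_module_homI) (use that in \<open>simp_all add: \<epsilon>_linear cspaceD[OF U] U_simps(1) U_closed\<close>)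
  have "fst \<in> linear_maps V H" "snd \<in> linear_maps V H"
    by (rule left_module_homI; force simp: V_simps)+
  then have \<beta>: "\<beta> \<in> linear_maps V U"
    unfolding \<beta>_def by (intro linear_add U linear_comp[OF _ lin] w)
  define \<theta> where "\<theta> = tensor_lift U (\<lambda>m h. h \<odot>\<^bsub>W\<^esub> \<beta> m)"
  have bi: "bilinear V H U (\<lambda>m h. h \<odot>\<^bsub>W\<^esub> \<beta> m)"
  proof (rule bilinearI)
    show "(\<lambda>m. h \<odot>\<^bsub>W\<^esub> \<beta> m) \<in> linear_maps V U" if "h \<in> carrier H" for h
      by (rule linear_comp[OF \<beta> bilinearD(2)[OF act that]])
    show "(\<lambda>h. h \<odot>\<^bsub>W\<^esub> \<beta> m) \<in> linear_maps H U" if "m \<in> carrier V" for m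
      by (rule bilinearD(1)[OF act linearD(1)[OF \<beta> that]])
  qed
  have \<theta>: "\<theta> \<in> linear_maps MH U"
    unfolding \<theta>_def by (rule tensor_lift_linear[OF V H' U bi])
  have \<theta>_pure: "\<theta> (pure_tensor V H m h) = h \<odot>\<^bsub>W\<^esub> \<beta> m" if "m \<in> carrier V" "h \<in> carrier H" for m h
    unfolding \<theta>_def using that by (rule tensor_lift_pure[OF V H' U bi])
  have \<beta>_emb: "\<beta> (fst_emb u) = \<epsilon> u \<odot>\<^bsub>U\<^esub> w0" "\<beta> (snd_emb u) = \<epsilon> u \<odot>\<^bsub>U\<^esub> w1" for u
    using w by (simp_all add: \<beta>_def \<epsilon>_zero smult_zero[OF U] U_simps(1) U_closed
      abelian_groupD[OF cspaceD(1)[OF U]])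
  have zero_column: "\<theta> (column q Z) = \<zero>\<^bsub>W\<^esub>" if "Z \<in> carrier HH" for q Z
    using that
  proof (induction Z rule: tensor_induct[OF H' H', consumes 1, case_names pure add])
    case (pure u v)
    have "\<theta> (column q (pure_tensor H H u v)) =
      (v \<otimes> a 0 q) \<odot>\<^bsub>W\<^esub> (\<epsilon> u \<odot>\<^bsub>U\<^esub> w0) \<oplus>\<^bsub>U\<^esub> (v \<otimes> a 1 q) \<odot>\<^bsub>W\<^esub> (\<epsilon> u \<odot>\<^bsub>U\<^esub> w1)"
      using pure by (simp add: column_def twist_pure emb_linear a_closed linearD(2)[OF \<theta>] pure_tensor_closed V H'
        V_simps \<theta>_pure \<beta>_emb)
    also have "\<dots> = \<epsilon> u \<odot>\<^bsub>U\<^esub> (v \<odot>\<^bsub>W\<^esub> (a 0 q \<odot>\<^bsub>W\<^esub> w0 \<oplus>\<^bsub>W\<^esub> a 1 q \<odot>\<^bsub>W\<^esub> w1))"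
      using pure w by (simp add: bilinearD(5,7)[OF act] U_simps(1) a_closed W.act_assoc W.act_closed
        cspaceD(4)[OF U] flip: U_simps(2))
    also have "\<dots> = \<zero>\<^bsub>W\<^esub>"
    proof -
      have "v \<odot>\<^bsub>W\<^esub> \<zero>\<^bsub>U\<^esub> = \<zero>\<^bsub>U\<^esub>"
        by (rule linear_zero[OF bilinearD(2)[OF act pure(2)] U U])
      then show ?thesis by (simp add: ann U_simps(3) smult_zero[OF U, of "\<zero>\<^bsub>U\<^esub>", unfolded U_simps] )
    qed
    finally show ?case .
  next
    case (add X Y)
    then show ?case
      using linearD(1)[OF column_linear]
      by (simp add: linearD(2)[OF column_linear] linearD(2)[OF \<theta>] U_simps)
  qed
  have zero: "\<theta> (\<rho> X) = \<zero>\<^bsub>W\<^esub>" if "X \<in> carrier source" for X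
    using that
  proof (induction X rule: source_induct)
    case (pure x m)
    obtain k0 k1 where m: "m = (k0, k1)" by (cases m)
    have "x \<otimes>\<^bsub>tensor_algebra H H\<^esub> \<Delta> k \<in> carrier HH" if "k \<in> carrier H" for k
      using pure that by (simp add: bilinearD(3)[OF bilinear_tensor_mult[OF H H]] \<Delta>_closed)
    then show ?case
      using pure linearD(1)[OF column_linear]
      by (simp add: m free_module2_simps induced_map_pure act_coaction linearD(2)[OF \<theta>] zero_column U_simps)
  next
    case (add X Y)
    then show ?case
      using induced_map_closed
      by (simp add: induced_map_add tensor_left_module_simps[OF H M H] linearD(2)[OF \<theta>] U_simps)
  qed
  \<comment> \<open>The element (0, 1) \<otimes> 1 lies outside the image: \<theta> vanishes on the
    image and has the value \<open>w1\<close> here.\<close>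
  have "pure_tensor V H (snd_emb \<one>) \<one> \<in> carrier N"
    by (simp add: tensor_left_module_simps[OF H M H] pure_tensor_closed V H' V_simps)
  then obtain X where "X \<in> carrier source" "pure_tensor V H (snd_emb \<one>) \<one> = \<rho> X"
    unfolding surj[symmetric] by (rule imageE)
  then have "\<theta> (pure_tensor V H (snd_emb \<one>) \<one>) = \<zero>\<^bsub>W\<^esub>"
    using zero by simp
  moreover have "\<theta> (pure_tensor V H (snd_emb \<one>) \<one>) = w1"
    using w by (simp add: \<theta>_pure V_simps \<beta>_emb \<epsilon>_one cspaceD(6)[OF U] U_simps(1) W.act_one)
  ultimately show False using w by simp
qed

end

section \<open>Algebras presented by generators and relations\<close>

datatype 'g alg_term =
  Gen 'g | Const complex | Plus "'g alg_term" "'g alg_term" | Times "'g alg_term" "'g alg_term"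

text \<open>The congruence generated by \<open>E\<close> and the laws of associative unital complex
  algebras; its classes form the quotient of the free algebra by the ideal of \<open>E\<close>.
  Scalars are central constants, which also supplies the right unit law, and the constant -1
  supplies negatives.\<close>

inductive presented_eq :: "('g alg_term \<times> 'g alg_term) set \<Rightarrow> 'g alg_term \<Rightarrow> 'g alg_term \<Rightarrow> bool"
  for E where
  relation: "(s, t) \<in> E \<Longrightarrow> presented_eq E s t"
| refl: "presented_eq E s s"
| sym: "presented_eq E s t \<Longrightarrow> presented_eq E t s"
| trans: "presented_eq E s t \<Longrightarrow> presented_eq E t u \<Longrightarrow> presented_eq E s u"
| plus_cong: "presented_eq E s s' \<Longrightarrow> presented_eq E t t' \<Longrightarrow> presented_eq E (Plus s t) (Plus s' t')"
| times_cong: "presented_eq E s s' \<Longrightarrow> presented_eq E t t' \<Longrightarrow> presented_eq E (Times s t) (Times s' t')"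
| plus_assoc: "presented_eq E (Plus (Plus s t) u) (Plus s (Plus t u))"
| plus_comm: "presented_eq E (Plus s t) (Plus t s)"
| zero_plus: "presented_eq E (Plus (Const 0) s) s"
| times_assoc: "presented_eq E (Times (Times s t) u) (Times s (Times t u))"
| one_times: "presented_eq E (Times (Const 1) s) s"
| zero_times: "presented_eq E (Times (Const 0) s) (Const 0)"
| distrib_left: "presented_eq E (Times s (Plus t u)) (Plus (Times s t) (Times s u))"
| distrib_right: "presented_eq E (Times (Plus s t) u) (Plus (Times s u) (Times t u))"
| const_plus: "presented_eq E (Const (c + d)) (Plus (Const c) (Const d))"
| const_times: "presented_eq E (Const (c * d)) (Times (Const c) (Const d))"
| const_central: "presented_eq E (Times (Const c) s) (Times s (Const c))"

lemmas presented_eq_laws = presented_eq.refl presented_eq.plus_assoc presented_eq.plus_comm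
  presented_eq.zero_plus presented_eq.times_assoc presented_eq.one_times presented_eq.distrib_left
  presented_eq.distrib_right

lemmas [trans] = presented_eq.trans

primrec eval_term :: "(complex, 'a, 'x) module_scheme \<Rightarrow> ('g \<Rightarrow> 'a) \<Rightarrow> 'g alg_term \<Rightarrow> 'a" where
  "eval_term A g (Gen x) = g x"
| "eval_term A g (Const c) = c \<odot>\<^bsub>A\<^esub> \<one>\<^bsub>A\<^esub>"
| "eval_term A g (Plus s t) = eval_term A g s \<oplus>\<^bsub>A\<^esub> eval_term A g t"
| "eval_term A g (Times s t) = eval_term A g s \<otimes>\<^bsub>A\<^esub> eval_term A g t"

lemma eval_term_closed:
  assumes "complex_algebra A" "\<And>x. g x \<in> carrier A"
  shows "eval_term A g t \<in> carrier A"
  by (induction t)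
    (simp_all add: assms complex_algebraD[OF assms(1)] cspaceD[OF complex_algebraD(1)[OF assms(1)]]
      abelian_groupD[OF cspaceD(1)[OF complex_algebraD(1)[OF assms(1)]]])

lemma eval_term_sound:
  assumes A: "complex_algebra A" and g: "\<And>x. g x \<in> carrier A"
    and E: "\<And>s t. (s, t) \<in> E \<Longrightarrow> eval_term A g s = eval_term A g t"
    and eq: "presented_eq E s t"
  shows "eval_term A g s = eval_term A g t"
proof -
  interpret A: complex_algebra A by (rule A)
  note cl = eval_term_closed[where g = g, OF A g]
  show ?thesis
    using eq
  proof (induction rule: presented_eq.induct)
    case (const_times c d)
    then show ?case
      by (simp add: complex_algebraD(4-7,9)[OF A] cspaceD[OF complex_algebraD(1)[OF A]])
  qed (simp_all add: E cl A.a_ac A.m_assoc A.l_distr A.r_distr complex_algebraD(4-7,9,10)[OF A]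
      cspaceD(2,3,6)[OF complex_algebraD(1)[OF A]] smult_zero[OF complex_algebraD(1)[OF A]])
qed

text \<open>A type that contains the complex numbers is infinite, so its square is in bijection with
  it. Terms can then be coded by iterated pairing inside the type.\<close>

lemma inj_alg_term:
  fixes c :: "complex \<Rightarrow> 'h" and g :: "'g \<Rightarrow> 'h"
  assumes c: "inj c" and g: "inj g"
  shows "\<exists>e :: 'g alg_term \<Rightarrow> 'h. inj e"
proof -
  have "infinite (UNIV :: 'h set)"
    using c infinite_UNIV_char_0[where ?'a = complex] finite_imageD[OF _ c] finite_subset[of "range c" UNIV]
    by auto
  then have "|(UNIV :: 'h set) \<times> (UNIV :: 'h set)| =o |UNIV :: 'h set|"
    by (rule card_of_Times_same_infinite)
  then obtain p :: "'h \<times> 'h \<Rightarrow> 'h" where "bij_betw p (UNIV \<times> UNIV) UNIV"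
    using card_of_ordIso by blast
  then have "inj p" by (simp add: bij_betw_def)
  then have p: "p x = p y \<longleftrightarrow> x = y" for x y
    by (rule inj_eq)
  \<comment> \<open>The numbers 0 to 3, embedded by \<open>c\<close>, tag the four constructors and
    keep their codes apart.\<close>
  define e :: "'g alg_term \<Rightarrow> 'h" where
    "e = rec_alg_term (\<lambda>x. p (c 0, g x)) (\<lambda>d. p (c 1, c d))
      (\<lambda>s t x y. p (c 2, p (x, y))) (\<lambda>s t x y. p (c 3, p (x, y)))"
  have e: "e (Gen x) = p (c 0, g x)" "e (Const d) = p (c 1, c d)"
    "e (Plus s t) = p (c 2, p (e s, e t))" "e (Times s t) = p (c 3, p (e s, e t))" for x d s t
    by (simp_all add: e_def)
  have "e s = e t \<Longrightarrow> s = t" for s t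
  proof (induction s arbitrary: t)
    case (Gen x)
    then show ?case by (cases t) (auto simp: e p inj_eq[OF c] inj_eq[OF g])
  next
    case (Const x)
    then show ?case by (cases t) (auto simp: e p inj_eq[OF c])
  next
    case (Plus s1 s2)
    then show ?case by (cases t) (auto simp: e p inj_eq[OF c])
  next
    case (Times s1 s2)
    then show ?case by (cases t) (auto simp: e p inj_eq[OF c])
  qed
  then show ?thesis by (auto simp: inj_def)
qed

text \<open>A term is sent to the code of a chosen representative of its class, so the quotient is
  realised inside \<open>'h\<close> itself. The choice depends only on the class, because equivalent
  terms satisfy the same predicate.\<close>

lemma ex_presentation:
  fixes c :: "complex \<Rightarrow> 'h" and g :: "'g \<Rightarrow> 'h"
  assumes "inj c" "inj g"
  shows "\<exists>p :: 'g alg_term \<Rightarrow> 'h. \<forall>s t. p s = p t \<longleftrightarrow> presented_eq E s t"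
proof -
  obtain e :: "'g alg_term \<Rightarrow> 'h" where e: "inj e"
    using inj_alg_term[OF assms] by blast
  define r where "r s = (SOME t. presented_eq E s t)" for s
  have r: "presented_eq E s (r s)" for s
    unfolding r_def by (rule someI[of _ s]) (rule presented_eq.refl)
  have "r s = r t \<longleftrightarrow> presented_eq E s t" for s t
  proof
    assume "r s = r t"
    then show "presented_eq E s t"
      using r[of s] r[of t] by (auto intro: presented_eq.trans presented_eq.sym)
  next
    assume "presented_eq E s t"
    then have "presented_eq E s = presented_eq E t"
      by (auto simp: fun_eq_iff intro: presented_eq.trans presented_eq.sym)
    then show "r s = r t" by (simp add: r_def)
  qed
  then show ?thesis
    by (intro exI[of _ "e \<circ> r"]) (simp add: inj_eq[OF e])
qed

section \<open>Presented algebras and their universal property\<close>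

definition alg_hom :: "(complex, 'a, 'x) module_scheme \<Rightarrow> (complex, 'b, 'y) module_scheme \<Rightarrow> ('a \<Rightarrow> 'b) set" where
  "alg_hom A B = linear_maps A B \<inter> ring_hom A B"

lemma alg_homI:
  assumes "f \<in> linear_maps A B"
    "\<And>x y. \<lbrakk>x \<in> carrier A; y \<in> carrier A\<rbrakk> \<Longrightarrow> f (x \<otimes>\<^bsub>A\<^esub> y) = f x \<otimes>\<^bsub>B\<^esub> f y"
    "f \<one>\<^bsub>A\<^esub> = \<one>\<^bsub>B\<^esub>"
  shows "f \<in> alg_hom A B"
  using assms linearD[OF assms(1)] by (auto simp: alg_hom_def ring_hom_def)

lemma alg_homD:
  assumes "f \<in> alg_hom A B"
  shows "f \<in> linear_maps A B" "f \<in> ring_hom A B"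
    "\<lbrakk>x \<in> carrier A; y \<in> carrier A\<rbrakk> \<Longrightarrow> f (x \<otimes>\<^bsub>A\<^esub> y) = f x \<otimes>\<^bsub>B\<^esub> f y"
    "f \<one>\<^bsub>A\<^esub> = \<one>\<^bsub>B\<^esub>"
  using assms by (auto simp: alg_hom_def ring_hom_def)

lemma alg_hom_id: "(\<lambda>x. x) \<in> alg_hom A A"
  by (rule alg_homI[OF linear_id]) auto

lemma alg_hom_comp:
  assumes "f \<in> alg_hom A B" "g \<in> alg_hom B C"
  shows "(\<lambda>x. g (f x)) \<in> alg_hom A C"
  by (rule alg_homI[OF linear_comp[OF alg_homD(1)[OF assms(1)] alg_homD(1)[OF assms(2)]]])
    (simp_all add: alg_homD(3,4)[OF assms(1)] alg_homD(3,4)[OF assms(2)] linearD(1)[OF alg_homD(1)[OF assms(1)]])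

text \<open>The comultiplication and counit are parameters, because they will themselves be obtained
  from the universal property of the algebra and cannot be named before it exists.\<close>

definition presented_algebra ::
  "('g alg_term \<Rightarrow> 'h) \<Rightarrow> ('h \<Rightarrow> ('h, 'h) tensor) \<Rightarrow> ('h \<Rightarrow> complex) \<Rightarrow> 'h coalg" where
  "presented_algebra p \<Delta> \<epsilon> =
     \<lparr>carrier = range p, monoid.mult = (\<lambda>x y. p (Times (inv_into UNIV p x) (inv_into UNIV p y))), one = p (Const 1),
      ring.zero = p (Const 0), add = (\<lambda>x y. p (Plus (inv_into UNIV p x) (inv_into UNIV p y))),
      smult = (\<lambda>c x. p (Times (Const c) (inv_into UNIV p x))), comult = \<Delta>, counit = \<epsilon>\<rparr>"

definition presented_lift ::
  "('g alg_term \<Rightarrow> 'h) \<Rightarrow> (complex, 'a, 'x) module_scheme \<Rightarrow> ('g \<Rightarrow> 'a) \<Rightarrow> 'h \<Rightarrow> 'a" where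
  "presented_lift p A g x = eval_term A g (inv_into UNIV p x)"

locale presentation =
  fixes E :: "('g alg_term \<times> 'g alg_term) set" and p :: "'g alg_term \<Rightarrow> 'h"
  assumes p_eq_iff: "p s = p t \<longleftrightarrow> presented_eq E s t"
begin

abbreviation "P \<equiv> presented_algebra p"

lemma inv_p: "presented_eq E (inv_into UNIV p (p s)) s"
  by (simp add: f_inv_into_f flip: p_eq_iff)

lemma P_simps:
  "carrier (P \<Delta> \<epsilon>) = range p" "p s \<otimes>\<^bsub>P \<Delta> \<epsilon>\<^esub> p t = p (Times s t)" "p s \<oplus>\<^bsub>P \<Delta> \<epsilon>\<^esub> p t = p (Plus s t)"
  "\<one>\<^bsub>P \<Delta> \<epsilon>\<^esub> = p (Const 1)" "\<zero>\<^bsub>P \<Delta> \<epsilon>\<^esub> = p (Const 0)" "c \<odot>\<^bsub>P \<Delta> \<epsilon>\<^esub> p s = p (Times (Const c) s)"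
  "comult (P \<Delta> \<epsilon>) = \<Delta>" "counit (P \<Delta> \<epsilon>) = \<epsilon>"
  by (auto simp: presented_algebra_def p_eq_iff
    intro!: presented_eq.times_cong presented_eq.plus_cong presented_eq.refl inv_p)

lemma P_cspace: "cspace (P \<Delta> \<epsilon>)"
proof (rule cspaceI)
  show "abelian_group (P \<Delta> \<epsilon>)"
  proof (rule abelian_groupI)
    fix x assume "x \<in> carrier (P \<Delta> \<epsilon>)"
    then obtain s where x: "x = p s" by (auto simp: P_simps)
    have "presented_eq E (Plus (Times (Const (-1)) s) (Times (Const 1) s)) (Times (Plus (Const (-1)) (Const 1)) s)"
      by (rule presented_eq.sym[OF presented_eq.distrib_right])
    also have "presented_eq E (Times (Plus (Const (-1)) (Const 1)) s) (Times (Const (-1 + 1)) s)"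
      by (rule presented_eq.times_cong[OF presented_eq.sym[OF presented_eq.const_plus] presented_eq.refl])
    also have "presented_eq E (Times (Const (-1 + 1)) s) (Const 0)"
      using presented_eq.zero_times[of E s] by simp
    finally
    have "presented_eq E (Plus (Times (Const (-1)) s) (Times (Const 1) s)) (Const 0)" .
    then have "presented_eq E (Plus (Times (Const (-1)) s) s) (Const 0)"
      by (rule presented_eq.trans[rotated])
        (rule presented_eq.plus_cong[OF presented_eq.refl presented_eq.sym[OF presented_eq.one_times]])
    then show "\<exists>y\<in>carrier (P \<Delta> \<epsilon>). y \<oplus>\<^bsub>P \<Delta> \<epsilon>\<^esub> x = \<zero>\<^bsub>P \<Delta> \<epsilon>\<^esub>"
      by (intro bexI[of _ "p (Times (Const (-1)) s)"]) (simp_all add: x P_simps p_eq_iff rangeI)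
  qed (auto simp: P_simps p_eq_iff rangeI intro: presented_eq_laws)
  have "presented_eq E (Times (Const (c + d)) s) (Plus (Times (Const c) s) (Times (Const d) s))" for c d s
    by (rule presented_eq.trans[OF presented_eq.times_cong[OF presented_eq.const_plus presented_eq.refl]
      presented_eq.distrib_right])
  then show "(c + d) \<odot>\<^bsub>P \<Delta> \<epsilon>\<^esub> x = c \<odot>\<^bsub>P \<Delta> \<epsilon>\<^esub> x \<oplus>\<^bsub>P \<Delta> \<epsilon>\<^esub> d \<odot>\<^bsub>P \<Delta> \<epsilon>\<^esub> x" if "x \<in> carrier (P \<Delta> \<epsilon>)" for c d x
    using that by (auto simp: P_simps p_eq_iff)
  have "presented_eq E (Times (Const (c * d)) s) (Times (Const c) (Times (Const d) s))" for c d s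
    by (rule presented_eq.trans[OF presented_eq.times_cong[OF presented_eq.const_times presented_eq.refl]
      presented_eq.times_assoc])
  then show "(c * d) \<odot>\<^bsub>P \<Delta> \<epsilon>\<^esub> x = c \<odot>\<^bsub>P \<Delta> \<epsilon>\<^esub> (d \<odot>\<^bsub>P \<Delta> \<epsilon>\<^esub> x)" if "x \<in> carrier (P \<Delta> \<epsilon>)" for c d x
    using that by (auto simp: P_simps p_eq_iff)
qed (auto simp: P_simps p_eq_iff rangeI intro: presented_eq_laws)

lemma P_algebra: "complex_algebra (P \<Delta> \<epsilon>)"
proof (rule complex_algebraI[OF P_cspace])
  have "presented_eq E (Times s (Times (Const c) t)) (Times (Const c) (Times s t))" for c s t
  proof -
    have "presented_eq E (Times s (Times (Const c) t)) (Times (Times s (Const c)) t)"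
      by (rule presented_eq.sym[OF presented_eq.times_assoc])
    also have "presented_eq E (Times (Times s (Const c)) t) (Times (Times (Const c) s) t)"
      by (rule presented_eq.times_cong[OF presented_eq.sym[OF presented_eq.const_central] presented_eq.refl])
    also have "presented_eq E (Times (Times (Const c) s) t) (Times (Const c) (Times s t))"
      by (rule presented_eq.times_assoc)
    finally show ?thesis .
  qed
  then show "bilinear (P \<Delta> \<epsilon>) (P \<Delta> \<epsilon>) (P \<Delta> \<epsilon>) (\<otimes>\<^bsub>P \<Delta> \<epsilon>\<^esub>)"
    by (intro bilinearI left_module_homI) (auto simp: P_simps p_eq_iff rangeI intro: presented_eq_laws)
  have "presented_eq E (Times s (Const 1)) s" for s
    by (rule presented_eq.trans[OF presented_eq.sym[OF presented_eq.const_central] presented_eq.one_times])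
  then show "x \<otimes>\<^bsub>P \<Delta> \<epsilon>\<^esub> \<one>\<^bsub>P \<Delta> \<epsilon>\<^esub> = x" if "x \<in> carrier (P \<Delta> \<epsilon>)" for x
    using that by (auto simp: P_simps p_eq_iff)
qed (auto simp: P_simps p_eq_iff rangeI intro: presented_eq_laws)

lemma presented_lift:
  assumes A: "complex_algebra A" and g: "\<And>x. g x \<in> carrier A"
    and E: "\<And>s t. (s, t) \<in> E \<Longrightarrow> eval_term A g s = eval_term A g t"
  shows "presented_lift p A g (p s) = eval_term A g s"
    "presented_lift p A g \<in> alg_hom (P \<Delta> \<epsilon>) A"
proof -
  show *: "presented_lift p A g (p s) = eval_term A g s" for s
    unfolding presented_lift_def by (rule eval_term_sound[OF A g E inv_p])
  note A' = cspaceD[OF complex_algebraD(1)[OF A]]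
  show "presented_lift p A g \<in> alg_hom (P \<Delta> \<epsilon>) A"
    by (rule alg_homI, rule left_module_homI)
      (auto simp: P_simps * eval_term_closed[OF A g] complex_algebraD[OF A] A')
qed

text \<open>Serves statements that are not equalities of homomorphisms, such as the antipode axioms.
  Constants are covered by the cases of the unit and of scalar multiples.\<close>

lemma p_induct:
  assumes x: "x \<in> carrier (P \<Delta> \<epsilon>)" and gen: "\<And>y. Q (p (Gen y))" and one: "Q \<one>\<^bsub>P \<Delta> \<epsilon>\<^esub>"
    and smult: "\<And>c y. \<lbrakk>y \<in> carrier (P \<Delta> \<epsilon>); Q y\<rbrakk> \<Longrightarrow> Q (c \<odot>\<^bsub>P \<Delta> \<epsilon>\<^esub> y)"
    and add: "\<And>y z. \<lbrakk>y \<in> carrier (P \<Delta> \<epsilon>); z \<in> carrier (P \<Delta> \<epsilon>); Q y; Q z\<rbrakk> \<Longrightarrow> Q (y \<oplus>\<^bsub>P \<Delta> \<epsilon>\<^esub> z)"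
    and mult: "\<And>y z. \<lbrakk>y \<in> carrier (P \<Delta> \<epsilon>); z \<in> carrier (P \<Delta> \<epsilon>); Q y; Q z\<rbrakk> \<Longrightarrow> Q (y \<otimes>\<^bsub>P \<Delta> \<epsilon>\<^esub> z)"
  shows "Q x"
proof -
  have "Q (p s)" for s
  proof (induction s)
    case (Const c)
    have "c \<odot>\<^bsub>P \<Delta> \<epsilon>\<^esub> \<one>\<^bsub>P \<Delta> \<epsilon>\<^esub> = p (Const c)"
      by (auto simp: P_simps p_eq_iff
        intro: presented_eq.trans[OF presented_eq.const_central presented_eq.one_times])
    then show ?case using smult[OF _ one, of c] by (simp add: P_simps)
  next
    case (Plus s t)
    then show ?case using add[of "p s" "p t"] by (simp add: P_simps)
  next
    case (Times s t)
    then show ?case using mult[of "p s" "p t"] by (simp add: P_simps)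
  qed (rule gen)
  then show ?thesis using x by (auto simp: P_simps)
qed

lemma alg_hom_eqI:
  assumes "f \<in> alg_hom (P \<Delta> \<epsilon>) A" "g \<in> alg_hom (P \<Delta> \<epsilon>) A" "\<And>y. f (p (Gen y)) = g (p (Gen y))"
    and "x \<in> carrier (P \<Delta> \<epsilon>)"
  shows "f x = g x"
  using assms(4)
  by (rule p_induct)
    (simp_all add: assms(3) alg_homD(3,4)[OF assms(1)] alg_homD(3,4)[OF assms(2)]
      linearD[OF alg_homD(1)[OF assms(1)]] linearD[OF alg_homD(1)[OF assms(2)]])

end

subsection \<open>Algebra homomorphisms between tensor products\<close>

lemma tensor_map_alg_hom:
  assumes A: "complex_algebra A" and B: "complex_algebra B" and A1: "complex_algebra A1" and B1: "complex_algebra B1"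
    and f: "f \<in> alg_hom A A1" and g: "g \<in> alg_hom B B1"
  shows "tensor_map A1 B1 f g \<in> alg_hom (tensor_algebra A B) (tensor_algebra A1 B1)"
proof (rule alg_homI)
  note f' = alg_homD[OF f] and g' = alg_homD[OF g]
  note c = complex_algebraD(1)[OF A] complex_algebraD(1)[OF B] complex_algebraD(1)[OF A1] complex_algebraD(1)[OF B1]
  show "tensor_map A1 B1 f g \<in> linear_maps (tensor_algebra A B) (tensor_algebra A1 B1)"
    using tensor_map_linear[OF c f'(1) g'(1)]
    by (simp add: left_module_hom_def tensor_algebra_simps[OF A B] tensor_algebra_simps[OF A1 B1])
  show "tensor_map A1 B1 f g (x \<otimes>\<^bsub>tensor_algebra A B\<^esub> y) =
      tensor_map A1 B1 f g x \<otimes>\<^bsub>tensor_algebra A1 B1\<^esub> tensor_map A1 B1 f g y"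
    if "x \<in> carrier (tensor_algebra A B)" "y \<in> carrier (tensor_algebra A B)" for x y
    using that unfolding tensor_algebra_simps[OF A B]
    by (intro tensor_map_mult[OF A B A1 B1 f'(1) _ g'(1)] f'(3) g'(3))
  show "tensor_map A1 B1 f g \<one>\<^bsub>tensor_algebra A B\<^esub> = \<one>\<^bsub>tensor_algebra A1 B1\<^esub>"
    by (simp add: tensor_algebra_simps[OF A B] tensor_algebra_simps[OF A1 B1]
      tensor_map_pure[OF c f'(1) g'(1)] f'(4) g'(4) complex_algebraD(5)[OF A] complex_algebraD(5)[OF B])
qed

lemma tensor_assoc_alg_hom:
  assumes A: "complex_algebra A" and B: "complex_algebra B" and C: "complex_algebra C"
  shows "tensor_assoc A B C \<in>
    alg_hom (tensor_algebra (tensor_algebra A B) C) (tensor_algebra A (tensor_algebra B C))"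
proof (rule alg_homI)
  note c = complex_algebraD(1)[OF A] complex_algebraD(1)[OF B] complex_algebraD(1)[OF C]
  note AB = complex_algebra_tensor[OF A B] and BC = complex_algebra_tensor[OF B C]
  note s = tensor_algebra_simps[OF AB C] tensor_algebra_simps[OF A BC] tensor_space_tensor_algebra
    tensor_algebra_simps[OF A B] tensor_algebra_simps[OF B C]
  show "tensor_assoc A B C \<in> linear_maps (tensor_algebra (tensor_algebra A B) C) (tensor_algebra A (tensor_algebra B C))"
    using tensor_assoc_linear[OF c] by (simp add: left_module_hom_def s)
  show "tensor_assoc A B C (x \<otimes>\<^bsub>tensor_algebra (tensor_algebra A B) C\<^esub> y) =
      tensor_assoc A B C x \<otimes>\<^bsub>tensor_algebra A (tensor_algebra B C)\<^esub> tensor_assoc A B C y"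
    if "x \<in> carrier (tensor_algebra (tensor_algebra A B) C)" "y \<in> carrier (tensor_algebra (tensor_algebra A B) C)" for x y
    using that by (intro tensor_assoc_mult[OF A B C]) (simp_all add: s)
  show "tensor_assoc A B C \<one>\<^bsub>tensor_algebra (tensor_algebra A B) C\<^esub> = \<one>\<^bsub>tensor_algebra A (tensor_algebra B C)\<^esub>"
    by (simp add: s tensor_assoc_pure[OF c] complex_algebraD(5)[OF A] complex_algebraD(5)[OF B] complex_algebraD(5)[OF C])
qed

text \<open>Makes each counit axiom of Takeuchi's algebra an equality between an algebra
  homomorphism and the identity, to be checked on generators.\<close>

lemma tensor_lift_alg_hom:
  assumes A: "complex_algebra A" and B: "complex_algebra B" and C: "complex_algebra C"
    and f: "bilinear A B C f"
    and mult: "\<And>a b a' b'. \<lbrakk>a \<in> carrier A; b \<in> carrier B; a' \<in> carrier A; b' \<in> carrier B\<rbrakk> \<Longrightarrow>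
      f (a \<otimes>\<^bsub>A\<^esub> a') (b \<otimes>\<^bsub>B\<^esub> b') = f a b \<otimes>\<^bsub>C\<^esub> f a' b'"
    and one: "f \<one>\<^bsub>A\<^esub> \<one>\<^bsub>B\<^esub> = \<one>\<^bsub>C\<^esub>"
  shows "tensor_lift C f \<in> alg_hom (tensor_algebra A B) C"
proof (rule alg_homI)
  note c = complex_algebraD(1)[OF A] complex_algebraD(1)[OF B] complex_algebraD(1)[OF C]
  note l = tensor_lift_linear[OF c f] and lp = tensor_lift_pure[OF c f]
  note m = bilinearD[OF bilinear_tensor_mult[OF A B]] and n = bilinearD[OF bilinear_mult[OF C]]
  show "tensor_lift C f \<in> linear_maps (tensor_algebra A B) C"
    using l by (simp add: left_module_hom_def tensor_algebra_simps[OF A B])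
  show "tensor_lift C f (X \<otimes>\<^bsub>tensor_algebra A B\<^esub> Y) = tensor_lift C f X \<otimes>\<^bsub>C\<^esub> tensor_lift C f Y"
    if X: "X \<in> carrier (tensor_algebra A B)" and Y: "Y \<in> carrier (tensor_algebra A B)" for X Y
    using X Y unfolding tensor_algebra_simps[OF A B]
  proof (induction X rule: tensor_induct[OF c(1,2), consumes 1, case_names pure add])
    case (pure a b)
    note ab = this
    show ?case
      using \<open>Y \<in> carrier (tensor_space A B)\<close>
      by (induction Y rule: tensor_induct[OF c(1,2), consumes 1, case_names pure add])
        (use ab in \<open>simp_all add: tensor_mult_pure[OF A B] lp mult m n linearD[OF l] pure_tensor_closed c
          complex_algebraD(4)[OF A] complex_algebraD(4)[OF B] bilinearD(3)[OF f]\<close>)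
  qed (simp_all add: m n linearD[OF l])
  show "tensor_lift C f \<one>\<^bsub>tensor_algebra A B\<^esub> = \<one>\<^bsub>C\<^esub>"
    by (simp add: tensor_algebra_simps[OF A B] lp one complex_algebraD(5)[OF A] complex_algebraD(5)[OF B])
qed

text \<open>\<open>complex_ring\<close> is a bare ring without scalar multiplication. As target of
  the counit the complex numbers are needed as an algebra over themselves.\<close>

definition complex_alg :: "(complex, complex) module" where
  "complex_alg = \<lparr>carrier = UNIV, monoid.mult = (*), one = 1, ring.zero = 0, add = (+), smult = (*)\<rparr>"

lemma complex_alg_simps [simp]:
  "carrier complex_alg = UNIV" "x \<otimes>\<^bsub>complex_alg\<^esub> y = x * y" "\<one>\<^bsub>complex_alg\<^esub> = 1"
  "\<zero>\<^bsub>complex_alg\<^esub> = 0" "x \<oplus>\<^bsub>complex_alg\<^esub> y = x + y" "c \<odot>\<^bsub>complex_alg\<^esub> x = c * x"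
  by (simp_all add: complex_alg_def)

lemma complex_algebra_complex_alg: "complex_algebra complex_alg"
proof (rule complex_algebraI)
  have "abelian_group complex_ring"
    using cring_complex_ring by (simp add: cring_def ring_def)
  then have "abelian_group complex_alg"
    by (rule abelian_group_cong) (auto simp: complex_ring_def complex_alg_def)
  then show "cspace complex_alg"
    by (rule cspaceI) (auto simp: algebra_simps)
qed (auto intro!: bilinearI left_module_homI simp: algebra_simps)

text \<open>An antipode reverses products. It becomes a homomorphism, and thus accessible to the
  universal property, with the opposite algebra as target.\<close>

definition opposite_algebra :: "(complex, 'a, 'x) module_scheme \<Rightarrow> (complex, 'a, 'x) module_scheme" where
  "opposite_algebra A = A\<lparr>monoid.mult := \<lambda>x y. y \<otimes>\<^bsub>A\<^esub> x\<rparr>"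

lemma opposite_algebra_simps:
  "carrier (opposite_algebra A) = carrier A" "x \<otimes>\<^bsub>opposite_algebra A\<^esub> y = y \<otimes>\<^bsub>A\<^esub> x"
  "\<one>\<^bsub>opposite_algebra A\<^esub> = \<one>\<^bsub>A\<^esub>" "\<zero>\<^bsub>opposite_algebra A\<^esub> = \<zero>\<^bsub>A\<^esub>"
  "x \<oplus>\<^bsub>opposite_algebra A\<^esub> y = x \<oplus>\<^bsub>A\<^esub> y" "c \<odot>\<^bsub>opposite_algebra A\<^esub> x = c \<odot>\<^bsub>A\<^esub> x"
  "add (opposite_algebra A) = add A"
  by (simp_all add: opposite_algebra_def)

lemma complex_algebra_opposite:
  assumes A: "complex_algebra A"
  shows "complex_algebra (opposite_algebra A)"
proof (rule complex_algebraI)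
  note A' = complex_algebraD(1)[OF A]
  show "cspace (opposite_algebra A)"
    by (rule cspaceI, rule abelian_group_cong[OF cspaceD(1)[OF A']])
      (simp_all add: opposite_algebra_simps cspaceD[OF A'])
  show "bilinear (opposite_algebra A) (opposite_algebra A) (opposite_algebra A) (\<otimes>\<^bsub>opposite_algebra A\<^esub>)"
    by (intro bilinearI left_module_homI)
      (simp_all add: opposite_algebra_simps bilinearD[OF bilinear_mult[OF A]])
qed (simp_all add: opposite_algebra_simps complex_algebraD[OF A])

section \<open>The free Hopf algebra on a matrix coalgebra\<close>

text \<open>Takeuchi's construction: the generators \<open>(n, i, j)\<close> stand for the entries of a matrix \<open>y\<^sub>n\<close>, and
  the relations say that the transpose of \<open>y\<^sub>n\<^sub>+\<^sub>1\<close> is the inverse of \<open>y\<^sub>n\<close>. The antipode maps the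
  \<open>(i, j)\<close> entry of \<open>y\<^sub>n\<close> to the \<open>(j, i)\<close> entry of \<open>y\<^sub>n\<^sub>+\<^sub>1\<close>.\<close>

definition takeuchi_relations :: "((nat \<times> 2 \<times> 2) alg_term \<times> (nat \<times> 2 \<times> 2) alg_term) set" where
  "takeuchi_relations =
     {(Plus (Times (Gen (n, i, 0)) (Gen (Suc n, j, 0))) (Times (Gen (n, i, 1)) (Gen (Suc n, j, 1))),
       Const (if i = j then 1 else 0)) | n i j. True} \<union>
     {(Plus (Times (Gen (Suc n, 0, i)) (Gen (n, 0, j))) (Times (Gen (Suc n, 1, i)) (Gen (n, 1, j))),
       Const (if i = j then 1 else 0)) | n i j. True}"

text \<open>In matrix notation y z^T = 1 and z^T y = 1. Both equations are imposed, since over a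
  noncommutative algebra a one-sided inverse need not be two-sided.\<close>

definition inverse_transpose :: "(complex, 'a, 'x) module_scheme \<Rightarrow> (2 \<Rightarrow> 2 \<Rightarrow> 'a) \<Rightarrow> (2 \<Rightarrow> 2 \<Rightarrow> 'a) \<Rightarrow> bool" where
  "inverse_transpose A y z \<longleftrightarrow>
     (\<forall>i j. y i 0 \<otimes>\<^bsub>A\<^esub> z j 0 \<oplus>\<^bsub>A\<^esub> y i 1 \<otimes>\<^bsub>A\<^esub> z j 1 = (if i = j then 1 else 0) \<odot>\<^bsub>A\<^esub> \<one>\<^bsub>A\<^esub>) \<and>
     (\<forall>i j. z 0 i \<otimes>\<^bsub>A\<^esub> y 0 j \<oplus>\<^bsub>A\<^esub> z 1 i \<otimes>\<^bsub>A\<^esub> y 1 j = (if i = j then 1 else 0) \<odot>\<^bsub>A\<^esub> \<one>\<^bsub>A\<^esub>)"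

definition takeuchi_solution :: "(complex, 'a, 'x) module_scheme \<Rightarrow> (nat \<Rightarrow> 2 \<Rightarrow> 2 \<Rightarrow> 'a) \<Rightarrow> bool" where
  "takeuchi_solution A y \<longleftrightarrow>
     (\<forall>n i j. y n i j \<in> carrier A) \<and> (\<forall>n. inverse_transpose A (y n) (y (Suc n)))"

lemma takeuchi_solutionD:
  assumes "takeuchi_solution A y"
  shows "y n i j \<in> carrier A"
    "y n i 0 \<otimes>\<^bsub>A\<^esub> y (Suc n) j 0 \<oplus>\<^bsub>A\<^esub> y n i 1 \<otimes>\<^bsub>A\<^esub> y (Suc n) j 1 = (if i = j then 1 else 0) \<odot>\<^bsub>A\<^esub> \<one>\<^bsub>A\<^esub>"
    "y (Suc n) 0 i \<otimes>\<^bsub>A\<^esub> y n 0 j \<oplus>\<^bsub>A\<^esub> y (Suc n) 1 i \<otimes>\<^bsub>A\<^esub> y n 1 j = (if i = j then 1 else 0) \<odot>\<^bsub>A\<^esub> \<one>\<^bsub>A\<^esub>"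
  using assms by (simp_all add: takeuchi_solution_def inverse_transpose_def)

lemma takeuchi_solution_counit: "takeuchi_solution complex_alg (\<lambda>n i j. if i = j then 1 else 0)"
  using two_cases by (auto simp: takeuchi_solution_def inverse_transpose_def)

text \<open>Reversing products and transposing interchanges the two kinds of relations. The
  relations of \<open>A\<close> at \<open>Suc n\<close> thus become relations of the opposite
  algebra at \<open>n\<close>, which yields the antipode.\<close>

lemma takeuchi_solution_opposite:
  assumes "takeuchi_solution A y"
  shows "takeuchi_solution (opposite_algebra A) (\<lambda>n i j. y (Suc n) j i)"
  unfolding takeuchi_solution_def inverse_transpose_def opposite_algebra_simps
  using takeuchi_solutionD[OF assms] by (auto simp: eq_commute)

text \<open>The new matrix is the product of y_n \<otimes> 1 and 1 \<otimes> z_n. Entries of these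
  two matrices commute with each other, so transposition reverses the product and the inverse
  transpose of the product is the product of the inverse transposes. This yields the
  comultiplication.\<close>

lemma takeuchi_solution_tensor:
  assumes A: "complex_algebra A" and B: "complex_algebra B"
    and y: "takeuchi_solution A y" and z: "takeuchi_solution B z"
  shows "takeuchi_solution (tensor_algebra A B) (\<lambda>n i j. pure_tensor A B (y n i 0) (z n 0 j)
      \<oplus>\<^bsub>tensor_space A B\<^esub> pure_tensor A B (y n i 1) (z n 1 j))" (is "takeuchi_solution _ ?X")
proof -
  let ?T = "tensor_space A B" and ?p = "pure_tensor A B"
  note y' = takeuchi_solutionD[OF y] and z' = takeuchi_solutionD[OF z]
  note c = complex_algebraD(1)[OF A] complex_algebraD(1)[OF B]
  note T = cspace_tensor[OF c]
  interpret T: abelian_group ?T by (rule cspaceD(1)[OF T])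
  note mA = complex_algebraD(4)[OF A] and mB = complex_algebraD(4)[OF B]
  note one = complex_algebraD(5)[OF A] complex_algebraD(5)[OF B]
  note pc = pure_tensor_closed[OF c]
  note m = bilinearD[OF bilinear_tensor_mult[OF A B]]
  have prod: "?X n i j \<otimes>\<^bsub>tensor_algebra A B\<^esub> ?X n' i' j' =
      (?p (y n i 0 \<otimes>\<^bsub>A\<^esub> y n' i' 0) (z n 0 j \<otimes>\<^bsub>B\<^esub> z n' 0 j') \<oplus>\<^bsub>?T\<^esub>
       ?p (y n i 0 \<otimes>\<^bsub>A\<^esub> y n' i' 1) (z n 0 j \<otimes>\<^bsub>B\<^esub> z n' 1 j')) \<oplus>\<^bsub>?T\<^esub>
      (?p (y n i 1 \<otimes>\<^bsub>A\<^esub> y n' i' 0) (z n 1 j \<otimes>\<^bsub>B\<^esub> z n' 0 j') \<oplus>\<^bsub>?T\<^esub>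
       ?p (y n i 1 \<otimes>\<^bsub>A\<^esub> y n' i' 1) (z n 1 j \<otimes>\<^bsub>B\<^esub> z n' 1 j'))" for n i j n' i' j'
    by (simp add: m y'(1) z'(1) pc mA mB tensor_mult_pure[OF A B] T.a_ac)
  \<comment> \<open>Pairs the terms that share the factor not yet contracted. For the first relation
    the sum collapses in \<open>B\<close> and then in \<open>A\<close>, for the second in the
    opposite order.\<close>
  have interchange: "((s0 \<oplus>\<^bsub>?T\<^esub> s1) \<oplus>\<^bsub>?T\<^esub> (s2 \<oplus>\<^bsub>?T\<^esub> s3)) \<oplus>\<^bsub>?T\<^esub> ((t0 \<oplus>\<^bsub>?T\<^esub> t1) \<oplus>\<^bsub>?T\<^esub> (t2 \<oplus>\<^bsub>?T\<^esub> t3)) =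
      ((s0 \<oplus>\<^bsub>?T\<^esub> t0) \<oplus>\<^bsub>?T\<^esub> (s1 \<oplus>\<^bsub>?T\<^esub> t1)) \<oplus>\<^bsub>?T\<^esub> ((s2 \<oplus>\<^bsub>?T\<^esub> t2) \<oplus>\<^bsub>?T\<^esub> (s3 \<oplus>\<^bsub>?T\<^esub> t3))"
    if "s0 \<in> carrier ?T" "s1 \<in> carrier ?T" "s2 \<in> carrier ?T" "s3 \<in> carrier ?T"
      "t0 \<in> carrier ?T" "t1 \<in> carrier ?T" "t2 \<in> carrier ?T" "t3 \<in> carrier ?T" for s0 s1 s2 s3 t0 t1 t2 t3
    using that by (simp add: T.a_ac)
  show ?thesis
    unfolding takeuchi_solution_def inverse_transpose_def tensor_algebra_simps[OF A B]
  proof (intro conjI allI)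
    show "?X n i j \<in> carrier ?T" for n i j
      by (simp add: pc y'(1) z'(1))
    show "?X n i 0 \<otimes>\<^bsub>tensor_algebra A B\<^esub> ?X (Suc n) j 0 \<oplus>\<^bsub>?T\<^esub> ?X n i 1 \<otimes>\<^bsub>tensor_algebra A B\<^esub> ?X (Suc n) j 1 =
      (if i = j then 1 else 0) \<odot>\<^bsub>?T\<^esub> ?p \<one>\<^bsub>A\<^esub> \<one>\<^bsub>B\<^esub>" for n i j
    proof -
      have "?X n i 0 \<otimes>\<^bsub>tensor_algebra A B\<^esub> ?X (Suc n) j 0 \<oplus>\<^bsub>?T\<^esub> ?X n i 1 \<otimes>\<^bsub>tensor_algebra A B\<^esub> ?X (Suc n) j 1 =
        ?p (y n i 0 \<otimes>\<^bsub>A\<^esub> y (Suc n) j 0) \<one>\<^bsub>B\<^esub> \<oplus>\<^bsub>?T\<^esub> ?p (y n i 1 \<otimes>\<^bsub>A\<^esub> y (Suc n) j 1) \<one>\<^bsub>B\<^esub>"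
        unfolding prod
        by (subst interchange)
          (simp_all add: pc mA mB y'(1) z'(1,2) one smult_zero[OF T] cspaceD(6)[OF T]
            flip: pure_tensor_add_right[OF c] smult_pure_tensor_right[OF c])
      also have "\<dots> = ?p ((if i = j then 1 else 0) \<odot>\<^bsub>A\<^esub> \<one>\<^bsub>A\<^esub>) \<one>\<^bsub>B\<^esub>"
        by (simp add: mA y' one flip: pure_tensor_add_left[OF c])
      finally show ?thesis by (simp add: smult_pure_tensor_left[OF c] one)
    qed
    show "?X (Suc n) 0 i \<otimes>\<^bsub>tensor_algebra A B\<^esub> ?X n 0 j \<oplus>\<^bsub>?T\<^esub> ?X (Suc n) 1 i \<otimes>\<^bsub>tensor_algebra A B\<^esub> ?X n 1 j =
      (if i = j then 1 else 0) \<odot>\<^bsub>?T\<^esub> ?p \<one>\<^bsub>A\<^esub> \<one>\<^bsub>B\<^esub>" for n i j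
    proof -
      have "?X (Suc n) 0 i \<otimes>\<^bsub>tensor_algebra A B\<^esub> ?X n 0 j \<oplus>\<^bsub>?T\<^esub> ?X (Suc n) 1 i \<otimes>\<^bsub>tensor_algebra A B\<^esub> ?X n 1 j =
        ?p \<one>\<^bsub>A\<^esub> (z (Suc n) 0 i \<otimes>\<^bsub>B\<^esub> z n 0 j) \<oplus>\<^bsub>?T\<^esub> ?p \<one>\<^bsub>A\<^esub> (z (Suc n) 1 i \<otimes>\<^bsub>B\<^esub> z n 1 j)"
        unfolding prod
        by (subst interchange)
          (simp_all add: pc mA mB y'(1,3) z'(1) one smult_zero[OF T] cspaceD(6)[OF T]
            flip: pure_tensor_add_left[OF c] smult_pure_tensor_left[OF c])
      also have "\<dots> = ?p \<one>\<^bsub>A\<^esub> ((if i = j then 1 else 0) \<odot>\<^bsub>B\<^esub> \<one>\<^bsub>B\<^esub>)"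
        by (simp add: mB z' one flip: pure_tensor_add_right[OF c])
      finally show ?thesis by (simp add: smult_pure_tensor_right[OF c] one)
    qed
  qed
qed

locale takeuchi_presentation = presentation takeuchi_relations p
  for p :: "(nat \<times> 2 \<times> 2) alg_term \<Rightarrow> 'h"
begin

definition y :: "nat \<Rightarrow> 2 \<Rightarrow> 2 \<Rightarrow> 'h" where
  "y n i j = p (Gen (n, i, j))"

text \<open>A solution of the relations in an algebra amounts to a homomorphism into it.
  Comultiplication, counit, antipode and the representation on power series all arise from
  this.\<close>

lemma takeuchi_lift:
  assumes A: "complex_algebra A" and z: "takeuchi_solution A z"
  shows "presented_lift p A (\<lambda>(n, i, j). z n i j) \<in> alg_hom (P \<Delta> \<epsilon>) A"
    "presented_lift p A (\<lambda>(n, i, j). z n i j) (y n i j) = z n i j"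
proof -
  note z' = takeuchi_solutionD[OF z]
  have 1: "(case x of (n, i, j) \<Rightarrow> z n i j) \<in> carrier A" for x
    by (cases x) (simp add: z'(1))
  have 2: "eval_term A (\<lambda>(n, i, j). z n i j) s = eval_term A (\<lambda>(n, i, j). z n i j) t"
    if "(s, t) \<in> takeuchi_relations" for s t
    using that z'(2,3) by (auto simp: takeuchi_relations_def)
  show "presented_lift p A (\<lambda>(n, i, j). z n i j) \<in> alg_hom (P \<Delta> \<epsilon>) A"
    by (rule presented_lift(2)[OF A 1 2])
  show "presented_lift p A (\<lambda>(n, i, j). z n i j) (y n i j) = z n i j"
    unfolding y_def by (subst presented_lift(1)[OF A 1 2]) auto
qed

lemma y_solution: "takeuchi_solution (P \<Delta> \<epsilon>) y"
proof -
  have c: "c \<odot>\<^bsub>P \<Delta> \<epsilon>\<^esub> \<one>\<^bsub>P \<Delta> \<epsilon>\<^esub> = p (Const c)" for c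
    by (auto simp: P_simps p_eq_iff
      intro: presented_eq.trans[OF presented_eq.const_central presented_eq.one_times])
  have "presented_eq takeuchi_relations s t" if "(s, t) \<in> takeuchi_relations" for s t
    using that by (rule presented_eq.relation)
  then show ?thesis
    unfolding takeuchi_solution_def inverse_transpose_def c
    by (auto simp: y_def P_simps p_eq_iff takeuchi_relations_def rangeI)
qed

text \<open>Breaks a circularity: \<Delta> takes values in the tensor square of the algebra, whose
  record has \<Delta> as a field. Tensor products ignore that field, so a copy with dummy entries
  can stand in, and \<open>tensor_K0\<close> replaces it afterwards.\<close>

abbreviation "K0 \<equiv> P undefined undefined"

section \<open>Comultiplication, counit and antipode of Takeuchi's algebra\<close>

definition \<Delta> :: "'h \<Rightarrow> ('h, 'h) tensor" where
  "\<Delta> = presented_lift p (tensor_algebra K0 K0) (\<lambda>(n, i, j). pure_tensor K0 K0 (y n i 0) (y n 0 j)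
      \<oplus>\<^bsub>tensor_space K0 K0\<^esub> pure_tensor K0 K0 (y n i 1) (y n 1 j))"

definition \<epsilon> :: "'h \<Rightarrow> complex" where
  "\<epsilon> = presented_lift p complex_alg (\<lambda>(n, i, j). if i = j then 1 else 0)"

abbreviation "K \<equiv> P \<Delta> \<epsilon>"
abbreviation "KK \<equiv> tensor_space K K"
abbreviation "KKa \<equiv> tensor_algebra K K"

definition S :: "'h \<Rightarrow> 'h" where
  "S = presented_lift p (opposite_algebra K) (\<lambda>(n, i, j). y (Suc n) j i)"

lemmas K = P_algebra[of \<Delta> \<epsilon>] and K' = P_cspace[of \<Delta> \<epsilon>]
lemmas KKa = complex_algebra_tensor[OF K K] and KK = cspace_tensor[OF K' K']
lemmas y_sol = y_solution[of \<Delta> \<epsilon>]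
lemmas y = takeuchi_solutionD[OF y_sol]

lemma tensor_K0: "tensor_space K0 K0 = KK" "pure_tensor K0 K0 = pure_tensor K K" "tensor_algebra K0 K0 = KKa"
proof -
  show 1: "tensor_space K0 K0 = KK" and 2: "pure_tensor K0 K0 = pure_tensor K K"
    by (rule tensor_space_cong; simp add: presented_algebra_def)+
  have "monoid.mult K0 = monoid.mult K" "one K0 = one K"
    by (simp_all add: presented_algebra_def)
  then show "tensor_algebra K0 K0 = KKa"
    by (simp add: tensor_algebra_def 1 2)
qed

lemmas \<Delta>_lift = takeuchi_lift[OF KKa takeuchi_solution_tensor[OF K K y_sol y_sol], folded \<Delta>_def[unfolded tensor_K0]]
lemmas \<Delta>_hom = \<Delta>_lift(1)[of \<Delta> \<epsilon>] and \<Delta>_y = \<Delta>_lift(2)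

lemmas \<epsilon>_lift = takeuchi_lift[OF complex_algebra_complex_alg takeuchi_solution_counit, folded \<epsilon>_def]
lemmas \<epsilon>_hom = \<epsilon>_lift(1)[of \<Delta> \<epsilon>] and \<epsilon>_y = \<epsilon>_lift(2)

lemmas S_lift = takeuchi_lift[OF complex_algebra_opposite[OF K] takeuchi_solution_opposite[OF y_sol], folded S_def]
lemmas S_hom = S_lift(1)[of \<Delta> \<epsilon>] and S_y = S_lift(2)

lemmas K_laws = complex_algebraD[OF K] cspaceD[OF K'] abelian_groupD[OF cspaceD(1)[OF K']]

lemma \<Delta>_linear: "\<Delta> \<in> linear_maps K KK"
  using alg_homD(1)[OF \<Delta>_hom] by (simp add: left_module_hom_def tensor_algebra_simps[OF K K])

lemma \<Delta>_one: "\<Delta> \<one>\<^bsub>K\<^esub> = pure_tensor K K \<one>\<^bsub>K\<^esub> \<one>\<^bsub>K\<^esub>"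
  using alg_homD(4)[OF \<Delta>_hom] by (simp add: tensor_algebra_simps[OF K K])

lemma \<epsilon>: "\<epsilon> \<one>\<^bsub>K\<^esub> = 1"
  "\<lbrakk>u \<in> carrier K; v \<in> carrier K\<rbrakk> \<Longrightarrow> \<epsilon> (u \<otimes>\<^bsub>K\<^esub> v) = \<epsilon> u * \<epsilon> v"
  "\<lbrakk>u \<in> carrier K; v \<in> carrier K\<rbrakk> \<Longrightarrow> \<epsilon> (u \<oplus>\<^bsub>K\<^esub> v) = \<epsilon> u + \<epsilon> v"
  "u \<in> carrier K \<Longrightarrow> \<epsilon> (c \<odot>\<^bsub>K\<^esub> u) = c * \<epsilon> u"
  using alg_homD(3,4)[OF \<epsilon>_hom] linearD[OF alg_homD(1)[OF \<epsilon>_hom]] by simp_all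

lemma S_linear: "S \<in> linear_maps K K"
  using alg_homD(1)[OF S_hom] by (simp add: left_module_hom_def opposite_algebra_simps)

lemma S: "S \<one>\<^bsub>K\<^esub> = \<one>\<^bsub>K\<^esub>"
  "\<lbrakk>u \<in> carrier K; v \<in> carrier K\<rbrakk> \<Longrightarrow> S (u \<otimes>\<^bsub>K\<^esub> v) = S v \<otimes>\<^bsub>K\<^esub> S u"
  using alg_homD(3,4)[OF S_hom] by (simp_all add: opposite_algebra_simps)

text \<open>Both sides are algebra homomorphisms, and on an entry of y_n both give the double sum of
  y_il \<otimes> (y_lm \<otimes> y_mj).\<close>

lemma K_coassoc:
  assumes "x \<in> carrier K"
  shows "tensor_map K KK (\<lambda>u. u) \<Delta> (\<Delta> x) =
    tensor_assoc K K K (tensor_map KK K \<Delta> (\<lambda>u. u) (\<Delta> x))"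
proof -
  have "tensor_map K KKa (\<lambda>u. u) \<Delta> \<in> alg_hom KKa (tensor_algebra K KKa)"
    by (rule tensor_map_alg_hom[OF K K K KKa alg_hom_id \<Delta>_hom])
  then have L: "(\<lambda>x. tensor_map K KK (\<lambda>u. u) \<Delta> (\<Delta> x)) \<in> alg_hom K (tensor_algebra K KKa)"
    unfolding tensor_map_tensor_algebra by (rule alg_hom_comp[OF \<Delta>_hom])
  have "tensor_map KKa K \<Delta> (\<lambda>u. u) \<in> alg_hom KKa (tensor_algebra KKa K)"
    by (rule tensor_map_alg_hom[OF K K KKa K \<Delta>_hom alg_hom_id])
  then have R: "(\<lambda>x. tensor_assoc K K K (tensor_map KK K \<Delta> (\<lambda>u. u) (\<Delta> x))) \<in> alg_hom K (tensor_algebra K KKa)"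
    unfolding tensor_map_tensor_algebra
    by (rule alg_hom_comp[OF alg_hom_comp[OF \<Delta>_hom] tensor_assoc_alg_hom[OF K K K]])
  note pc = pure_tensor_closed[OF K' K'] pure_tensor_closed[OF K' KK] pure_tensor_closed[OF KK K']
  note KKK = cspace_tensor[OF K' KK]
  note l = linearD(2)[OF tensor_map_linear[OF K' K' K' KK linear_id \<Delta>_linear]]
    linearD(2)[OF tensor_map_linear[OF K' K' KK K' \<Delta>_linear linear_id]]
    tensor_map_pure[OF K' K' K' KK linear_id \<Delta>_linear] tensor_map_pure[OF K' K' KK K' \<Delta>_linear linear_id]
    linearD(2)[OF tensor_assoc_linear[OF K' K' K']] tensor_assoc_pure[OF K' K' K']
  have gen: "tensor_map K KK (\<lambda>u. u) \<Delta> (\<Delta> (y n i j)) = tensor_assoc K K K (tensor_map KK K \<Delta> (\<lambda>u. u) (\<Delta> (y n i j)))" for n i j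
    by (simp add: \<Delta>_y l y(1) pc linearD(1)[OF \<Delta>_linear] pure_tensor_add_left[OF KK K'] pure_tensor_add_right[OF K' KK]
      abelian_groupD[OF cspaceD(1)[OF KK]] abelian_groupD[OF cspaceD(1)[OF cspace_tensor[OF KK K']]])
     (rule abelian_group_interchange[OF cspaceD(1)[OF KKK]]; simp add: y(1) pc)
  show ?thesis
    by (rule alg_hom_eqI[OF L R _ assms]) (use gen in \<open>auto simp: y_def\<close>)
qed

lemma K_counit_left:
  assumes "x \<in> carrier K"
  shows "tensor_lift K (\<lambda>u v. \<epsilon> u \<odot>\<^bsub>K\<^esub> v) (\<Delta> x) = x"
proof -
  have bi: "bilinear K K K (\<lambda>u v. \<epsilon> u \<odot>\<^bsub>K\<^esub> v)"
    by (intro bilinearI left_module_homI)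
      (simp_all add: K_laws \<epsilon> mult.commute[of "\<epsilon> _"] flip: cspaceD(5)[OF K'])
  have h: "tensor_lift K (\<lambda>u v. \<epsilon> u \<odot>\<^bsub>K\<^esub> v) \<in> alg_hom KKa K"
    by (rule tensor_lift_alg_hom[OF K K K bi])
      (simp_all add: \<epsilon> K_laws mult.commute flip: cspaceD(5)[OF K'])
  note l = alg_hom_comp[OF \<Delta>_hom h]
  have "tensor_lift K (\<lambda>u v. \<epsilon> u \<odot>\<^bsub>K\<^esub> v) (\<Delta> (y n i j)) = y n i j" for n i j
    using two_cases[of i]
    by (auto simp: \<Delta>_y linearD(2)[OF tensor_lift_linear[OF K' K' K' bi]] pure_tensor_closed K' y(1)
      tensor_lift_pure[OF K' K' K' bi] \<epsilon>_y K_laws smult_zero[OF K'])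
  then show ?thesis
    by (intro alg_hom_eqI[OF l alg_hom_id _ assms]) (auto simp: y_def)
qed

lemma K_counit_right:
  assumes "x \<in> carrier K"
  shows "tensor_lift K (\<lambda>u v. \<epsilon> v \<odot>\<^bsub>K\<^esub> u) (\<Delta> x) = x"
proof -
  have bi: "bilinear K K K (\<lambda>u v. \<epsilon> v \<odot>\<^bsub>K\<^esub> u)"
    by (intro bilinearI left_module_homI)
      (simp_all add: K_laws \<epsilon> mult.commute[of "\<epsilon> _"] flip: cspaceD(5)[OF K'])
  have h: "tensor_lift K (\<lambda>u v. \<epsilon> v \<odot>\<^bsub>K\<^esub> u) \<in> alg_hom KKa K"
    by (rule tensor_lift_alg_hom[OF K K K bi])
      (simp_all add: \<epsilon> K_laws mult.commute flip: cspaceD(5)[OF K'])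
  note l = alg_hom_comp[OF \<Delta>_hom h]
  have "tensor_lift K (\<lambda>u v. \<epsilon> v \<odot>\<^bsub>K\<^esub> u) (\<Delta> (y n i j)) = y n i j" for n i j
    using two_cases[of j]
    by (auto simp: \<Delta>_y linearD(2)[OF tensor_lift_linear[OF K' K' K' bi]] pure_tensor_closed K' y(1)
      tensor_lift_pure[OF K' K' K' bi] \<epsilon>_y K_laws smult_zero[OF K'])
  then show ?thesis
    by (intro alg_hom_eqI[OF l alg_hom_id _ assms]) (auto simp: y_def)
qed

lemma S_bilinear:
  "bilinear K K K (\<lambda>u v. S u \<otimes>\<^bsub>K\<^esub> v)" "bilinear K K K (\<lambda>u v. u \<otimes>\<^bsub>K\<^esub> S v)"
  using bilinear_comp[OF bilinear_mult[OF K] S_linear linear_id linear_id]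
    bilinear_comp[OF bilinear_mult[OF K] linear_id S_linear linear_id] by simp_all

text \<open>Both convolutions with the antipode are computed on a product \<open>X Y\<close> from inside out, which
  makes the antipode equations multiplicative.\<close>

lemma antipode_left_mult:
  assumes X: "X \<in> carrier KK" and Y: "Y \<in> carrier KK"
    and eX: "tensor_lift K (\<lambda>u v. S u \<otimes>\<^bsub>K\<^esub> v) X = c \<odot>\<^bsub>K\<^esub> \<one>\<^bsub>K\<^esub>"
  shows "tensor_lift K (\<lambda>u v. S u \<otimes>\<^bsub>K\<^esub> v) (X \<otimes>\<^bsub>KKa\<^esub> Y) = c \<odot>\<^bsub>K\<^esub> tensor_lift K (\<lambda>u v. S u \<otimes>\<^bsub>K\<^esub> v) Y"
proof -
  let ?m = "tensor_lift K (\<lambda>u v. S u \<otimes>\<^bsub>K\<^esub> v)"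
  note m = linearD[OF tensor_lift_linear[OF K' K' K' S_bilinear(1)]] and mp = tensor_lift_pure[OF K' K' K' S_bilinear(1)]
  note t = bilinearD[OF bilinear_tensor_mult[OF K K]] and tp = tensor_mult_pure[OF K K]
  note pc = pure_tensor_closed[OF K' K']
  note s = m mp t tp pc K_laws(4,8) linearD(1)[OF S_linear] S bilinearD[OF bilinear_mult[OF K]]
  have *: "?m (X' \<otimes>\<^bsub>KKa\<^esub> pure_tensor K K u v) = S u \<otimes>\<^bsub>K\<^esub> ?m X' \<otimes>\<^bsub>K\<^esub> v"
    if "X' \<in> carrier KK" "u \<in> carrier K" "v \<in> carrier K" for X' u v
    using that(1)
    by (induction X' rule: tensor_induct[OF K' K', consumes 1, case_names pure add])
      (use that(2,3) in \<open>simp_all add: s\<close>)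
  show ?thesis
    using Y
    by (induction Y rule: tensor_induct[OF K' K', consumes 1, case_names pure add])
      (use X eX in \<open>simp_all add: * mp m t K_laws linearD(1)[OF S_linear]\<close>)
qed

lemma antipode_right_mult:
  assumes X: "X \<in> carrier KK" and Y: "Y \<in> carrier KK"
    and eY: "tensor_lift K (\<lambda>u v. u \<otimes>\<^bsub>K\<^esub> S v) Y = c \<odot>\<^bsub>K\<^esub> \<one>\<^bsub>K\<^esub>"
  shows "tensor_lift K (\<lambda>u v. u \<otimes>\<^bsub>K\<^esub> S v) (X \<otimes>\<^bsub>KKa\<^esub> Y) = c \<odot>\<^bsub>K\<^esub> tensor_lift K (\<lambda>u v. u \<otimes>\<^bsub>K\<^esub> S v) X"
proof -
  let ?m = "tensor_lift K (\<lambda>u v. u \<otimes>\<^bsub>K\<^esub> S v)"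
  note m = linearD[OF tensor_lift_linear[OF K' K' K' S_bilinear(2)]] and mp = tensor_lift_pure[OF K' K' K' S_bilinear(2)]
  note t = bilinearD[OF bilinear_tensor_mult[OF K K]] and tp = tensor_mult_pure[OF K K]
  note pc = pure_tensor_closed[OF K' K']
  note s = m mp t tp pc K_laws(4,8) linearD(1)[OF S_linear] S bilinearD[OF bilinear_mult[OF K]]
  have *: "?m (pure_tensor K K u v \<otimes>\<^bsub>KKa\<^esub> Y') = u \<otimes>\<^bsub>K\<^esub> ?m Y' \<otimes>\<^bsub>K\<^esub> S v"
    if "Y' \<in> carrier KK" "u \<in> carrier K" "v \<in> carrier K" for Y' u v
    using that(1)
    by (induction Y' rule: tensor_induct[OF K' K', consumes 1, case_names pure add])
      (use that(2,3) in \<open>simp_all add: s\<close>)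
  show ?thesis
    using X
    by (induction X rule: tensor_induct[OF K' K', consumes 1, case_names pure add])
      (use Y eY in \<open>simp_all add: * mp m t K_laws linearD(1)[OF S_linear]\<close>)
qed

text \<open>The convolutions are not obviously homomorphisms, since \<open>S\<close> reverses
  products; hence an induction over products with the two preceding lemmas. On generators the two
  equations are precisely the two kinds of Takeuchi relations.\<close>

lemma K_antipode:
  assumes "x \<in> carrier K"
  shows "tensor_lift K (\<lambda>u v. S u \<otimes>\<^bsub>K\<^esub> v) (\<Delta> x) = \<epsilon> x \<odot>\<^bsub>K\<^esub> \<one>\<^bsub>K\<^esub> \<and>
    tensor_lift K (\<lambda>u v. u \<otimes>\<^bsub>K\<^esub> S v) (\<Delta> x) = \<epsilon> x \<odot>\<^bsub>K\<^esub> \<one>\<^bsub>K\<^esub>"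
proof -
  note l = linearD[OF tensor_lift_linear[OF K' K' K' S_bilinear(1)]] linearD[OF tensor_lift_linear[OF K' K' K' S_bilinear(2)]]
  note lp = tensor_lift_pure[OF K' K' K' S_bilinear(1)] tensor_lift_pure[OF K' K' K' S_bilinear(2)]
  note \<Delta> = linearD[OF \<Delta>_linear]
  show ?thesis
    using assms
  proof (rule p_induct)
    fix z :: "nat \<times> 2 \<times> 2"
    obtain n i j where z: "z = (n, i, j)" by (cases z)
    show "tensor_lift K (\<lambda>u v. S u \<otimes>\<^bsub>K\<^esub> v) (\<Delta> (p (Gen z))) = \<epsilon> (p (Gen z)) \<odot>\<^bsub>K\<^esub> \<one>\<^bsub>K\<^esub> \<and>
      tensor_lift K (\<lambda>u v. u \<otimes>\<^bsub>K\<^esub> S v) (\<Delta> (p (Gen z))) = \<epsilon> (p (Gen z)) \<odot>\<^bsub>K\<^esub> \<one>\<^bsub>K\<^esub>"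
      unfolding z y_def[symmetric]
      by (simp add: \<Delta>_y \<epsilon>_y l lp pure_tensor_closed[OF K' K'] y S_y)
  next
    show "tensor_lift K (\<lambda>u v. S u \<otimes>\<^bsub>K\<^esub> v) (\<Delta> \<one>\<^bsub>K\<^esub>) = \<epsilon> \<one>\<^bsub>K\<^esub> \<odot>\<^bsub>K\<^esub> \<one>\<^bsub>K\<^esub> \<and>
      tensor_lift K (\<lambda>u v. u \<otimes>\<^bsub>K\<^esub> S v) (\<Delta> \<one>\<^bsub>K\<^esub>) = \<epsilon> \<one>\<^bsub>K\<^esub> \<odot>\<^bsub>K\<^esub> \<one>\<^bsub>K\<^esub>"
      by (simp add: \<Delta>_one lp S \<epsilon> K_laws)
  next
    fix u v
    assume uv: "u \<in> carrier K" "v \<in> carrier K"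
      and u: "tensor_lift K (\<lambda>u v. S u \<otimes>\<^bsub>K\<^esub> v) (\<Delta> u) = \<epsilon> u \<odot>\<^bsub>K\<^esub> \<one>\<^bsub>K\<^esub> \<and>
        tensor_lift K (\<lambda>u v. u \<otimes>\<^bsub>K\<^esub> S v) (\<Delta> u) = \<epsilon> u \<odot>\<^bsub>K\<^esub> \<one>\<^bsub>K\<^esub>"
      and v: "tensor_lift K (\<lambda>u v. S u \<otimes>\<^bsub>K\<^esub> v) (\<Delta> v) = \<epsilon> v \<odot>\<^bsub>K\<^esub> \<one>\<^bsub>K\<^esub> \<and>
        tensor_lift K (\<lambda>u v. u \<otimes>\<^bsub>K\<^esub> S v) (\<Delta> v) = \<epsilon> v \<odot>\<^bsub>K\<^esub> \<one>\<^bsub>K\<^esub>"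
    show "tensor_lift K (\<lambda>u v. S u \<otimes>\<^bsub>K\<^esub> v) (\<Delta> (u \<oplus>\<^bsub>K\<^esub> v)) = \<epsilon> (u \<oplus>\<^bsub>K\<^esub> v) \<odot>\<^bsub>K\<^esub> \<one>\<^bsub>K\<^esub> \<and>
        tensor_lift K (\<lambda>u v. u \<otimes>\<^bsub>K\<^esub> S v) (\<Delta> (u \<oplus>\<^bsub>K\<^esub> v)) = \<epsilon> (u \<oplus>\<^bsub>K\<^esub> v) \<odot>\<^bsub>K\<^esub> \<one>\<^bsub>K\<^esub>"
      using uv u v by (simp add: \<Delta> l \<epsilon> K_laws)
    show "tensor_lift K (\<lambda>u v. S u \<otimes>\<^bsub>K\<^esub> v) (\<Delta> (u \<otimes>\<^bsub>K\<^esub> v)) = \<epsilon> (u \<otimes>\<^bsub>K\<^esub> v) \<odot>\<^bsub>K\<^esub> \<one>\<^bsub>K\<^esub> \<and>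
        tensor_lift K (\<lambda>u v. u \<otimes>\<^bsub>K\<^esub> S v) (\<Delta> (u \<otimes>\<^bsub>K\<^esub> v)) = \<epsilon> (u \<otimes>\<^bsub>K\<^esub> v) \<odot>\<^bsub>K\<^esub> \<one>\<^bsub>K\<^esub>"
      using uv u v antipode_left_mult[of "\<Delta> u" "\<Delta> v" "\<epsilon> u"] antipode_right_mult[of "\<Delta> u" "\<Delta> v" "\<epsilon> v"]
      by (simp add: alg_homD(3)[OF \<Delta>_hom] \<Delta>(1) \<epsilon> K_laws(5) mult.commute[of "\<epsilon> u"] flip: cspaceD(5)[OF K'])
  next
    fix c u
    assume "u \<in> carrier K" "tensor_lift K (\<lambda>u v. S u \<otimes>\<^bsub>K\<^esub> v) (\<Delta> u) = \<epsilon> u \<odot>\<^bsub>K\<^esub> \<one>\<^bsub>K\<^esub> \<and>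
        tensor_lift K (\<lambda>u v. u \<otimes>\<^bsub>K\<^esub> S v) (\<Delta> u) = \<epsilon> u \<odot>\<^bsub>K\<^esub> \<one>\<^bsub>K\<^esub>"
    then show "tensor_lift K (\<lambda>u v. S u \<otimes>\<^bsub>K\<^esub> v) (\<Delta> (c \<odot>\<^bsub>K\<^esub> u)) = \<epsilon> (c \<odot>\<^bsub>K\<^esub> u) \<odot>\<^bsub>K\<^esub> \<one>\<^bsub>K\<^esub> \<and>
        tensor_lift K (\<lambda>u v. u \<otimes>\<^bsub>K\<^esub> S v) (\<Delta> (c \<odot>\<^bsub>K\<^esub> u)) = \<epsilon> (c \<odot>\<^bsub>K\<^esub> u) \<odot>\<^bsub>K\<^esub> \<one>\<^bsub>K\<^esub>"
      by (simp add: \<Delta> l \<epsilon> K_laws)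
  qed
qed

lemma hopf_algebra_K: "hopf_algebra K"
proof -
  have "\<epsilon> \<in> linear_maps K (regular_module complex_ring)"
    by (rule left_module_homI) (simp_all add: \<epsilon>)
  then have co: "coalgebra K"
    by (intro coalgebra.intro coalgebra_axioms.intro K')
      (simp_all add: P_simps(7,8) \<Delta>_linear K_coassoc K_counit_left K_counit_right del: regular_module_simps)
  have "\<epsilon> \<in> ring_hom K complex_ring"
    by (rule ring_hom_memI) (simp_all add: \<epsilon>)
  then have "bialgebra K"
    by (intro bialgebra.intro bialgebra_axioms.intro K co)
      (simp_all add: P_simps(7,8) alg_homD(2)[OF \<Delta>_hom])
  then show ?thesis
    by (intro hopf_algebra.intro hopf_algebra_axioms.intro exI[of _ S])
      (auto simp: is_antipode_def P_simps(7,8) S_linear K_antipode)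
qed

end

section \<open>A representation in which the transpose is not invertible\<close>

text \<open>Linear operators on formal power series, given by their coefficient sequences.\<close>

definition series_endo :: "(complex, (nat \<Rightarrow> complex) \<Rightarrow> nat \<Rightarrow> complex) module" where
  "series_endo =
     \<lparr>carrier = {F. (\<forall>u v. F (\<lambda>n. u n + v n) = (\<lambda>n. F u n + F v n)) \<and> (\<forall>c u. F (\<lambda>n. c * u n) = (\<lambda>n. c * F u n))},
      monoid.mult = (\<lambda>F G u. F (G u)), one = (\<lambda>u. u),
      ring.zero = (\<lambda>u n. 0), add = (\<lambda>F G u n. F u n + G u n), smult = (\<lambda>c F u n. c * F u n)\<rparr>"

lemma series_endo_simps:
  "F \<in> carrier series_endo \<longleftrightarrow> (\<forall>u v. F (\<lambda>n. u n + v n) = (\<lambda>n. F u n + F v n)) \<and> (\<forall>c u. F (\<lambda>n. c * u n) = (\<lambda>n. c * F u n))"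
  "F \<otimes>\<^bsub>series_endo\<^esub> G = (\<lambda>u. F (G u))" "\<one>\<^bsub>series_endo\<^esub> = (\<lambda>u. u)" "\<zero>\<^bsub>series_endo\<^esub> = (\<lambda>u n. 0)"
  "F \<oplus>\<^bsub>series_endo\<^esub> G = (\<lambda>u n. F u n + G u n)" "c \<odot>\<^bsub>series_endo\<^esub> F = (\<lambda>u n. c * F u n)"
  by (simp_all add: series_endo_def)

lemma complex_algebra_series_endo: "complex_algebra series_endo"
proof (rule complex_algebraI)
  have "abelian_group series_endo"
  proof (rule abelian_groupI)
    fix F assume "F \<in> carrier series_endo"
    then show "\<exists>G\<in>carrier series_endo. G \<oplus>\<^bsub>series_endo\<^esub> F = \<zero>\<^bsub>series_endo\<^esub>"
      by (intro bexI[of _ "\<lambda>u n. - F u n"]) (auto simp: series_endo_simps)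
  qed (auto simp: series_endo_simps algebra_simps)
  then show "cspace series_endo"
    by (rule cspaceI) (auto simp: series_endo_simps algebra_simps)
  show "bilinear series_endo series_endo series_endo (\<otimes>\<^bsub>series_endo\<^esub>)"
    by (intro bilinearI left_module_homI) (auto simp: series_endo_simps algebra_simps)
qed (auto simp: series_endo_simps)

text \<open>Differentiation of a power series with coefficients \<open>u\<close>;
  \<open>raise\<close> is multiplication by the variable.\<close>

definition lower :: "(nat \<Rightarrow> complex) \<Rightarrow> nat \<Rightarrow> complex" where
  "lower u n = (of_nat n + 1) * u (Suc n)"

definition raise :: "(nat \<Rightarrow> complex) \<Rightarrow> nat \<Rightarrow> complex" where
  "raise u n = (case n of 0 \<Rightarrow> 0 | Suc m \<Rightarrow> u m)"

text \<open>With \<open>D = lower\<close> and \<open>X = raise\<close>, so \<open>D X - X D = 1\<close>, the matrices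
  \<open>[[a, a D], [a X, a D X + b]]\<close> and \<open>[[r + s D X, - s X], [- s D, s]]\<close> are inverse transposes of
  each other for \<open>r = 1/a\<close> and \<open>s = 1/(a + b)\<close>. The inverse transpose of the second matrix is of the
  first form again, with \<open>1/(r + s)\<close> and \<open>1/s\<close> for \<open>a\<close> and \<open>b\<close>. Note that \<open>D X\<close> multiplies the coefficient
  with index \<open>n\<close> by \<open>n + 1\<close>. For \<open>b = 0\<close> the transpose of the first matrix is singular.\<close>

definition weyl_even :: "complex \<Rightarrow> complex \<Rightarrow> 2 \<Rightarrow> 2 \<Rightarrow> (nat \<Rightarrow> complex) \<Rightarrow> nat \<Rightarrow> complex" where
  "weyl_even a b i j = (\<lambda>u n. if i = 0 then (if j = 0 then a * u n else a * lower u n)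
     else (if j = 0 then a * raise u n else (a * (of_nat n + 1) + b) * u n))"

definition weyl_odd :: "complex \<Rightarrow> complex \<Rightarrow> 2 \<Rightarrow> 2 \<Rightarrow> (nat \<Rightarrow> complex) \<Rightarrow> nat \<Rightarrow> complex" where
  "weyl_odd r s i j = (\<lambda>u n. if i = 0 then (if j = 0 then (r + s * (of_nat n + 1)) * u n else - s * raise u n)
     else (if j = 0 then - s * lower u n else s * u n))"

lemma weyl_closed: "weyl_even a b i j \<in> carrier series_endo" "weyl_odd r s i j \<in> carrier series_endo"
  by (auto simp: series_endo_simps weyl_even_def weyl_odd_def lower_def raise_def fun_eq_iff algebra_simps
    split: nat.split)

lemma all_two: "(\<forall>i :: 2. Q i) \<longleftrightarrow> Q 0 \<and> Q 1"
  using two_cases by metis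

text \<open>\<open>g\<close> is the Schur complement of the corner entry: a D X + b - a X D = a + b.
  Hence the matrix is inverted by inverting the scalars \<open>a\<close> and \<open>g\<close> alone.
  For the transpose the Schur complement is b.\<close>

lemma inverse_transpose_even_odd:
  assumes "a \<noteq> 0" "g \<noteq> 0"
  shows "inverse_transpose series_endo (weyl_even a (g - a)) (weyl_odd (1 / a) (1 / g))"
  using assms
  by (simp add: inverse_transpose_def all_two series_endo_simps weyl_even_def weyl_odd_def fun_eq_iff
    lower_def raise_def field_simps split: nat.split)

text \<open>Here r = 1/a - 1/g and s = 1/g. The Schur complement of the corner entry s is r + s (D X
  - X D) = r + s = 1/a, so \<open>a\<close> and \<open>g\<close> are the parameters of the even
  matrix that follows.\<close>

lemma inverse_transpose_odd_even:
  assumes "a \<noteq> 0" "g \<noteq> 0"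
  shows "inverse_transpose series_endo (weyl_odd (1 / a - 1 / g) (1 / g)) (weyl_even a g)"
  using assms
  by (simp add: inverse_transpose_def all_two series_endo_simps weyl_even_def weyl_odd_def fun_eq_iff
    lower_def raise_def field_simps split: nat.split)

text \<open>One step covers two inverse transposes: the new \<open>a\<close> is 1/(1/a + 1/(a + b))
  and the new \<open>b\<close> is a + b. The start b = 0 is what makes the first transpose singular.
  Real parameters allow a positivity argument, by which no denominator ever vanishes.\<close>

primrec weyl_params :: "nat \<Rightarrow> real \<times> real" where
  "weyl_params 0 = (1, 0)"
| "weyl_params (Suc k) = (let (a, b) = weyl_params k in (a * (a + b) / (a + (a + b)), a + b))"

lemma weyl_params_pos: "fst (weyl_params k) > 0 \<and> snd (weyl_params k) \<ge> 0"
  by (induction k) (auto simp: Let_def split: prod.splits intro!: divide_pos_pos mult_pos_pos add_pos_nonneg)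

definition weyl :: "nat \<Rightarrow> 2 \<Rightarrow> 2 \<Rightarrow> (nat \<Rightarrow> complex) \<Rightarrow> nat \<Rightarrow> complex" where
  "weyl n = (let (a, b) = weyl_params (n div 2) in
     if even n then weyl_even (of_real a) (of_real b) else weyl_odd (1 / of_real a) (1 / of_real (a + b)))"

lemma inverse_transpose_weyl: "inverse_transpose series_endo (weyl n) (weyl (Suc n))"
proof -
  obtain a b where ab: "weyl_params (n div 2) = (a, b)" by fastforce
  have pos: "a > 0" "b \<ge> 0" using weyl_params_pos[of "n div 2"] ab by auto
  define g where "g = a + b"
  define a' where "a' = a * g / (a + g)"
  have g: "g > 0" "a' > 0" unfolding g_def a'_def using pos by (auto intro!: divide_pos_pos mult_pos_pos)
  show ?thesis
  proof (cases "even n")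
    case True
    have "weyl n = weyl_even (of_real a) (of_real g - of_real a)" "weyl (Suc n) = weyl_odd (1 / of_real a) (1 / of_real g)"
      using True by (simp_all add: weyl_def ab g_def)
    then show ?thesis using inverse_transpose_even_odd[of "of_real a" "of_real g"] pos g by simp
  next
    case False
    \<comment> \<open>This is r + s = 1/a' solved for r, which brings the odd matrix into the form
      required by \<open>inverse_transpose_odd_even\<close>.\<close>
    have "1 / a = 1 / a' - 1 / g"
      using pos g by (simp add: a'_def field_simps)
    then have r: "1 / complex_of_real a = 1 / of_real a' - 1 / of_real g"
      by (metis of_real_1 of_real_diff of_real_divide)
    have "Suc n div 2 = Suc (n div 2)" using False by simp
    then have "weyl n = weyl_odd (1 / of_real a' - 1 / of_real g) (1 / of_real g)"
      "weyl (Suc n) = weyl_even (of_real a') (of_real g)"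
      unfolding r[symmetric] using False by (simp_all add: weyl_def ab g_def a'_def)
    then show ?thesis using inverse_transpose_odd_even[of "of_real a'" "of_real g"] g by simp
  qed
qed

lemma weyl_solution: "takeuchi_solution series_endo weyl"
  using inverse_transpose_weyl weyl_closed
  by (simp add: takeuchi_solution_def weyl_def Let_def split: prod.splits)

section \<open>The matrix coalgebra\<close>

lemma matrix_coeff_unit: "matrix_coeff i j (matrix_unit i' j') = (if i = i' \<and> j = j' then 1 else 0)"
  by (simp add: matrix_coeff_def matrix_unit_def)

lemma matrix_coalgebra_simps:
  "f \<in> carrier matrix_coalgebra \<longleftrightarrow>
     (\<forall>X Y. f (X + Y) = f X + f Y) \<and> (\<forall>c X. f (map_matrix ((*) c) X) = c * f X)"
  "f \<oplus>\<^bsub>matrix_coalgebra\<^esub> g = (\<lambda>X. f X + g X)" "c \<odot>\<^bsub>matrix_coalgebra\<^esub> f = (\<lambda>X. c * f X)"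
  "comult matrix_coalgebra = matrix_comult" "counit matrix_coalgebra f = f (mat 1)"
  by (simp_all add: matrix_coalgebra_def matrix_dual_def)

lemma matrix_coeff_closed: "matrix_coeff i j \<in> carrier matrix_coalgebra"
  by (simp add: matrix_coalgebra_simps matrix_coeff_def map_matrix_def)

lemma finsum_two:
  assumes "abelian_group G" "f 0 \<in> carrier G" "f 1 \<in> carrier G"
  shows "(\<Oplus>\<^bsub>G\<^esub>i\<in>(UNIV :: 2 set). f i) = f 0 \<oplus>\<^bsub>G\<^esub> f 1"
proof -
  interpret abelian_group G by fact
  show ?thesis using assms(2,3) by (simp add: UNIV_two)
qed

lemma matrix_comult_expand:
  assumes C: "cspace matrix_coalgebra"
  defines "T \<equiv> tensor_space matrix_coalgebra matrix_coalgebra"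
  defines "t \<equiv> \<lambda>f i j l. f (matrix_unit i j) \<odot>\<^bsub>T\<^esub>
    pure_tensor matrix_coalgebra matrix_coalgebra (matrix_coeff i l) (matrix_coeff l j)"
  shows "matrix_comult f = ((t f 0 0 0 \<oplus>\<^bsub>T\<^esub> t f 0 0 1) \<oplus>\<^bsub>T\<^esub> (t f 0 1 0 \<oplus>\<^bsub>T\<^esub> t f 0 1 1)) \<oplus>\<^bsub>T\<^esub>
    ((t f 1 0 0 \<oplus>\<^bsub>T\<^esub> t f 1 0 1) \<oplus>\<^bsub>T\<^esub> (t f 1 1 0 \<oplus>\<^bsub>T\<^esub> t f 1 1 1))"
proof -
  have eq: "tensor_space matrix_dual matrix_dual = T"
    "pure_tensor matrix_dual matrix_dual = pure_tensor matrix_coalgebra matrix_coalgebra"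
    unfolding T_def by (rule tensor_space_cong; simp add: matrix_coalgebra_def)+
  have T: "cspace T" unfolding T_def by (rule cspace_tensor[OF C C])
  note ag = cspaceD(1)[OF T]
  have t: "t f i j l \<in> carrier T" for i j l
    unfolding t_def
    by (rule cspaceD(2)[OF T]) (simp add: T_def pure_tensor_closed[OF C C] matrix_coeff_closed)
  have "matrix_comult f = (\<Oplus>\<^bsub>T\<^esub>i\<in>UNIV. \<Oplus>\<^bsub>T\<^esub>j\<in>UNIV. \<Oplus>\<^bsub>T\<^esub>l\<in>UNIV. t f i j l)"
    unfolding matrix_comult_def Let_def eq t_def ..
  also have "\<dots> = ((t f 0 0 0 \<oplus>\<^bsub>T\<^esub> t f 0 0 1) \<oplus>\<^bsub>T\<^esub> (t f 0 1 0 \<oplus>\<^bsub>T\<^esub> t f 0 1 1)) \<oplus>\<^bsub>T\<^esub>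
    ((t f 1 0 0 \<oplus>\<^bsub>T\<^esub> t f 1 0 1) \<oplus>\<^bsub>T\<^esub> (t f 1 1 0 \<oplus>\<^bsub>T\<^esub> t f 1 1 1))"
    by (simp add: finsum_two[OF ag] t abelian_groupD(1)[OF ag])
  finally show ?thesis .
qed

text \<open>A matrix coefficient is 1 on one matrix unit and 0 on the other three, so two of the
  eight terms remain.\<close>

lemma matrix_comult_coeff:
  assumes C: "cspace matrix_coalgebra"
  shows "matrix_comult (matrix_coeff i j) =
    pure_tensor matrix_coalgebra matrix_coalgebra (matrix_coeff i 0) (matrix_coeff 0 j)
      \<oplus>\<^bsub>tensor_space matrix_coalgebra matrix_coalgebra\<^esub>
    pure_tensor matrix_coalgebra matrix_coalgebra (matrix_coeff i 1) (matrix_coeff 1 j)"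
proof -
  note T = cspace_tensor[OF C C]
  note pc = pure_tensor_closed[OF C C matrix_coeff_closed matrix_coeff_closed]
  show ?thesis
    using two_cases[of i] two_cases[of j]
    by (elim disjE) (simp_all add: matrix_comult_expand[OF C] matrix_coeff_unit smult_zero[OF T pc] cspaceD(6)[OF T pc]
      abelian_groupD[OF cspaceD(1)[OF T]] pc)
qed

lemma matrix_hopf_algebra_hom:
  assumes C: "cspace matrix_coalgebra" and H: "hopf_algebra H" and f: "f \<in> coalgebra_hom matrix_coalgebra H"
  shows "matrix_hopf_algebra H (\<lambda>i j. f (matrix_coeff i j))"
proof -
  interpret H: hopf_algebra H by (rule H)
  have H': "cspace H" by (rule H.module_axioms)
  have lin: "f \<in> linear_maps matrix_coalgebra H"
    and co: "\<And>x. x \<in> carrier matrix_coalgebra \<Longrightarrow> comult H (f x) = tensor_map H H f f (matrix_comult x)"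
    and eps: "\<And>x. x \<in> carrier matrix_coalgebra \<Longrightarrow> counit H (f x) = x (mat 1)"
    using f by (auto simp: coalgebra_hom_def matrix_coalgebra_simps(4,5))
  note pc = pure_tensor_closed[OF C C matrix_coeff_closed matrix_coeff_closed]
  show ?thesis
  proof (intro matrix_hopf_algebra.intro matrix_hopf_algebra_axioms.intro H)
    fix i j
    show "f (matrix_coeff i j) \<in> carrier H"
      by (rule linearD(1)[OF lin matrix_coeff_closed])
    show "comult H (f (matrix_coeff i j)) = pure_tensor H H (f (matrix_coeff i 0)) (f (matrix_coeff 0 j))
        \<oplus>\<^bsub>tensor_space H H\<^esub> pure_tensor H H (f (matrix_coeff i 1)) (f (matrix_coeff 1 j))"
      by (simp add: co matrix_coeff_closed matrix_comult_coeff[OF C] linearD(2)[OF tensor_map_linear[OF C C H' H' lin lin]]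
        tensor_map_pure[OF C C H' H' lin lin] pc)
    show "counit H (f (matrix_coeff i j)) = (if i = j then 1 else 0)"
      by (simp add: eps matrix_coeff_closed) (simp add: matrix_coeff_def mat_def)
  qed
qed

section \<open>The coalgebra map from the matrix coalgebra into Takeuchi's algebra\<close>

context takeuchi_presentation
begin

text \<open>A functional is expanded in matrix coefficients, its values on the matrix units being
  the coordinates, and the coefficients are sent to the entries of y_0. The later matrices y_n are
  reached from y_0 by the antipode.\<close>

definition coeff_map :: "(matrix2 \<Rightarrow> complex) \<Rightarrow> 'h" where
  "coeff_map f = (f (matrix_unit 0 0) \<odot>\<^bsub>K\<^esub> y 0 0 0 \<oplus>\<^bsub>K\<^esub> f (matrix_unit 0 1) \<odot>\<^bsub>K\<^esub> y 0 0 1) \<oplus>\<^bsub>K\<^esub>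
    (f (matrix_unit 1 0) \<odot>\<^bsub>K\<^esub> y 0 1 0 \<oplus>\<^bsub>K\<^esub> f (matrix_unit 1 1) \<odot>\<^bsub>K\<^esub> y 0 1 1)"

lemma coeff_map_coeff: "coeff_map (matrix_coeff i j) = y 0 i j"
  using two_cases[of i] two_cases[of j]
  by (elim disjE) (simp_all add: coeff_map_def matrix_coeff_unit K_laws y(1) smult_zero[OF K'])

lemma coeff_map_linear: "coeff_map \<in> linear_maps matrix_coalgebra K"
proof -
  have lin: "(\<lambda>f. f X \<odot>\<^bsub>K\<^esub> u) \<in> linear_maps matrix_coalgebra K" if "u \<in> carrier K" for X u
    by (rule left_module_homI) (simp_all add: matrix_coalgebra_simps(2,3) K_laws that)
  show ?thesis
    unfolding coeff_map_def by (intro linear_add K' lin y(1))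
qed

lemma coeff_map_hom:
  assumes C: "cspace matrix_coalgebra"
  shows "coeff_map \<in> coalgebra_hom matrix_coalgebra K"
  unfolding coalgebra_hom_def P_simps(7,8) matrix_coalgebra_simps(4,5)
proof (intro CollectI conjI ballI coeff_map_linear)
  fix f
  assume f: "f \<in> carrier matrix_coalgebra"
  note l = linearD(2,3)[OF tensor_map_linear[OF C C K' K' coeff_map_linear coeff_map_linear]]
  note pc = pure_tensor_closed[OF C C matrix_coeff_closed matrix_coeff_closed]
  note T = cspace_tensor[OF C C]
  show "\<Delta> (coeff_map f) = tensor_map K K coeff_map coeff_map (matrix_comult f)"
    by (simp add: matrix_comult_expand[OF C] l pc cspaceD(2)[OF T] abelian_groupD(1)[OF cspaceD(1)[OF T]]
      tensor_map_pure[OF C C K' K' coeff_map_linear coeff_map_linear] matrix_coeff_closed coeff_map_coeff)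
     (simp add: coeff_map_def linearD[OF \<Delta>_linear] K_laws y(1) \<Delta>_y cspaceD(4)[OF KK] pure_tensor_closed[OF K' K'])
  have "(mat 1 :: matrix2) = matrix_unit 0 0 + matrix_unit 1 1"
    using two_cases by (auto simp: vec_eq_iff mat_def matrix_unit_def)
  then show "\<epsilon> (coeff_map f) = f (mat 1)"
    using f by (simp add: coeff_map_def \<epsilon> \<epsilon>_y K_laws y(1) matrix_coalgebra_simps(1))
qed

end

text \<open>The two indices form the remainder modulo 4. The code is a complex number because scalar
  multiples of the unit of \<open>H\<close> carry such numbers into the type
  \<open>'h\<close>.\<close>

lemma inj_generator:
  "inj (\<lambda>(n :: nat, i :: 2, j :: 2). complex_of_nat (4 * n + (if i = 0 then 0 else 2) + (if j = 0 then 0 else 1)))"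
    (is "inj ?f")
proof (rule injI)
  fix x y assume "?f x = ?f y"
  moreover obtain n i j m k l where xy: "x = (n, i, j)" "y = (m, k, l)"
    by (cases x, cases y) auto
  ultimately have "4 * n + (if i = 0 then 0 else 2) + (if j = 0 then 0 else 1) =
    4 * m + (if k = 0 then 0 else 2) + (if l = 0 then 0 else 1 :: nat)"
    by (simp only: of_nat_eq_iff prod.case)
  then have "n = m \<and> (i = 0 \<longleftrightarrow> k = 0) \<and> (j = 0 \<longleftrightarrow> l = 0)"
    by (cases "i = 0"; cases "j = 0"; cases "k = 0"; cases "l = 0"; simp; arith)
  then show "x = y"
    using two_cases[of i] two_cases[of j] two_cases[of k] two_cases[of l] by (auto simp: xy)
qed

text \<open>The counit recovers \<open>c\<close> from \<open>c \<odot> \<one>\<close>. This is the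
  copy of the complex numbers in \<open>'h\<close> on which the coding of terms rests.\<close>

lemma (in bialgebra) inj_scalars: "inj (\<lambda>c. c \<odot> \<one>)"
proof (rule injI)
  fix c d
  assume "c \<odot> \<one> = d \<odot> \<one>"
  moreover have "counit H (c \<odot> \<one>) = c * counit H \<one>" for c
    using linearD(3)[OF counit_linear, of \<one> c] by simp
  moreover have "counit H \<one> = 1"
    using ring_hom_one[OF counit_ring_hom] by simp
  ultimately show "c = d" by (metis mult.right_neutral)
qed

text \<open>Through the representation the matrix \<open>a\<close> acts as \<open>[[1, D], [X, D X]]\<close>,
  whose transpose annihilates \<open>(- X 1, 1)\<close>.\<close>

lemma ex_annihilated:
  fixes H :: "'h coalg"
  assumes free: "free_hopf_algebra matrix_coalgebra H \<iota>"
  shows "\<exists>(W :: ('h, nat \<Rightarrow> complex) module) w0 w1. left_module H W \<and> w0 \<in> carrier W \<and> w1 \<in> carrier W \<and> w1 \<noteq> \<zero>\<^bsub>W\<^esub> \<and>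
    (\<forall>q. \<iota> (matrix_coeff 0 q) \<odot>\<^bsub>W\<^esub> w0 \<oplus>\<^bsub>W\<^esub> \<iota> (matrix_coeff 1 q) \<odot>\<^bsub>W\<^esub> w1 = \<zero>\<^bsub>W\<^esub>)"
proof -
  from free have "coalgebra matrix_coalgebra" and Hh: "hopf_algebra H"
    and univ: "\<And>(K :: 'h coalg) f. hopf_algebra K \<Longrightarrow> f \<in> coalgebra_hom matrix_coalgebra K \<Longrightarrow>
      \<exists>g \<in> hopf_hom H K. \<forall>c\<in>carrier matrix_coalgebra. g (\<iota> c) = f c"
    unfolding free_hopf_algebra_def by blast+
  then have C: "cspace matrix_coalgebra" by (simp add: coalgebra_def)
  interpret H: hopf_algebra H by (rule Hh)
  obtain p :: "(nat \<times> 2 \<times> 2) alg_term \<Rightarrow> 'h" where "\<forall>s t. p s = p t \<longleftrightarrow> presented_eq takeuchi_relations s t"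
    using ex_presentation[OF H.inj_scalars inj_compose[OF H.inj_scalars inj_generator]] by blast
  then interpret takeuchi_presentation p by unfold_locales simp
  obtain g where g: "g \<in> hopf_hom H K" "\<And>c. c \<in> carrier matrix_coalgebra \<Longrightarrow> g (\<iota> c) = coeff_map c"
    using univ[OF hopf_algebra_K coeff_map_hom[OF C]] by blast
  have ghom: "g \<in> alg_hom H K"
    using g(1) by (auto simp: hopf_hom_def coalgebra_hom_def alg_hom_def)
  \<comment> \<open>The representation of Takeuchi's algebra on power series, pulled back along
    \<open>g\<close>; it makes the space of power series an \<open>H\<close>-module
    \<open>W\<close>.\<close>
  define \<phi> where "\<phi> h = presented_lift p series_endo (\<lambda>(n, i, j). weyl n i j) (g h)" for h
  note lift = takeuchi_lift[OF complex_algebra_series_endo weyl_solution]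
  have \<phi>: "\<phi> \<in> alg_hom H series_endo"
    unfolding \<phi>_def by (rule alg_hom_comp[OF ghom lift(1)])
  have \<phi>_coeff: "\<phi> (\<iota> (matrix_coeff i j)) = weyl_even 1 0 i j" for i j
  proof -
    have "weyl 0 = weyl_even 1 0" by (simp add: weyl_def)
    then show ?thesis
      by (simp add: \<phi>_def g(2) matrix_coeff_closed coeff_map_coeff lift(2))
  qed
  define W :: "('h, nat \<Rightarrow> complex) module" where
    "W = \<lparr>carrier = UNIV, monoid.mult = undefined, one = undefined, ring.zero = (\<lambda>n. 0),
      add = (\<lambda>u v n. u n + v n), smult = \<phi>\<rparr>"
  have W_simps: "carrier W = UNIV" "\<zero>\<^bsub>W\<^esub> = (\<lambda>n. 0)" "u \<oplus>\<^bsub>W\<^esub> v = (\<lambda>n. u n + v n)" "h \<odot>\<^bsub>W\<^esub> u = \<phi> h u" for u v h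
    by (simp_all add: W_def)
  have "abelian_group W"
  proof (rule abelian_groupI)
    fix u assume "u \<in> carrier W"
    show "\<exists>v\<in>carrier W. v \<oplus>\<^bsub>W\<^esub> u = \<zero>\<^bsub>W\<^esub>"
      by (rule bexI[of _ "\<lambda>n. - u n"]) (auto simp: W_simps)
  qed (auto simp: W_simps algebra_simps)
  moreover have "\<phi> h (\<lambda>n. u n + v n) = (\<lambda>n. \<phi> h u n + \<phi> h v n)" if "h \<in> carrier H" for h u v
    using linearD(1)[OF alg_homD(1)[OF \<phi>] that] by (simp add: series_endo_simps)
  ultimately have "left_module H W"
    by (intro left_module.intro left_module_axioms.intro H.ring_axioms)
      (simp_all add: W_simps alg_homD(3,4)[OF \<phi>] linearD(2)[OF alg_homD(1)[OF \<phi>]] series_endo_simps)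
  \<comment> \<open>\<open>w1\<close> is the constant series 1 and \<open>w0\<close> is minus the
    variable. Column 0 gives - X 1 + X 1 and column 1 gives - D X 1 + D X 1, both zero.\<close>
  moreover define w1 :: "nat \<Rightarrow> complex" where "w1 n = (if n = 0 then 1 else 0)" for n
  moreover define w0 where "w0 n = - raise w1 n" for n
  moreover have "w1 \<noteq> (\<lambda>n. 0)"
    by (auto simp: w1_def fun_eq_iff)
  moreover have "\<iota> (matrix_coeff 0 q) \<odot>\<^bsub>W\<^esub> w0 \<oplus>\<^bsub>W\<^esub> \<iota> (matrix_coeff 1 q) \<odot>\<^bsub>W\<^esub> w1 = \<zero>\<^bsub>W\<^esub>" for q
    using two_cases[of q]
    by (auto simp: W_simps \<phi>_coeff weyl_even_def w0_def raise_def lower_def fun_eq_iff)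
  ultimately show ?thesis
    by (intro exI[of _ W] exI[of _ w0] exI[of _ w1]) (simp add: W_simps)
qed

theorem mainTheorem2:
  fixes H :: "'h coalg" and \<iota> :: "(matrix2 \<Rightarrow> complex) \<Rightarrow> 'h"
  assumes "free_hopf_algebra matrix_coalgebra H \<iota>"
  shows "let a = (\<lambda>i j. \<iota> (matrix_coeff i j));
             M = free_module2 H;
             \<delta> = twisted_coaction H a;
             HH = tensor_algebra H H;
             source = induced_module H H (comult H) M;
             target = tensor_left_module H M H;
             \<rho> = induced_map H H M \<delta>
         in relative_hopf_module H H (comult H) M \<delta> \<and>
            \<rho> \<in> left_module_hom HH source target \<and>
            (\<forall>x\<in>carrier HH. \<forall>m\<in>carrier M.
               \<rho> (induced_pure H H (comult H) M x m) = x \<odot>\<^bsub>target\<^esub> \<delta> m) \<and>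
            \<rho> \<notin> left_module_iso HH source target"
proof -
  from assms have "coalgebra matrix_coalgebra" and H: "hopf_algebra H"
    and \<iota>: "\<iota> \<in> coalgebra_hom matrix_coalgebra H"
    by (simp_all add: free_hopf_algebra_def)
  then have C: "cspace matrix_coalgebra" by (simp add: coalgebra_def)
  interpret matrix_hopf_algebra H "\<lambda>i j. \<iota> (matrix_coeff i j)"
    by (rule matrix_hopf_algebra_hom[OF C H \<iota>])
  obtain W :: "('h, nat \<Rightarrow> complex) module" and w0 w1 where
    "left_module H W" "w0 \<in> carrier W" "w1 \<in> carrier W" "w1 \<noteq> \<zero>\<^bsub>W\<^esub>"
    "\<And>q. \<iota> (matrix_coeff 0 q) \<odot>\<^bsub>W\<^esub> w0 \<oplus>\<^bsub>W\<^esub> \<iota> (matrix_coeff 1 q) \<odot>\<^bsub>W\<^esub> w1 = \<zero>\<^bsub>W\<^esub>"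
    using ex_annihilated[OF assms] by blast
  then have "\<rho> ` carrier source \<noteq> carrier N"
    by (rule induced_map_not_surj)
  then have "\<rho> \<notin> left_module_iso (tensor_algebra H H) source N"
    by (auto simp: left_module_iso_def bij_betw_def)
  then show ?thesis
    unfolding Let_def
    using relative_hopf_module_twisted induced_map_hom induced_map_pure
    by (simp add: tensor_algebra_simps[OF local.H local.H])
qed

end
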